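(* Let $\sigma>0$, let $\Phi:\Theta\to\mathbb{R}$ be a $\mathcal{C}^1$ functional, $\hat\Psi_0$ an estimator, $V$ a $\mathcal{C}^1$ vector field, let $\pi$ be $\mathcal{C}^1$, and let $\chi_n:\Theta\to[0,1]$ be a sequence of compactly supported $\mathcal{C}^1$ functions such that $$A_0:=1-\Pi_n[\chi_n]=o_p(1),\qquad A_1:=\Pi_n\left[|\langle\nabla\chi_n|V\rangle|\right]=o_p(\sqrt n).$$ Put $\hat\Phi=\Phi+n^{-1}\langle V|\nabla\ell_n\rangle$. 1. If (a) $A_2:=\sup_{\mathrm{supp}(\chi_n)}|\hat\Phi-\hat\Psi_0+n^{-1}\mathrm{Div}_\pi V|=o_p(n^{-1/2})$ and (b) $A_3:=\sup_{\mathrm{supp}(\chi_n)}|\sigma^2-\langle\nabla\Phi|V\rangle|=o_p(1)$, then with $Z_n=\sqrt n(\Phi-\hat\Psi_0)$, $$d_{BL}\left(\Pi_n\circ Z_n^{-1},\mathcal{N}(0,\sigma^2)\right)\le4\left(A_0+\sigma^{-1}\frac{A_1}{\sqrt n(1-A_0)}+\sigma^{-1}\sqrt nA_2+\sigma^{-2}A_3\right)=o_p(1).$$ 2. If in addition to the assumptions preceding item 1 one has $\mathrm{Div}_\pi V\in\mathcal{C}^1$, and (a) $A_2:=\sup_{\mathrm{supp}(\chi_n)}|\hat\Phi-\hat\Psi_0|=o_p(n^{-1/2})$ and (b) $A_3:=\sup_{\mathrm{supp}(\chi_n)}|\sigma^2-\langle\nabla\Phi|V\rangle+n^{-1}\langle\nabla\mathrm{Div}_\pi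 V|V\rangle|=o_p(1)$, then with $Z_n=\sqrt n(\Phi-n^{-1}\mathrm{Div}_\pi V-\hat\Psi_0)$, $$d_{BL}\left(\Pi_n\circ Z_n^{-1},\mathcal{N}(0,\sigma^2)\right)\le4\left(A_0+\sigma^{-1}\frac{A_1}{\sqrt n(1-A_0)}+\sigma^{-1}\sqrt nA_2+\sigma^{-2}A_3\right)=o_p(1).$$ (The upper bounds are read as $+\infty$ on the event $A_0=1$.)
   Context: Setting. $\{P_\theta:\theta\in\Theta\}$ is a statistical model on a measurable space, dominated by a measure $\lambda$, where $\Theta$ is a manifold without boundary of finite dimension $p$. Write $\ell(\theta,x)=\ln\frac{dP_\theta}{d\lambda}(x)$, assumed $\mathcal{C}^1$ in $\theta$. $\Theta$ carries the Fisher information metric, given in local coordinates by $g_{\mu\nu}(\theta)=\int(\partial_\mu\ell)(\partial_\nu\ell)\,dP_\theta$, assumed to be a well-defined (smooth) Riemannian metric; $\langle\cdot|\cdot\rangle$, $\nabla$, $\mathrm{Div}$, $\mathrm{vol}_\Theta$ are the associated inner product, gradient, divergence and Riemannian volume. The model, $\Theta$, $p$, the prior, $\Phi$, $\hat\Psi_0$ and $V$ may all depend on $n$; $\sigma$ does not. Prior and posterior. $\Pi$ is a (possibly improper) measure on $\Theta$ with an everywhere positive density $\pi$ with respect to $\mathrm{vol}_\Theta$. The data are $X^n=(X_1,\dots,X_n)$ i.i.d. from some probability distribution $\mathbb{P}_0$ (not necessarily in the model), and all $o_p$, $O_p$ are with respect to $X^n\sim\mathbb{P}_0^n$ as $n\to\infty$.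 $\ell_n(\theta)=\sum_{i=1}^n\ell(\theta,X_i)$; it is assumed that $e^{\ell_n}\in L^1(\Pi)$, and the posterior is $\Pi_n(d\theta)=e^{\ell_n(\theta)}\Pi(d\theta)/\int e^{\ell_n}d\Pi$. For a measure $\mu$ and a function $f$, $\mu[f]=\int f\,d\mu$. An estimator is a real-valued $X^n$-measurable random variable. The weighted divergence is $\mathrm{Div}_\pi V=\mathrm{Div}V+\langle V|\nabla\ln\pi\rangle$. $\Pi_n\circ Z_n^{-1}$ is the law of $Z_n(\theta)$ when $\theta\sim\Pi_n$ (with $X^n$ fixed). Bounded Lipschitz distance: for probability measures $\mu,\nu$ on $\mathbb{R}$, $d_{BL}(\mu,\nu)=\sup\{|\int h\,d(\mu-\nu)|:\ h:\mathbb{R}\to[-1,1],\ |h(x)-h(y)|\le|x-y|\ \forall x,y\}$. *)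

theory Defs
  imports "HOL-Probability.Probability" "Jordan_Normal_Form.Determinant"
begin

section \<open>Differentiability on open subsets of coordinate space\<close>

text \<open>
  The dimension of the manifold is allowed to vary along a sequence, so it cannot be a type.
  Coordinate space of dimension \<open>p\<close> consists of the extensional functions on \<open>{..<p}\<close>, with the
  product topology and, as Lebesgue measure, the product measure
  \<open>\<Pi>\<^sub>M i\<in>{..<p}. lborel\<close>, which lives on the same set of points.
\<close>

definition coord_space :: "nat \<Rightarrow> (nat \<Rightarrow> real) topology" where
  "coord_space p = product_topology (\<lambda>_. euclideanreal) {..<p}"

definition coord_lebesgue :: "nat \<Rightarrow> (nat \<Rightarrow> real) measure" where
  "coord_lebesgue p = Pi\<^sub>M {..<p} (\<lambda>_. lborel)"

definition partial_deriv :: "nat \<Rightarrow> ((nat \<Rightarrow> real) \<Rightarrow> real) \<Rightarrow> (nat \<Rightarrow> real) \<Rightarrow> real" where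
  "partial_deriv i f x = deriv (\<lambda>t. f (x(i := t))) (x i)"

text \<open>Only applied to sets \<open>S\<close> that are open in \<^term>\<open>coord_space p\<close>.\<close>

primrec Ck_coord :: "nat \<Rightarrow> nat \<Rightarrow> (nat \<Rightarrow> real) set \<Rightarrow> ((nat \<Rightarrow> real) \<Rightarrow> real) \<Rightarrow> bool" where
  "Ck_coord p 0 S f \<longleftrightarrow> continuous_map (subtopology (coord_space p) S) euclideanreal f"
| "Ck_coord p (Suc k) S f \<longleftrightarrow>
     continuous_map (subtopology (coord_space p) S) euclideanreal f \<and>
     (\<forall>i<p. (\<forall>x\<in>S. (\<lambda>t. f (x(i := t))) differentiable (at (x i))) \<and>
            Ck_coord p k S (partial_deriv i f))"

definition smooth_coord :: "nat \<Rightarrow> (nat \<Rightarrow> real) set \<Rightarrow> ((nat \<Rightarrow> real) \<Rightarrow> real) \<Rightarrow> bool" where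
  "smooth_coord p S f \<longleftrightarrow> (\<forall>k. Ck_coord p k S f)"

section \<open>Smooth manifolds without boundary\<close>

text \<open>
  A chart is a pair of its domain and its coordinate map; only the values of the coordinate map on
  the domain matter.
\<close>

type_synonym 'a chart = "'a set \<times> ('a \<Rightarrow> nat \<Rightarrow> real)"

record 'a manifold =
  mfd_top :: "'a topology"
  mfd_dim :: nat
  mfd_atlas :: "'a chart set"

abbreviation mfd_points :: "'a manifold \<Rightarrow> 'a set" where
  "mfd_points M \<equiv> topspace (mfd_top M)"

abbreviation chart_dom :: "'a chart \<Rightarrow> 'a set" where
  "chart_dom c \<equiv> fst c"

abbreviation chart_map :: "'a chart \<Rightarrow> 'a \<Rightarrow> nat \<Rightarrow> real" where
  "chart_map c \<equiv> snd c"

abbreviation chart_img :: "'a chart \<Rightarrow> (nat \<Rightarrow> real) set" where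
  "chart_img c \<equiv> chart_map c ` chart_dom c"

definition chart_inv :: "'a chart \<Rightarrow> (nat \<Rightarrow> real) \<Rightarrow> 'a" where
  "chart_inv c = inv_into (chart_dom c) (chart_map c)"

definition is_chart :: "'a topology \<Rightarrow> nat \<Rightarrow> 'a chart \<Rightarrow> bool" where
  "is_chart T p c \<longleftrightarrow>
     openin T (chart_dom c) \<and>
     openin (coord_space p) (chart_img c) \<and>
     homeomorphic_map (subtopology T (chart_dom c)) (subtopology (coord_space p) (chart_img c))
       (chart_map c)"

definition smooth_manifold :: "'a manifold \<Rightarrow> bool" where
  "smooth_manifold M \<longleftrightarrow>
     Hausdorff_space (mfd_top M) \<and>
     second_countable (mfd_top M) \<and>
     mfd_points M = (\<Union>c\<in>mfd_atlas M. chart_dom c) \<and>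
     (\<forall>c\<in>mfd_atlas M. is_chart (mfd_top M) (mfd_dim M) c) \<and>
     (\<forall>c\<in>mfd_atlas M. \<forall>c'\<in>mfd_atlas M. \<forall>i<mfd_dim M.
        smooth_coord (mfd_dim M) (chart_map c ` (chart_dom c \<inter> chart_dom c'))
          (\<lambda>x. chart_map c' (chart_inv c x) i))"

definition chart_at :: "'a manifold \<Rightarrow> 'a \<Rightarrow> 'a chart" where
  "chart_at M \<theta> = (SOME c. c \<in> mfd_atlas M \<and> \<theta> \<in> chart_dom c)"

definition Ck_on :: "'a manifold \<Rightarrow> nat \<Rightarrow> ('a \<Rightarrow> real) \<Rightarrow> bool" where
  "Ck_on M k f \<longleftrightarrow>
     (\<forall>c\<in>mfd_atlas M. Ck_coord (mfd_dim M) k (chart_img c) (\<lambda>x. f (chart_inv c x)))"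

text \<open>\<open>chart_deriv c i f \<theta>\<close> is the derivative of \<open>f\<close> at \<open>\<theta>\<close> with respect to the \<open>i\<close>-th local
  coordinate of the chart \<open>c\<close>.\<close>

definition chart_deriv :: "'a chart \<Rightarrow> nat \<Rightarrow> ('a \<Rightarrow> real) \<Rightarrow> 'a \<Rightarrow> real" where
  "chart_deriv c i f \<theta> = partial_deriv i (\<lambda>x. f (chart_inv c x)) (chart_map c \<theta>)"

definition msupport :: "'a manifold \<Rightarrow> ('a \<Rightarrow> real) \<Rightarrow> 'a set" where
  "msupport M f = mfd_top M closure_of {\<theta> \<in> mfd_points M. f \<theta> \<noteq> 0}"

section \<open>Vector fields and Riemannian geometry in local coordinates\<close>

text \<open>
  A vector field \<open>V\<close> is represented by its components \<open>V c \<theta> i\<close> in every chart \<open>c\<close> of the atlas,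
  which are related by the contravariant transformation law; likewise a metric \<open>g\<close> by its
  components \<open>g c \<theta> i j\<close>, with the covariant law.
\<close>

type_synonym 'a vfield = "'a chart \<Rightarrow> 'a \<Rightarrow> nat \<Rightarrow> real"
type_synonym 'a metric = "'a chart \<Rightarrow> 'a \<Rightarrow> nat \<Rightarrow> nat \<Rightarrow> real"

definition Ck_vfield :: "'a manifold \<Rightarrow> nat \<Rightarrow> 'a vfield \<Rightarrow> bool" where
  "Ck_vfield M k V \<longleftrightarrow>
     (\<forall>c\<in>mfd_atlas M. \<forall>i<mfd_dim M.
        Ck_coord (mfd_dim M) k (chart_img c) (\<lambda>x. V c (chart_inv c x) i)) \<and>
     (\<forall>c\<in>mfd_atlas M. \<forall>c'\<in>mfd_atlas M. \<forall>\<theta>\<in>chart_dom c \<inter> chart_dom c'. \<forall>i<mfd_dim M.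
        V c' \<theta> i = (\<Sum>j<mfd_dim M. chart_deriv c j (\<lambda>\<eta>. chart_map c' \<eta> i) \<theta> * V c \<theta> j))"

definition riemannian_metric :: "'a manifold \<Rightarrow> 'a metric \<Rightarrow> bool" where
  "riemannian_metric M g \<longleftrightarrow>
     (\<forall>c\<in>mfd_atlas M. \<forall>i<mfd_dim M. \<forall>j<mfd_dim M.
        smooth_coord (mfd_dim M) (chart_img c) (\<lambda>x. g c (chart_inv c x) i j)) \<and>
     (\<forall>c\<in>mfd_atlas M. \<forall>\<theta>\<in>chart_dom c.
        (\<forall>i<mfd_dim M. \<forall>j<mfd_dim M. g c \<theta> i j = g c \<theta> j i) \<and>
        (\<forall>u. (\<exists>i<mfd_dim M. u i \<noteq> 0) \<longrightarrow>
             (\<Sum>i<mfd_dim M. \<Sum>j<mfd_dim M. g c \<theta> i j * u i * u j) > 0)) \<and>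
     (\<forall>c\<in>mfd_atlas M. \<forall>c'\<in>mfd_atlas M. \<forall>\<theta>\<in>chart_dom c \<inter> chart_dom c'.
        \<forall>i<mfd_dim M. \<forall>j<mfd_dim M.
        g c \<theta> i j =
          (\<Sum>k<mfd_dim M. \<Sum>l<mfd_dim M.
             chart_deriv c i (\<lambda>\<eta>. chart_map c' \<eta> k) \<theta> *
             chart_deriv c j (\<lambda>\<eta>. chart_map c' \<eta> l) \<theta> * g c' \<theta> k l))"

definition metric_inner :: "'a manifold \<Rightarrow> 'a metric \<Rightarrow> 'a vfield \<Rightarrow> 'a vfield \<Rightarrow> 'a \<Rightarrow> real" where
  "metric_inner M g U V \<theta> =
     (let c = chart_at M \<theta>
      in \<Sum>i<mfd_dim M. \<Sum>j<mfd_dim M. g c \<theta> i j * U c \<theta> i * V c \<theta> j)"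

text \<open>The gradient is the vector field dual to the differential with respect to the metric.\<close>

definition grad :: "'a manifold \<Rightarrow> 'a metric \<Rightarrow> ('a \<Rightarrow> real) \<Rightarrow> 'a vfield" where
  "grad M g f c \<theta> =
     (THE u. u \<in> extensional {..<mfd_dim M} \<and>
             (\<forall>i<mfd_dim M. (\<Sum>j<mfd_dim M. g c \<theta> i j * u j) = chart_deriv c i f \<theta>))"

definition vol_density :: "'a manifold \<Rightarrow> 'a metric \<Rightarrow> 'a chart \<Rightarrow> 'a \<Rightarrow> real" where
  "vol_density M g c \<theta> = sqrt (Determinant.det (mat (mfd_dim M) (mfd_dim M) (\<lambda>(i, j). g c \<theta> i j)))"

definition divergence :: "'a manifold \<Rightarrow> 'a metric \<Rightarrow> 'a vfield \<Rightarrow> 'a \<Rightarrow> real" where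
  "divergence M g V \<theta> =
     (let c = chart_at M \<theta>
      in (\<Sum>i<mfd_dim M. chart_deriv c i (\<lambda>\<eta>. vol_density M g c \<eta> * V c \<eta> i) \<theta>) /
         vol_density M g c \<theta>)"

text \<open>
  On a smooth manifold with a Riemannian metric there is exactly one measure with the following
  property: existence is the change of variables formula, and uniqueness holds because countably
  many charts cover the manifold.
\<close>

definition riemannian_volume :: "'a manifold \<Rightarrow> 'a metric \<Rightarrow> 'a measure \<Rightarrow> bool" where
  "riemannian_volume M g \<mu> \<longleftrightarrow>
     sets \<mu> = sets (sigma (mfd_points M) {S. openin (mfd_top M) S}) \<and>
     (\<forall>c\<in>mfd_atlas M. \<forall>B\<in>sets \<mu>. B \<subseteq> chart_dom c \<longrightarrow>
        emeasure \<mu> B =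
          (\<integral>\<^sup>+x. ennreal (vol_density M g c (chart_inv c x)) * indicator (chart_map c ` B) x
             \<partial>coord_lebesgue (mfd_dim M)))"

definition weighted_div ::
    "'a manifold \<Rightarrow> 'a metric \<Rightarrow> ('a \<Rightarrow> real) \<Rightarrow> 'a vfield \<Rightarrow> 'a \<Rightarrow> real" where
  "weighted_div M g w V \<theta> =
     divergence M g V \<theta> + metric_inner M g V (grad M g (\<lambda>\<eta>. ln (w \<eta>))) \<theta>"

section \<open>Statistical models, posteriors and stochastic order symbols\<close>

text \<open>
  The log-likelihood \<open>ell\<close> is a version of the logarithm of the density of \<open>P \<theta>\<close> with respect to
  the dominating measure; as it is real-valued, the densities are everywhere positive.
\<close>

definition statistical_model ::
    "'a manifold \<Rightarrow> 'x measure \<Rightarrow> ('a \<Rightarrow> 'x measure) \<Rightarrow> ('a \<Rightarrow> 'x \<Rightarrow> real) \<Rightarrow> bool" where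
  "statistical_model M lam P ell \<longleftrightarrow>
     smooth_manifold M \<and>
     (\<forall>\<theta>\<in>mfd_points M. prob_space (P \<theta>) \<and> ell \<theta> \<in> borel_measurable lam \<and>
        P \<theta> = density lam (\<lambda>x. ennreal (exp (ell \<theta> x)))) \<and>
     (\<forall>x\<in>space lam. Ck_on M 1 (\<lambda>\<theta>. ell \<theta> x))"

definition fisher_metric ::
    "('a \<Rightarrow> 'x measure) \<Rightarrow> ('a \<Rightarrow> 'x \<Rightarrow> real) \<Rightarrow> 'a metric" where
  "fisher_metric P ell c \<theta> i j =
     (\<integral>x. chart_deriv c i (\<lambda>\<eta>. ell \<eta> x) \<theta> * chart_deriv c j (\<lambda>\<eta>. ell \<eta> x) \<theta> \<partial>P \<theta>)"

definition fisher_integrable ::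
    "'a manifold \<Rightarrow> ('a \<Rightarrow> 'x measure) \<Rightarrow> ('a \<Rightarrow> 'x \<Rightarrow> real) \<Rightarrow> bool" where
  "fisher_integrable M P ell \<longleftrightarrow>
     (\<forall>c\<in>mfd_atlas M. \<forall>\<theta>\<in>chart_dom c. \<forall>i<mfd_dim M. \<forall>j<mfd_dim M.
        integrable (P \<theta>)
          (\<lambda>x. chart_deriv c i (\<lambda>\<eta>. ell \<eta> x) \<theta> * chart_deriv c j (\<lambda>\<eta>. ell \<eta> x) \<theta>))"

definition log_lik :: "('a \<Rightarrow> 'x \<Rightarrow> real) \<Rightarrow> nat \<Rightarrow> (nat \<Rightarrow> 'x) \<Rightarrow> 'a \<Rightarrow> real" where
  "log_lik ell n X \<theta> = (\<Sum>i<n. ell \<theta> (X i))"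

definition posterior :: "'a measure \<Rightarrow> ('a \<Rightarrow> real) \<Rightarrow> 'a measure" where
  "posterior Prior l =
     density Prior (\<lambda>\<theta>. ennreal (exp (l \<theta>) / (\<integral>\<eta>. exp (l \<eta>) \<partial>Prior)))"

text \<open>
  \<open>little_op Q A r\<close> states that \<open>A n = o\<^sub>p(r n)\<close> under \<open>Q n\<close>, for nonnegative extended-real-valued
  \<open>A n\<close>.  The covering events \<open>B n\<close> express convergence in outer probability.  For measurable
  \<open>A n\<close> this is the usual convergence; they are used because \<^const>\<open>measure\<close> is \<open>0\<close> on
  non-measurable sets.
\<close>

definition little_op ::
    "(nat \<Rightarrow> 'b measure) \<Rightarrow> (nat \<Rightarrow> 'b \<Rightarrow> ennreal) \<Rightarrow> (nat \<Rightarrow> real) \<Rightarrow> bool" where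
  "little_op Q A r \<longleftrightarrow>
     (\<forall>\<epsilon>>0. \<exists>B. (\<forall>n. B n \<in> sets (Q n) \<and> {X \<in> space (Q n). A n X > ennreal (\<epsilon> * r n)} \<subseteq> B n) \<and>
               (\<lambda>n. measure (Q n) (B n)) \<longlonglongrightarrow> 0)"

definition dBL :: "real measure \<Rightarrow> real measure \<Rightarrow> real" where
  "dBL \<mu> \<nu> =
     (SUP h\<in>{h :: real \<Rightarrow> real. (\<forall>x. \<bar>h x\<bar> \<le> 1) \<and> (\<forall>x y. \<bar>h x - h y\<bar> \<le> \<bar>x - y\<bar>)}.
        \<bar>(\<integral>x. h x \<partial>\<mu>) - (\<integral>x. h x \<partial>\<nu>)\<bar>)"

definition stein_bound :: "real \<Rightarrow> nat \<Rightarrow> ennreal \<Rightarrow> ennreal \<Rightarrow> ennreal \<Rightarrow> ennreal \<Rightarrow> ennreal" where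
  "stein_bound \<sigma> n a0 a1 a2 a3 =
     (if a0 = 1 then \<infinity>
      else 4 * (a0 + ennreal (1 / \<sigma>) * (a1 / (ennreal (sqrt (real n)) * (1 - a0))) +
                ennreal (1 / \<sigma>) * ennreal (sqrt (real n)) * a2 + ennreal (1 / \<sigma>\<^sup>2) * a3))"

end

(*
  Let w be the density of the unnormalised posterior, u = \<kappa> f(Z) with \<kappa> the cut-off and f the
  solution of Stein's equation \<sigma>^2 f'(z) - z f(z) = h(z) - N(0,\<sigma>^2)[h].  The divergence theorem for
  the compactly supported field u w V states that the posterior expectation of
  u (Div_\<pi> V + <V|grad l>) + <grad u|V> vanishes.  Expanding <grad u|V> by the product rule and
  writing <V|grad l> through the one-step corrected functional turns this into the expectation of
  \<kappa> (\<sigma>^2 f'(Z) - Z f(Z)) plus error terms controlled by A1, A2 and A3 through |f| \<le> 4/\<sigma> and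
  |f'| \<le> 4/\<sigma>^2; the part 1 - \<kappa> of the posterior mass costs at most 2 A0.
*)
theory Submission
  imports Defs "HOL-Real_Asymp.Real_Asymp"
begin

section \<open>Functions of class $C^1$ on coordinate space\<close>

text \<open>The divergence theorem has to be built on charts whose dimension is a term and not a
  type: points are extensional functions, regularity is a matter of partial derivatives, and the
  chain rule comes from moving one coordinate at a time. A second obstacle is that
  \<open>divergence\<close> and \<open>metric_inner\<close> are evaluated in whatever chart
  \<open>chart_at\<close> picks at each single point. Until independence of the chart is known,
  nothing can be said about their behaviour near a point, not even continuity.

  The constants come from the Gaussian. Since |h - m| \<le> 2, Mills' ratio gives |z f z| \<le> 2,
  and Stein's equation then gives \<sigma>^2 |f'| \<le> 2 + 2. For |z| < \<sigma> the ratio is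
  useless; a mean value estimate up to \<sigma> doubles the tail constant 2/\<sigma> to 4/\<sigma>.

  The argument itself never divides by 1 - A0; that factor enters only when the estimate is weakened
  to \<open>stein_bound\<close>. The two items are one inequality for a general functional \<Psi>,
  taken as \<Phi> and as \<Phi> minus the scaled weighted divergence.\<close>

definition ccont :: "nat \<Rightarrow> ((nat \<Rightarrow> real) \<Rightarrow> real) \<Rightarrow> (nat \<Rightarrow> real) \<Rightarrow> bool" where
  "ccont p f x \<longleftrightarrow> (f \<longlongrightarrow> f x) (nhdsin (coord_space p) x)"

text \<open>On open \<open>S\<close> this is \<open>Ck_coord p 1\<close>. Being a pointwise
  condition, with neighbourhoods taken in the whole coordinate space, it passes to subsets and
  unions, so gluing over an open cover becomes a matter of set inclusion.\<close>

definition C1_coord :: "nat \<Rightarrow> (nat \<Rightarrow> real) set \<Rightarrow> ((nat \<Rightarrow> real) \<Rightarrow> real) \<Rightarrow> bool" where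
  "C1_coord p S f \<longleftrightarrow> (\<forall>x\<in>S. ccont p f x \<and>
     (\<forall>i<p. (\<lambda>t. f (x(i := t))) differentiable (at (x i)) \<and> ccont p (partial_deriv i f) x))"

section \<open>Neighbourhood filters and continuity on coordinate space\<close>

abbreviation "nhdc p \<equiv> nhdsin (coord_space p)"

abbreviation "pts p \<equiv> topspace (coord_space p)"

lemma topspace_coord: "pts p = extensional {..<p}"
  by (auto simp: coord_space_def PiE_def)

lemma coord_upd: "x \<in> pts p \<Longrightarrow> i < p \<Longrightarrow> x(i := t) \<in> pts p"
  by (auto simp: topspace_coord extensional_def)

lemma openin_coord_box:
  assumes "openin (coord_space p) S" "x \<in> S"
  obtains \<delta> where "\<delta> > 0" "\<And>y. y \<in> pts p \<Longrightarrow> (\<And>i. i < p \<Longrightarrow> \<bar>y i - x i\<bar> < \<delta>) \<Longrightarrow> y \<in> S"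
proof -
  obtain U where U: "\<And>i. i < p \<Longrightarrow> open (U i)" "x \<in> Pi\<^sub>E {..<p} U" "Pi\<^sub>E {..<p} U \<subseteq> S"
    using assms unfolding coord_space_def openin_product_topology_alt
    by (auto simp: simp flip: open_openin) (metis lessThan_iff)
  have "\<exists>d>0. \<forall>t. \<bar>t - x i\<bar> < d \<longrightarrow> t \<in> U i" if "i < p" for i
    using U(1)[OF that] U(2) that unfolding open_dist by (force simp: dist_real_def PiE_iff)
  then obtain d where d: "\<And>i. i < p \<Longrightarrow> d i > 0" "\<And>i t. i < p \<Longrightarrow> \<bar>t - x i\<bar> < d i \<Longrightarrow> t \<in> U i"
    by metis
  \<comment> \<open>\<open>insert 1\<close> keeps the set nonempty when
    \<open>p = 0\<close>.\<close>
  define \<delta> where "\<delta> = Min (insert 1 (d ` {..<p}))"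
  have "\<delta> > 0" using d(1) unfolding \<delta>_def by (subst Min_gr_iff) auto
  moreover have "\<delta> \<le> d i" if "i < p" for i unfolding \<delta>_def using that by (intro Min_le) auto
  moreover have "y \<in> S" if "y \<in> pts p" "\<And>i. i < p \<Longrightarrow> \<bar>y i - x i\<bar> < \<delta>" for y
  proof -
    have "y i \<in> U i" if "i < p" for i
      using d(2)[OF that] \<open>\<And>i. i < p \<Longrightarrow> \<bar>y i - x i\<bar> < \<delta>\<close>[OF that] \<open>\<And>i. i < p \<Longrightarrow> \<delta> \<le> d i\<close>[OF that] by force
    then show ?thesis using U(3) that(1) by (auto simp: topspace_coord PiE_iff subset_iff)
  qed
  ultimately show ?thesis using that by blast
qed

lemma openin_coord_rect:
  assumes "\<And>i. i < p \<Longrightarrow> open (U i)"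
  shows "openin (coord_space p) (Pi\<^sub>E {..<p} U)"
  using assms unfolding coord_space_def by (auto simp: openin_PiE_gen)

lemma openin_coord_cube: "openin (coord_space p) {y \<in> pts p. \<forall>i<p. \<bar>y i - x i\<bar> < \<delta>}"
proof -
  have "{y \<in> pts p. \<forall>i<p. \<bar>y i - x i\<bar> < \<delta>} = Pi\<^sub>E {..<p} (\<lambda>i. {x i - \<delta> <..< x i + \<delta>})"
    by (auto simp: topspace_coord PiE_def Pi_def abs_less_iff)
  then show ?thesis using openin_coord_rect[of p "\<lambda>i. {x i - \<delta> <..< x i + \<delta>}"] by simp
qed

lemma eventually_nhdsin_coord:
  assumes "x \<in> pts p"
  shows "eventually P (nhdc p x) \<longleftrightarrow>
    (\<exists>\<delta>>0. \<forall>y\<in>pts p. (\<forall>i<p. \<bar>y i - x i\<bar> < \<delta>) \<longrightarrow> P y)" (is "?L \<longleftrightarrow> ?R")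
proof
  assume ?L
  then obtain S where S: "openin (coord_space p) S" "x \<in> S" "\<forall>y\<in>S. P y"
    using assms by (auto simp: eventually_nhdsin)
  show ?R using openin_coord_box[OF S(1,2)] S(3) by metis
next
  assume ?R
  then obtain \<delta> where \<delta>: "\<delta> > 0" "\<forall>y\<in>pts p. (\<forall>i<p. \<bar>y i - x i\<bar> < \<delta>) \<longrightarrow> P y" by blast
  show ?L unfolding eventually_nhdsin
    using \<delta> assms by (intro disjI2 exI[of _ "{y \<in> pts p. \<forall>i<p. \<bar>y i - x i\<bar> < \<delta>}"])
      (auto intro: openin_coord_cube)
qed

lemma eventually_nhdsin_openin:
  "openin X S \<Longrightarrow> x \<in> S \<Longrightarrow> eventually (\<lambda>y. y \<in> S) (nhdsin X x)"
  by (auto simp: eventually_nhdsin)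

lemma eventually_eventually_nhdsin:
  "eventually P (nhdsin X x) \<Longrightarrow> eventually (\<lambda>y. eventually P (nhdsin X y)) (nhdsin X x)"
  by (auto simp: eventually_nhdsin)

lemma eventually_nhdsin_self: "eventually P (nhdsin X x) \<Longrightarrow> x \<in> topspace X \<Longrightarrow> P x"
  by (auto simp: eventually_nhdsin)

lemma tendsto_nhdsin_iff:
  assumes "x \<in> topspace X"
  shows "(f \<longlongrightarrow> f x) (nhdsin X x) \<longleftrightarrow> (\<forall>V. open V \<and> f x \<in> V \<longrightarrow> (\<exists>U. openin X U \<and> x \<in> U \<and> (\<forall>y\<in>U. f y \<in> V)))"
  using assms unfolding tendsto_def eventually_nhdsin by auto

text \<open>Because \<open>S\<close> is open, neighbourhoods within \<open>S\<close> and within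
  \<open>X\<close> generate the same filter at points of \<open>S\<close>; intersecting a
  neighbourhood with \<open>S\<close> is the only construction involved.\<close>

lemma continuous_map_iff_tendsto:
  assumes "openin X S"
  shows "continuous_map (subtopology X S) euclidean f \<longleftrightarrow> (\<forall>x\<in>S. (f \<longlongrightarrow> f x) (nhdsin X x))"
proof -
  have *: "S \<subseteq> topspace X" using assms openin_subset by blast
  have "topcontinuous_at (subtopology X S) euclidean f x \<longleftrightarrow> (f \<longlongrightarrow> f x) (nhdsin X x)" if "x \<in> S" for x
  proof -
    have x: "x \<in> topspace X" using that * by blast
    have eq: "(\<exists>U. openin X U \<and> x \<in> U \<and> (\<forall>y\<in>U. f y \<in> W)) \<longleftrightarrow>
        (\<exists>U. (openin X U \<and> U \<subseteq> S) \<and> x \<in> U \<and> (\<forall>y\<in>U. f y \<in> W))" for W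
    proof
      assume "\<exists>U. openin X U \<and> x \<in> U \<and> (\<forall>y\<in>U. f y \<in> W)"
      then obtain U where "openin X U \<and> x \<in> U \<and> (\<forall>y\<in>U. f y \<in> W)" by blast
      then show "\<exists>U. (openin X U \<and> U \<subseteq> S) \<and> x \<in> U \<and> (\<forall>y\<in>U. f y \<in> W)"
        using assms that by (intro exI[of _ "U \<inter> S"]) auto
    qed blast
    show ?thesis unfolding topcontinuous_at_def tendsto_nhdsin_iff[OF x] openin_open_subtopology[OF assms] eq[symmetric]
      using that x by (simp add: Pi_def)
  qed
  then show ?thesis unfolding continuous_map_eq_topcontinuous_at using * by auto
qed

lemma ccont_iff:
  assumes "openin (coord_space p) S"
  shows "continuous_map (subtopology (coord_space p) S) euclideanreal f \<longleftrightarrow> (\<forall>x\<in>S. ccont p f x)"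
  using continuous_map_iff_tendsto[OF assms] by (simp add: ccont_def)

lemma Ck_coord_1_iff:
  assumes "openin (coord_space p) S"
  shows "Ck_coord p 1 S f \<longleftrightarrow> C1_coord p S f"
  unfolding One_nat_def Ck_coord.simps ccont_iff[OF assms] C1_coord_def by blast

lemma smooth_coord_C1:
  assumes "openin (coord_space p) S" "smooth_coord p S f"
  shows "C1_coord p S f"
  using assms unfolding smooth_coord_def by (metis Ck_coord_1_iff)

lemma eventually_line:
  assumes "x \<in> pts p" "i < p" "eventually P (nhdc p x)"
  shows "eventually (\<lambda>t. P (x(i := t))) (nhds (x i))"
proof -
  obtain \<delta> where d: "\<delta> > 0" "\<forall>y\<in>pts p. (\<forall>i<p. \<bar>y i - x i\<bar> < \<delta>) \<longrightarrow> P y"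
    using assms(3) eventually_nhdsin_coord[OF assms(1)] by auto
  then show ?thesis unfolding eventually_nhds_metric
    using coord_upd[OF assms(1,2)] by (intro exI[of _ \<delta>]) (auto simp: dist_real_def)
qed

lemma ccont_cong:
  assumes "x \<in> pts p" "eventually (\<lambda>y. f y = g y) (nhdc p x)"
  shows "ccont p f x \<longleftrightarrow> ccont p g x"
proof -
  have "f x = g x" using assms by (rule eventually_nhdsin_self[rotated])
  then show ?thesis unfolding ccont_def using tendsto_cong[OF assms(2)] by simp
qed

lemma partial_deriv_cong:
  assumes "x \<in> pts p" "i < p" "eventually (\<lambda>y. f y = g y) (nhdc p x)"
  shows "partial_deriv i f x = partial_deriv i g x"
  unfolding partial_deriv_def by (rule deriv_cong_ev[OF eventually_line[OF assms] refl])

lemma C1_coord_deriv: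
  assumes "C1_coord p S f" "x \<in> S" "i < p"
  shows "((\<lambda>t. f (x(i := t))) has_real_derivative partial_deriv i f x) (at (x i))"
  using assms unfolding C1_coord_def partial_deriv_def
  by (metis DERIV_deriv_iff_real_differentiable)

lemma C1_coord_ccont: "C1_coord p S f \<Longrightarrow> x \<in> S \<Longrightarrow> ccont p f x"
  by (simp add: C1_coord_def)

lemma C1_coord_ccont_deriv: "C1_coord p S f \<Longrightarrow> x \<in> S \<Longrightarrow> i < p \<Longrightarrow> ccont p (partial_deriv i f) x"
  by (simp add: C1_coord_def)

lemma partial_derivI:
  "((\<lambda>t. f (x(i := t))) has_real_derivative D) (at (x i)) \<Longrightarrow> partial_deriv i f x = D"
  by (simp add: DERIV_imp_deriv partial_deriv_def)

text \<open>Agreement on an open set is agreement near each of its points, hence carries over to the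
  partial derivatives and to their continuity.\<close>

lemma C1_coord_cong:
  assumes S: "openin (coord_space p) S" and fg: "\<And>x. x \<in> S \<Longrightarrow> f x = g x" and f: "C1_coord p S f"
  shows "C1_coord p S g"
  unfolding C1_coord_def
proof (intro ballI conjI allI impI)
  fix x assume x: "x \<in> S"
  have xt: "x \<in> pts p" using S x openin_subset by blast
  have ev: "eventually (\<lambda>y. f y = g y) (nhdc p x)"
    using eventually_nhdsin_openin[OF S x] by eventually_elim (use fg in auto)
  show "ccont p g x" using ccont_cong[OF xt ev] f x by (simp add: C1_coord_def)
  fix i assume i: "i < p"
  have "((\<lambda>t. g (x(i := t))) has_real_derivative partial_deriv i f x) (at (x i))"
    using C1_coord_deriv[OF f x i] DERIV_cong_ev[OF refl eventually_line[OF xt i ev] refl] by blast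
  then show "(\<lambda>t. g (x(i := t))) differentiable (at (x i))"
    using real_differentiable_def by blast
  have "eventually (\<lambda>y. partial_deriv i f y = partial_deriv i g y) (nhdc p x)"
    using eventually_nhdsin_openin[OF S x] eventually_eventually_nhdsin[OF ev]
  proof eventually_elim
    case (elim y)
    then show ?case using partial_deriv_cong[of y p i f g] openin_subset[OF S] i by auto
  qed
  from ccont_cong[OF xt this] show "ccont p (partial_deriv i g) x"
    using f x i by (simp add: C1_coord_def)
qed

lemma C1_coordI:
  assumes S: "openin (coord_space p) S" and c: "\<And>x. x \<in> S \<Longrightarrow> ccont p f x"
    and d: "\<And>i x. i < p \<Longrightarrow> x \<in> S \<Longrightarrow> ((\<lambda>t. f (x(i := t))) has_real_derivative D i x) (at (x i))"
    and cd: "\<And>i x. i < p \<Longrightarrow> x \<in> S \<Longrightarrow> ccont p (D i) x"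
  shows "C1_coord p S f"
  unfolding C1_coord_def
proof (intro ballI conjI allI impI)
  fix x assume x: "x \<in> S"
  then show "ccont p f x" by (rule c)
  have xt: "x \<in> pts p" using S x openin_subset by blast
  fix i assume i: "i < p"
  show "(\<lambda>t. f (x(i := t))) differentiable (at (x i))"
    using d[OF i x] real_differentiable_def by blast
  have "eventually (\<lambda>y. D i y = partial_deriv i f y) (nhdc p x)"
    using eventually_nhdsin_openin[OF S x] by eventually_elim (metis d i partial_derivI)
  from ccont_cong[OF xt this] show "ccont p (partial_deriv i f) x" using cd[OF i x] by simp
qed

lemma C1_coord_subset: "C1_coord p S f \<Longrightarrow> T \<subseteq> S \<Longrightarrow> C1_coord p T f"
  by (auto simp: C1_coord_def)

lemma C1_coord_Un: "C1_coord p S f \<Longrightarrow> C1_coord p T f \<Longrightarrow> C1_coord p (S \<union> T) f"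
  by (auto simp: C1_coord_def)

lemma ccont_const: "ccont p (\<lambda>x. a) x"
  by (simp add: ccont_def)
lemma ccont_add: "ccont p f x \<Longrightarrow> ccont p g x \<Longrightarrow> ccont p (\<lambda>x. f x + g x) x"
  unfolding ccont_def by (rule tendsto_add)
lemma ccont_mult: "ccont p f x \<Longrightarrow> ccont p g x \<Longrightarrow> ccont p (\<lambda>x. f x * g x) x"
  unfolding ccont_def by (rule tendsto_mult)
lemma ccont_sum: "(\<And>i. i \<in> I \<Longrightarrow> ccont p (f i) x) \<Longrightarrow> ccont p (\<lambda>x. \<Sum>i\<in>I. f i x) x"
  unfolding ccont_def by (rule tendsto_sum)
lemma ccont_compose: "ccont p f x \<Longrightarrow> isCont \<phi> (f x) \<Longrightarrow> ccont p (\<lambda>x. \<phi> (f x)) x"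
  unfolding ccont_def by (rule isCont_tendsto_compose)

lemma ccont_proj:
  assumes "i < p" "x \<in> pts p" shows "ccont p (\<lambda>x. x i) x"
  unfolding ccont_def tendsto_iff eventually_nhdsin_coord[OF assms(2)] dist_real_def
  using assms(1) by blast

lemma C1_coord_const: "C1_coord p S (\<lambda>x. a)"
proof -
  have "partial_deriv i (\<lambda>x. a) = (\<lambda>x. 0)" for i
    by (rule ext, rule partial_derivI) simp
  then show ?thesis by (auto simp: C1_coord_def ccont_const)
qed

lemma C1_coord_add:
  assumes "openin (coord_space p) S" "C1_coord p S f" "C1_coord p S g"
  shows "C1_coord p S (\<lambda>x. f x + g x)"
  by (rule C1_coordI[OF assms(1), where D = "\<lambda>i x. partial_deriv i f x + partial_deriv i g x"])
     (use assms in \<open>auto intro!: ccont_add derivative_eq_intros C1_coord_deriv simp: C1_coord_ccont C1_coord_ccont_deriv\<close>)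

lemma C1_coord_mult:
  assumes "openin (coord_space p) S" "C1_coord p S f" "C1_coord p S g"
  shows "C1_coord p S (\<lambda>x. f x * g x)"
proof (rule C1_coordI[OF assms(1), where D = "\<lambda>i x. partial_deriv i f x * g x + partial_deriv i g x * f x"])
  fix i x assume "i < p" "x \<in> S"
  from DERIV_mult[OF C1_coord_deriv[OF assms(2) this(2,1)] C1_coord_deriv[OF assms(3) this(2,1)]]
  show "((\<lambda>t. f (x(i := t)) * g (x(i := t))) has_real_derivative partial_deriv i f x * g x + partial_deriv i g x * f x) (at (x i))"
    by simp
qed (use assms in \<open>auto intro!: ccont_add ccont_mult simp: C1_coord_ccont C1_coord_ccont_deriv\<close>)

lemma C1_coord_sum:
  assumes "openin (coord_space p) S" "\<And>k. k \<in> I \<Longrightarrow> C1_coord p S (f k)"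
  shows "C1_coord p S (\<lambda>x. \<Sum>k\<in>I. f k x)"
proof (cases "finite I")
  case True then show ?thesis using assms(2)
    by (induction I) (auto intro: C1_coord_const C1_coord_add[OF assms(1)])
qed (simp add: C1_coord_const)

lemma C1_coord_prod:
  assumes "openin (coord_space p) S" "\<And>k. k \<in> I \<Longrightarrow> C1_coord p S (f k)"
  shows "C1_coord p S (\<lambda>x. \<Prod>k\<in>I. f k x)"
proof (cases "finite I")
  case True then show ?thesis using assms(2)
    by (induction I) (auto intro: C1_coord_const C1_coord_mult[OF assms(1)])
qed (simp add: C1_coord_const)

lemma C1_coord_proj:
  assumes "openin (coord_space p) S" "k < p" shows "C1_coord p S (\<lambda>x. x k)"
  by (rule C1_coordI[OF assms(1), where D = "\<lambda>i x. if k = i then 1 else 0"])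
     (use assms openin_subset[OF assms(1)] in \<open>auto intro: ccont_proj ccont_const\<close>)

lemma C1_coord_compose:
  assumes S: "openin (coord_space p) S" and f: "C1_coord p S f"
    and d: "\<And>x. x \<in> S \<Longrightarrow> (\<phi> has_real_derivative \<phi>' (f x)) (at (f x))" and c: "\<And>x. x \<in> S \<Longrightarrow> isCont \<phi>' (f x)"
  shows "C1_coord p S (\<lambda>x. \<phi> (f x))"
    and "\<And>i x. i < p \<Longrightarrow> x \<in> S \<Longrightarrow> partial_deriv i (\<lambda>x. \<phi> (f x)) x = \<phi>' (f x) * partial_deriv i f x"
proof -
  have *: "((\<lambda>t. \<phi> (f (x(i := t)))) has_real_derivative \<phi>' (f x) * partial_deriv i f x) (at (x i))"
    if "i < p" "x \<in> S" for i x
    using DERIV_chain2[OF _ C1_coord_deriv[OF f that(2,1)], of \<phi>] d[OF that(2)] by simp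
  show "C1_coord p S (\<lambda>x. \<phi> (f x))"
  proof (rule C1_coordI[OF S, where D = "\<lambda>i x. \<phi>' (f x) * partial_deriv i f x"])
    show "ccont p (\<lambda>x. \<phi> (f x)) x" if "x \<in> S" for x
      by (rule ccont_compose[OF C1_coord_ccont[OF f that] DERIV_isCont[OF d[OF that]]])
    show "ccont p (\<lambda>x. \<phi>' (f x) * partial_deriv i f x) x" if "i < p" "x \<in> S" for i x
      by (rule ccont_mult[OF ccont_compose[OF C1_coord_ccont[OF f that(2)] c[OF that(2)]] C1_coord_ccont_deriv[OF f that(2,1)]])
  qed (rule *)
  show "partial_deriv i (\<lambda>x. \<phi> (f x)) x = \<phi>' (f x) * partial_deriv i f x" if "i < p" "x \<in> S" for i x
    by (rule partial_derivI[OF *[OF that]])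
qed

section \<open>The chain rule on coordinate space\<close>

lemma eventually_nhdsin_finite_coord:
  assumes "x \<in> pts p" "\<And>k::nat. k < q \<Longrightarrow> eventually (P k) (nhdc p x)"
  shows "eventually (\<lambda>y. \<forall>k<q. P k y) (nhdc p x)"
proof -
  have "eventually (\<lambda>y. \<forall>k\<in>{..<q::nat}. P k y) (nhdc p x)"
    using assms(2) by (intro eventually_ball_finite) auto
  then show ?thesis by (simp add: Ball_def)
qed

lemma filterlim_nhdsin_coord:
  assumes x: "T a \<in> pts q" "eventually (\<lambda>z. T z \<in> pts q) F"
    and T: "\<And>k. k < q \<Longrightarrow> ((\<lambda>z. T z k) \<longlongrightarrow> T a k) F"
  shows "filterlim T (nhdc q (T a)) F"
  unfolding filterlim_iff
proof (intro allI impI)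
  fix P assume "eventually P (nhdc q (T a))"
  then obtain \<delta> where d: "\<delta> > 0" "\<forall>y\<in>pts q. (\<forall>i<q. \<bar>y i - T a i\<bar> < \<delta>) \<longrightarrow> P y"
    using eventually_nhdsin_coord[OF x(1)] by auto
  have "eventually (\<lambda>z. \<forall>k\<in>{..<q}. \<bar>T z k - T a k\<bar> < \<delta>) F"
    using T d(1) by (intro eventually_ball_finite) (auto simp: tendsto_iff dist_real_def)
  with x(2) show "eventually (\<lambda>z. P (T z)) F"
    by eventually_elim (use d(2) in auto)
qed

lemma ccont_compose_map:
  assumes "x \<in> pts p" "T x \<in> pts q"
    "eventually (\<lambda>z. T z \<in> pts q) (nhdc p x)"
    "\<And>k. k < q \<Longrightarrow> ccont p (\<lambda>z. T z k) x" "ccont q f (T x)"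
  shows "ccont p (\<lambda>z. f (T z)) x"
  unfolding ccont_def
  by (rule filterlim_compose[OF assms(5)[unfolded ccont_def] filterlim_nhdsin_coord[OF assms(2,3)]])
    (use assms(4) in \<open>simp add: ccont_def\<close>)

text \<open>Changing one coordinate at a time reduces the increment to the one-dimensional mean value
  theorem.\<close>

lemma C1_coord_increment:
  assumes W: "openin (coord_space q) W" "y \<in> W" and f: "C1_coord q W f" and "\<epsilon> > 0"
  shows "eventually (\<lambda>z. \<bar>f z - f y - (\<Sum>k<q. partial_deriv k f y * (z k - y k))\<bar> \<le> \<epsilon> * (\<Sum>k<q. \<bar>z k - y k\<bar>))
    (nhdc q y)"
proof -
  have yt: "y \<in> pts q" using W openin_subset by blast
  have "eventually (\<lambda>z. \<forall>k<q. \<bar>partial_deriv k f z - partial_deriv k f y\<bar> < \<epsilon>) (nhdc q y)"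
    using f W(2) \<open>\<epsilon> > 0\<close> by (intro eventually_nhdsin_finite_coord[OF yt])
      (auto simp: C1_coord_def ccont_def tendsto_iff dist_real_def)
  with eventually_nhdsin_openin[OF W]
  have "eventually (\<lambda>z. z \<in> W \<and> (\<forall>k<q. \<bar>partial_deriv k f z - partial_deriv k f y\<bar> < \<epsilon>)) (nhdc q y)"
    by eventually_elim auto
  then obtain \<delta> where \<delta>: "\<delta> > 0" and *: "\<And>z. z \<in> pts q \<Longrightarrow> (\<forall>i<q. \<bar>z i - y i\<bar> < \<delta>) \<Longrightarrow>
      z \<in> W \<and> (\<forall>k<q. \<bar>partial_deriv k f z - partial_deriv k f y\<bar> < \<epsilon>)"
    using eventually_nhdsin_coord[OF yt] by auto
  show ?thesis unfolding eventually_nhdsin_coord[OF yt]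
  proof (intro exI[of _ \<delta>] conjI ballI impI \<delta>)
    fix z assume zt: "z \<in> pts q" and z: "\<forall>i<q. \<bar>z i - y i\<bar> < \<delta>"
    define m where "m k = (\<lambda>j. if j < k then z j else y j)" for k :: nat
    have mt: "m k \<in> pts q" if "k \<le> q" for k
      using yt that zt by (auto simp: m_def topspace_coord extensional_def)
    have md: "\<bar>m k i - y i\<bar> < \<delta>" if "i < q" for k i using z \<delta> that by (auto simp: m_def)
    have m_Suc: "m (Suc k) = (m k)(k := z k)" and m_k: "(m k)(k := y k) = m k" for k
      by (auto simp: m_def fun_eq_iff less_Suc_eq)
    have step: "\<bar>f (m (Suc k)) - f (m k) - partial_deriv k f y * (z k - y k)\<bar> \<le> \<epsilon> * \<bar>z k - y k\<bar>"
      if k: "k < q" for k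
    proof -
      define S where "S = {y k - \<delta> <..< y k + \<delta>}"
      have in_box: "(m k)(k := s) \<in> pts q \<and> (\<forall>i<q. \<bar>((m k)(k := s)) i - y i\<bar> < \<delta>)" if "s \<in> S" for s
        using that md coord_upd[OF mt k] k by (auto simp: S_def abs_less_iff)
      \<comment> \<open>Subtracting the linear part leaves a function of one variable whose
        derivative is at most \<epsilon> in absolute value, since the whole segment stays in the
        cube where the partial derivatives are within \<epsilon> of their values at
        \<open>y\<close>.\<close>
      have "norm ((f ((m k)(k := z k)) - partial_deriv k f y * z k) - (f ((m k)(k := y k)) - partial_deriv k f y * y k))
         \<le> \<epsilon> * norm (z k - y k)"
      proof (rule field_differentiable_bound[where S = S and
            f' = "\<lambda>s. partial_deriv k f ((m k)(k := s)) - partial_deriv k f y"])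
        show "convex S" by (simp add: S_def)
        show "y k \<in> S" "z k \<in> S" using \<delta> z k by (auto simp: S_def abs_less_iff)
        fix s assume s: "s \<in> S"
        have "((\<lambda>t. f (((m k)(k := s))(k := t))) has_real_derivative partial_deriv k f ((m k)(k := s))) (at (((m k)(k := s)) k))"
          using * in_box[OF s] by (intro C1_coord_deriv[OF f _ k]) auto
        then have "((\<lambda>t. f ((m k)(k := t))) has_real_derivative partial_deriv k f ((m k)(k := s))) (at s)"
          by simp
        then show "((\<lambda>t. f ((m k)(k := t)) - partial_deriv k f y * t) has_field_derivative
            partial_deriv k f ((m k)(k := s)) - partial_deriv k f y) (at s within S)"
          by (auto intro!: derivative_eq_intros intro: has_field_derivative_at_within)
        show "norm (partial_deriv k f ((m k)(k := s)) - partial_deriv k f y) \<le> \<epsilon>"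
          using * in_box[OF s] k by (auto intro: less_imp_le)
      qed
      then show ?thesis unfolding m_Suc m_k by (simp add: algebra_simps)
    qed
    have "m 0 = y" by (simp add: m_def)
    moreover have "m q = z" using yt zt by (auto simp: m_def topspace_coord extensional_def)
    ultimately have "f z - f y = (\<Sum>k<q. f (m (Suc k)) - f (m k))"
      using sum_lessThan_telescope[of "\<lambda>k. f (m k)" q] by simp
    then have "\<bar>f z - f y - (\<Sum>k<q. partial_deriv k f y * (z k - y k))\<bar>
        = \<bar>\<Sum>k<q. f (m (Suc k)) - f (m k) - partial_deriv k f y * (z k - y k)\<bar>"
      by (simp add: sum_subtractf)
    also have "\<dots> \<le> (\<Sum>k<q. \<epsilon> * \<bar>z k - y k\<bar>)"
      by (rule order.trans[OF sum_abs sum_mono]) (use step in auto)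
    finally show "\<bar>f z - f y - (\<Sum>k<q. partial_deriv k f y * (z k - y k))\<bar> \<le> \<epsilon> * (\<Sum>k<q. \<bar>z k - y k\<bar>)"
      by (simp add: sum_distrib_left)
  qed
qed

text \<open>The remainder \<open>R\<close> is o of the sum of |\<gamma> t k - y k| by the increment
  estimate, and that sum divided by |t - t0| stays bounded because the coordinates are
  differentiable; so \<open>R\<close> does not contribute to the derivative.\<close>

lemma C1_coord_curve_deriv:
  assumes W: "openin (coord_space q) W" "\<gamma> t0 \<in> W" and f: "C1_coord q W f"
    and \<gamma>: "eventually (\<lambda>t. \<gamma> t \<in> pts q) (at t0)"
    and d: "\<And>k. k < q \<Longrightarrow> ((\<lambda>t. \<gamma> t k) has_real_derivative D k) (at t0)"
  shows "((\<lambda>t. f (\<gamma> t)) has_real_derivative (\<Sum>k<q. partial_deriv k f (\<gamma> t0) * D k)) (at t0)"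
proof -
  define y where "y = \<gamma> t0"
  have yt: "y \<in> pts q" using W openin_subset by (auto simp: y_def)
  define Q where "Q k t = (\<gamma> t k - y k) / (t - t0)" for k t
  define R where "R t = (f (\<gamma> t) - f y - (\<Sum>k<q. partial_deriv k f y * (\<gamma> t k - y k)))" for t
  have Q: "(Q k \<longlongrightarrow> D k) (at t0)" if "k < q" for k
    using d[OF that] by (simp add: Q_def[abs_def] y_def has_field_derivative_iff)
  have lim: "filterlim \<gamma> (nhdc q (\<gamma> t0)) (at t0)"
    using yt \<gamma> DERIV_isCont[OF d] unfolding y_def
    by (intro filterlim_nhdsin_coord) (auto simp: isCont_def)
  have "((\<lambda>t. R t / (t - t0)) \<longlongrightarrow> 0) (at t0)"
    unfolding tendsto_iff dist_real_def
  proof (intro allI impI)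
    fix e :: real assume "e > 0"
    \<comment> \<open>The summand 1 makes \<open>C\<close> a strict bound for the limit of the
      difference quotients, hence a bound for them near \<open>t0\<close>; the factor
      \<open>e / (2 * C)\<close> then leaves e/2 < e.\<close>
    define C where "C = (\<Sum>k<q. \<bar>D k\<bar>) + 1"
    have C: "C > 0" unfolding C_def by (intro add_nonneg_pos sum_nonneg) auto
    have "eventually (\<lambda>t. (\<Sum>k<q. \<bar>Q k t\<bar>) < C) (at t0)"
      by (rule order_tendstoD(2)[OF tendsto_sum[OF tendsto_rabs[OF Q]]]) (auto simp: C_def)
    moreover have "eventually (\<lambda>t. \<bar>R t\<bar> \<le> e / (2 * C) * (\<Sum>k<q. \<bar>\<gamma> t k - y k\<bar>)) (at t0)"
      using filterlim_iff[THEN iffD1, OF lim, rule_format, OF C1_coord_increment[OF W f, of "e / (2 * C)"]]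
        \<open>e > 0\<close> C unfolding R_def y_def by simp
    moreover have "eventually (\<lambda>t. t \<noteq> t0) (at t0)" by (simp add: eventually_at_filter)
    ultimately show "eventually (\<lambda>t. \<bar>R t / (t - t0) - 0\<bar> < e) (at t0)"
    proof eventually_elim
      case (elim t)
      have "\<bar>R t / (t - t0)\<bar> = \<bar>R t\<bar> / \<bar>t - t0\<bar>" by simp
      also have "\<dots> \<le> e / (2 * C) * (\<Sum>k<q. \<bar>\<gamma> t k - y k\<bar>) / \<bar>t - t0\<bar>"
        using elim by (intro divide_right_mono) auto
      also have "\<dots> = e / (2 * C) * (\<Sum>k<q. \<bar>Q k t\<bar>)"
        by (simp add: Q_def flip: sum_divide_distrib)
      also have "\<dots> \<le> e / (2 * C) * C" using elim \<open>e > 0\<close> C by (intro mult_left_mono) auto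
      also have "\<dots> < e" using \<open>e > 0\<close> C by simp
      finally show ?case by simp
    qed
  qed
  moreover have "((\<lambda>t. \<Sum>k<q. partial_deriv k f y * Q k t) \<longlongrightarrow> (\<Sum>k<q. partial_deriv k f y * D k)) (at t0)"
    by (intro tendsto_intros Q) auto
  ultimately have "((\<lambda>t. R t / (t - t0) + (\<Sum>k<q. partial_deriv k f y * Q k t)) \<longlongrightarrow> 0 + (\<Sum>k<q. partial_deriv k f y * D k)) (at t0)"
    by (rule tendsto_add)
  moreover have "R t / (t - t0) + (\<Sum>k<q. partial_deriv k f y * Q k t) = (f (\<gamma> t) - f y) / (t - t0)" for t
    by (simp add: R_def Q_def diff_divide_distrib[of "f (\<gamma> t) - f y"] sum_divide_distrib)
  ultimately show ?thesis by (simp add: has_field_derivative_iff y_def)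
qed

text \<open>A partial derivative of the composite is its derivative along the curve t \<mapsto>
  \<open>T (x(i := t))\<close>, so the result for curves applies; continuity of these derivatives is
  then read off the formula.\<close>

lemma chain_rule_coord:
  assumes U: "openin (coord_space p) U" and W: "openin (coord_space q) W" and f: "C1_coord q W f"
    and TW: "\<And>x. x \<in> U \<Longrightarrow> T x \<in> W" and T: "\<And>k. k < q \<Longrightarrow> C1_coord p U (\<lambda>x. T x k)"
  shows "C1_coord p U (\<lambda>x. f (T x))" (is ?C)
    and "\<And>i x. i < p \<Longrightarrow> x \<in> U \<Longrightarrow> partial_deriv i (\<lambda>x. f (T x)) x =
      (\<Sum>k<q. partial_deriv k f (T x) * partial_deriv i (\<lambda>x. T x k) x)" (is "\<And>i x. _ \<Longrightarrow> _ \<Longrightarrow> _ = ?D i x")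
proof -
  have xt: "x \<in> pts p" if "x \<in> U" for x using that U openin_subset by blast
  have Wt: "x \<in> pts q" if "x \<in> W" for x using that W openin_subset by blast
  have evU: "eventually (\<lambda>z. T z \<in> pts q) (nhdc p x)" if "x \<in> U" for x
    using eventually_nhdsin_openin[OF U that] by eventually_elim (use TW Wt in auto)
  have cc: "ccont p (\<lambda>x. h (T x)) x" if "x \<in> U" "ccont q h (T x)" for h x
    by (rule ccont_compose_map[OF xt[OF that(1)] Wt[OF TW[OF that(1)]] evU[OF that(1)] C1_coord_ccont[OF T that(1)] that(2)])
  have *: "((\<lambda>t. f (T (x(i := t)))) has_real_derivative ?D i x) (at (x i))" if "i < p" "x \<in> U" for i x
  proof -
    have "((\<lambda>t. f (T (x(i := t)))) has_real_derivative
       (\<Sum>k<q. partial_deriv k f (T (x(i := x i))) * partial_deriv i (\<lambda>x. T x k) x)) (at (x i))"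
      using TW that eventually_line[OF xt[OF that(2)] that(1) evU[OF that(2)]]
      by (intro C1_coord_curve_deriv[OF W _ f, where \<gamma> = "\<lambda>t. T (x(i := t))"] C1_coord_deriv[OF T that(2,1)])
        (auto simp: eventually_nhds_conv_at)
    then show ?thesis by simp
  qed
  show ?C
  proof (rule C1_coordI[OF U, where D = ?D])
    show "ccont p (\<lambda>x. f (T x)) x" if "x \<in> U" for x
      using cc[OF that C1_coord_ccont[OF f TW[OF that]]] .
    show "ccont p (?D i) x" if "i < p" "x \<in> U" for i x
    proof (rule ccont_sum, rule ccont_mult)
      fix k assume k: "k \<in> {..<q}"
      show "ccont p (\<lambda>x. partial_deriv k f (T x)) x"
        using k by (intro cc[OF that(2)] C1_coord_ccont_deriv[OF f TW[OF that(2)]]) simp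
      show "ccont p (partial_deriv i (\<lambda>x. T x k)) x"
        using k by (intro C1_coord_ccont_deriv[OF T that(2,1)]) simp
    qed
  qed (rule *)
  show "partial_deriv i (\<lambda>x. f (T x)) x = ?D i x" if "i < p" "x \<in> U" for i x
    by (rule partial_derivI[OF *[OF that]])
qed

section \<open>Bump functions of class C1 on coordinate space\<close>

lemma max_0_power2_has_derivative:
  "((\<lambda>s. (max 0 s)\<^sup>2) has_real_derivative 2 * max 0 s) (at s)" for s :: real
proof -
  \<comment> \<open>At 0 the derivative comes from Caratheodory's criterion: the square of max 0 z
    factors as max 0 z times z, with a continuous first factor.\<close>
  have "\<exists>g. (\<forall>z. (max 0 z)\<^sup>2 - (max 0 s)\<^sup>2 = g z * (z - s)) \<and> isCont g s \<and> g s = 2 * max 0 s" if "s = 0"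
    using that by (intro exI[of _ "\<lambda>z. max 0 z"]) (auto intro!: continuous_intros, auto simp: power2_eq_square max_def)
  then have "((\<lambda>s. (max 0 s)\<^sup>2) has_real_derivative 2 * max 0 s) (at s)" if "s = 0"
    using that CARAT_DERIV[of "\<lambda>s. (max 0 s)\<^sup>2" "2 * max 0 s" s] by blast
  moreover have "((\<lambda>s. (max 0 s)\<^sup>2) has_real_derivative 2 * max 0 s) (at s)" if "s < 0"
  proof -
    have "eventually (\<lambda>t. (max 0 t)\<^sup>2 = 0) (nhds s)"
      using eventually_nhds_in_open[of "{..<0}" s] that by (auto elim!: eventually_mono)
    from DERIV_cong_ev[OF refl this refl] that show ?thesis by simp
  qed
  moreover have "((\<lambda>s. (max 0 s)\<^sup>2) has_real_derivative 2 * max 0 s) (at s)" if "s > 0"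
  proof -
    have "eventually (\<lambda>t. (max 0 t)\<^sup>2 = t\<^sup>2) (nhds s)"
      using eventually_nhds_in_open[of "{0<..}" s] that by (auto elim!: eventually_mono)
    from DERIV_cong_ev[OF refl this refl] that show ?thesis
      by (auto intro!: derivative_eq_intros)
  qed
  ultimately show ?thesis by (cases s "0::real" rule: linorder_cases) auto
qed

text \<open>A paraboloid cut off at 0 and then squared. The square smooths the edge just enough for
  class C1, and the function vanishes off the Euclidean ball of radius |r|, which lies in the cube
  of that half-width.\<close>

definition coord_bump :: "nat \<Rightarrow> (nat \<Rightarrow> real) \<Rightarrow> real \<Rightarrow> (nat \<Rightarrow> real) \<Rightarrow> real" where
  "coord_bump p a r x = (max 0 (r\<^sup>2 - (\<Sum>i<p. (x i - a i)\<^sup>2)))\<^sup>2"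

lemma coord_bump_C1: "C1_coord p (pts p) (coord_bump p a r)"
proof -
  have "C1_coord p (pts p) (\<lambda>x. r\<^sup>2 + (\<Sum>i<p. -1 * ((x i + - a i) * (x i + - a i))))"
    by (intro C1_coord_add C1_coord_sum C1_coord_const C1_coord_mult C1_coord_proj) auto
  then have "C1_coord p (pts p) (\<lambda>x. r\<^sup>2 - (\<Sum>i<p. (x i - a i)\<^sup>2))"
    by (simp add: power2_eq_square sum_negf)
  then show ?thesis
    unfolding coord_bump_def
    by (intro C1_coord_compose(1)[where \<phi> = "\<lambda>s. (max 0 s)\<^sup>2" and \<phi>' = "\<lambda>s. 2 * max 0 s"] max_0_power2_has_derivative continuous_intros) auto
qed

lemma coord_bump_nonneg: "coord_bump p a r x \<ge> 0"
  by (simp add: coord_bump_def)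

lemma coord_bump_pos: "r > 0 \<Longrightarrow> coord_bump p a r a > 0"
  by (simp add: coord_bump_def)

lemma coord_bump_eq_0:
  assumes "r > 0" "i < p" "\<bar>x i - a i\<bar> > r" shows "coord_bump p a r x = 0"
proof -
  have "r\<^sup>2 \<le> (x i - a i)\<^sup>2" using assms by (simp add: abs_le_square_iff[symmetric])
  also have "\<dots> \<le> (\<Sum>i<p. (x i - a i)\<^sup>2)" using assms by (intro member_le_sum) auto
  finally show ?thesis by (simp add: coord_bump_def)
qed

section \<open>Integration by parts on coordinate space\<close>

lemma space_coord_lebesgue: "space (coord_lebesgue p) = pts p"
  by (simp add: coord_lebesgue_def coord_space_def space_PiM)

lemma product_sigma_finite_lborel: "product_sigma_finite (\<lambda>_. lborel :: real measure)"
  by unfold_locales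

text \<open>Extension by zero maps coordinate space measurably into the full product over all
  natural numbers, where product and Borel sets coincide. Restriction is a continuous left inverse,
  so an open set is the preimage of an open set.\<close>

lemma openin_coord_sets:
  assumes "openin (coord_space p) S" shows "S \<in> sets (coord_lebesgue p)"
proof -
  let ?R = "\<lambda>x. restrict x {..<p}" and ?E = "\<lambda>x i. if i < p then x i else 0 :: real"
  have "continuous_map (product_topology (\<lambda>_. euclideanreal) UNIV) (coord_space p) ?R"
    unfolding coord_space_def by (auto simp: continuous_map_componentwise intro: continuous_map_product_projection)
  from openin_continuous_map_preimage[OF this assms]
  have "open {x. ?R x \<in> S}" by (simp add: euclidean_product_topology)
  then have "{x. ?R x \<in> S} \<in> sets (Pi\<^sub>M UNIV (\<lambda>_. borel))"
    by (simp add: sets_PiM_equal_borel)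
  moreover have "?E \<in> measurable (coord_lebesgue p) (Pi\<^sub>M UNIV (\<lambda>_. borel))"
    unfolding coord_lebesgue_def
  proof (rule measurable_PiM_single')
    show "(\<lambda>x. ?E x i) \<in> borel_measurable (Pi\<^sub>M {..<p} (\<lambda>_. lborel))" for i
      using measurable_component_singleton[of i "{..<p}" "\<lambda>_. lborel"] by (cases "i < p") auto
  qed simp
  ultimately have "?E -` {x. ?R x \<in> S} \<inter> space (coord_lebesgue p) \<in> sets (coord_lebesgue p)"
    by (rule measurable_sets[rotated])
  moreover have "?R (?E x) = x" if "x \<in> pts p" for x
    using that by (auto simp: topspace_coord extensional_def)
  then have "?E -` {x. ?R x \<in> S} \<inter> space (coord_lebesgue p) = S"
    using openin_subset[OF assms] unfolding space_coord_lebesgue by auto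
  ultimately show ?thesis by simp
qed

lemma openin_tendsto_preimage:
  assumes S: "openin X S" and f: "\<And>x. x \<in> S \<Longrightarrow> (f \<longlongrightarrow> f x) (nhdsin X x)" and "open V"
  shows "openin X {x \<in> S. f x \<in> V}"
proof -
  have "openin (subtopology X S) {x \<in> topspace (subtopology X S). f x \<in> V}"
    using continuous_map_iff_tendsto[OF S, of f] f \<open>open V\<close>
    by (intro openin_continuous_map_preimage[of _ euclidean]) auto
  moreover have "topspace (subtopology X S) = S"
    using openin_subset[OF S] by auto
  ultimately show ?thesis unfolding openin_open_subtopology[OF S] by (elim conjE) (simp only:)
qed

text \<open>Stated for an arbitrary topology whose open sets are measurable, because it is applied
  both to coordinate space and to the manifold.\<close>

lemma borel_measurable_if_tendsto:
  fixes f :: "'a \<Rightarrow> real"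
  assumes N: "space N = topspace X" "\<And>S. openin X S \<Longrightarrow> S \<in> sets N"
    and S: "openin X S" and f: "\<And>x. x \<in> S \<Longrightarrow> (f \<longlongrightarrow> f x) (nhdsin X x)"
  shows "(\<lambda>x. if x \<in> S then f x else 0) \<in> borel_measurable N"
proof (rule borel_measurableI)
  fix V :: "real set" assume "open V"
  have *: "(\<lambda>x. if x \<in> S then f x else 0) -` V \<inter> space N =
    {x \<in> S. f x \<in> V} \<union> (if 0 \<in> V then space N - S else {})"
    using openin_subset[OF S] by (auto simp: N(1) split: if_splits)
  show "(\<lambda>x. if x \<in> S then f x else 0) -` V \<inter> space N \<in> sets N"
    unfolding * using N(2)[OF openin_tendsto_preimage[OF S f \<open>open V\<close>]] N(2)[OF S]
    by auto
qed

lemma ccont_borel_measurable: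
  assumes S: "openin (coord_space p) S" and f: "\<And>x. x \<in> S \<Longrightarrow> ccont p f x"
  shows "(\<lambda>x. if x \<in> S then f x else 0) \<in> borel_measurable (coord_lebesgue p)"
  using f by (intro borel_measurable_if_tendsto[OF space_coord_lebesgue openin_coord_sets S]) (auto simp: ccont_def)

abbreviation coord_cube :: "nat \<Rightarrow> (nat \<Rightarrow> real) \<Rightarrow> real \<Rightarrow> (nat \<Rightarrow> real) set" where
  "coord_cube p a r \<equiv> Pi\<^sub>E {..<p} (\<lambda>i. {a i - r..a i + r})"

lemma compactin_coord_cube: "compactin (coord_space p) (coord_cube p a r)"
  unfolding coord_space_def compactin_PiE by (simp add: compactin_euclidean_iff)

lemma emeasure_coord_cube_finite: "coord_cube p a r \<in> sets (coord_lebesgue p)" "emeasure (coord_lebesgue p) (coord_cube p a r) < \<infinity>"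
proof -
  interpret product_sigma_finite "\<lambda>_::nat. lborel :: real measure" by (rule product_sigma_finite_lborel)
  show "coord_cube p a r \<in> sets (coord_lebesgue p)"
    unfolding coord_lebesgue_def by (rule sets_PiM_I_finite) auto
  have "emeasure (coord_lebesgue p) (coord_cube p a r) = (\<Prod>i<p. emeasure lborel {a i - r..a i + r})"
    unfolding coord_lebesgue_def by (rule emeasure_PiM) auto
  also have "\<dots> < \<infinity>"
    by (auto simp: less_top[symmetric] ennreal_prod_eq_top emeasure_lborel_Icc_eq)
  finally show "emeasure (coord_lebesgue p) (coord_cube p a r) < \<infinity>" .
qed

lemma emeasure_coord_cube_pos:
  assumes "r > 0" shows "emeasure (coord_lebesgue p) (Pi\<^sub>E {..<p} (\<lambda>i. {a i - r<..<a i + r})) > 0"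
proof -
  let ?C = "Pi\<^sub>E {..<p} (\<lambda>i. {a i - r<..<a i + r})"
  interpret product_sigma_finite "\<lambda>_::nat. lborel :: real measure" by (rule product_sigma_finite_lborel)
  have "emeasure (coord_lebesgue p) (?C) = (\<Prod>i<p. emeasure lborel {a i - r<..<a i + r})"
    unfolding coord_lebesgue_def by (rule emeasure_PiM) auto
  also have "\<dots> = ennreal (2 * r) ^ p"
    using assms by simp
  also have "\<dots> > 0" using assms by (simp add: ennreal_power)
  finally show ?thesis .
qed

lemma ccont_compact_support_integrable:
  assumes f: "\<And>x. x \<in> pts p \<Longrightarrow> ccont p f x"
    and supp: "\<And>x. x \<in> pts p \<Longrightarrow> x \<notin> coord_cube p a r \<Longrightarrow> f x = 0"
  shows "integrable (coord_lebesgue p) f"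
proof -
  have "continuous_map (subtopology (coord_space p) (pts p)) euclideanreal f"
    using ccont_iff[of p "pts p" f] f by simp
  then have "continuous_map (coord_space p) euclideanreal f" by simp
  from image_compactin[OF compactin_coord_cube this]
  have "compact (f ` coord_cube p a r)" by simp
  then have "bounded (f ` coord_cube p a r)" by (rule compact_imp_bounded)
  then obtain B where B: "\<And>x. x \<in> coord_cube p a r \<Longrightarrow> norm (f x) \<le> B"
    unfolding bounded_iff by blast
  show ?thesis
  proof (rule integrableI_bounded_set[OF emeasure_coord_cube_finite(1)[of p a r] _ emeasure_coord_cube_finite(2)[of p a r]])
    have "(\<lambda>x. if x \<in> pts p then f x else 0) \<in> borel_measurable (coord_lebesgue p)"
      by (rule ccont_borel_measurable[OF openin_topspace f])
    then show "f \<in> borel_measurable (coord_lebesgue p)"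
      by (rule measurable_cong[THEN iffD1, rotated]) (simp add: space_coord_lebesgue)
    show "AE x in coord_lebesgue p. x \<in> coord_cube p a r \<longrightarrow> norm (f x) \<le> B"
      by (intro AE_I2 impI B)
    show "AE x in coord_lebesgue p. x \<notin> coord_cube p a r \<longrightarrow> f x = 0"
      using supp by (intro AE_I2 impI) (auto simp: space_coord_lebesgue)
  qed
qed

lemma closedin_coord_cube: "closedin (coord_space p) (coord_cube p a r)"
  unfolding coord_space_def by (auto simp: closedin_product_topology)

text \<open>Fubini isolates the coordinate \<open>i\<close>; along each line in that direction the
  fundamental theorem of calculus leaves the values of \<open>F\<close> at two points outside the
  cube.\<close>

lemma integral_partial_deriv_compact_support:
  assumes F: "C1_coord p (pts p) F" and i: "i < p"
    and supp: "\<And>x. x \<in> pts p \<Longrightarrow> x \<notin> coord_cube p a r \<Longrightarrow> F x = 0"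
  shows "integrable (coord_lebesgue p) (partial_deriv i F)" "(\<integral>x. partial_deriv i F x \<partial>coord_lebesgue p) = 0"
proof -
  \<comment> \<open>The complement of the closed cube is open, so \<open>F\<close> vanishes near
    \<open>x\<close> and not only at it.\<close>
  have zero: "partial_deriv i F x = 0" if "x \<in> pts p" "x \<notin> coord_cube p a r" for x
  proof -
    have o: "openin (coord_space p) (pts p - coord_cube p a r)"
      using closedin_coord_cube by blast
    have "eventually (\<lambda>y. F y = 0) (nhdc p x)"
      by (rule eventually_mono[OF eventually_nhdsin_openin[OF o, of x]]) (use that supp in blast)+
    from partial_deriv_cong[OF that(1) i this] show ?thesis by (simp add: partial_deriv_def)
  qed
  show int: "integrable (coord_lebesgue p) (partial_deriv i F)"
    using C1_coord_ccont_deriv[OF F _ i] zero by (rule ccont_compact_support_integrable)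
  interpret product_sigma_finite "\<lambda>_::nat. lborel :: real measure" by (rule product_sigma_finite_lborel)
  have ins: "{..<p} = insert i ({..<p} - {i})" using i by auto
  have "(\<integral>x. partial_deriv i F x \<partial>coord_lebesgue p) =
      (\<integral>x. (\<integral>t. partial_deriv i F (x(i := t)) \<partial>lborel) \<partial>Pi\<^sub>M ({..<p} - {i}) (\<lambda>_. lborel))"
    using product_integral_insert[of "{..<p} - {i}" i "partial_deriv i F"] int
    unfolding coord_lebesgue_def ins[symmetric] by simp
  also have "\<dots> = (\<integral>x. 0 \<partial>Pi\<^sub>M ({..<p} - {i}) (\<lambda>_. lborel :: real measure))"
  proof (rule Bochner_Integration.integral_cong)
    fix x assume "x \<in> space (Pi\<^sub>M ({..<p} - {i}) (\<lambda>_. lborel :: real measure))"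
    then have xt: "x(i := t) \<in> pts p" for t
      using i by (auto simp: space_PiM PiE_def topspace_coord extensional_def)
    \<comment> \<open>The extra 1 puts both end points strictly outside the cube; |r| serves either
      sign of \<open>r\<close>.\<close>
    define u v where "u = a i - \<bar>r\<bar> - 1" and "v = a i + \<bar>r\<bar> + 1"
    have out: "x(i := t) \<notin> coord_cube p a r" if "t \<notin> {u<..<v}" for t
      using that i by (force simp: u_def v_def PiE_iff abs_if split: if_splits)
    have d: "((\<lambda>t. F (x(i := t))) has_real_derivative partial_deriv i F (x(i := t))) (at t)" for t
      using C1_coord_deriv[OF F xt i, of t] by simp
    have cont: "isCont (\<lambda>t. partial_deriv i F (x(i := t))) t" for t
    proof -
      have "eventually (\<lambda>s. dist (partial_deriv i F (x(i := s))) (partial_deriv i F (x(i := t))) < e) (nhds t)" if "e > 0" for e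
        using eventually_line[OF xt i, of _ t] C1_coord_ccont_deriv[OF F xt i, of t] that
        by (auto simp: ccont_def tendsto_iff)
      then show ?thesis unfolding isCont_def tendsto_iff by (auto simp: eventually_at_filter intro: eventually_mono)
    qed
    have "(\<integral>t. partial_deriv i F (x(i := t)) * indicator {u..v} t \<partial>lborel) = F (x(i := v)) - F (x(i := u))"
      by (rule integral_FTC_Icc_real[OF _ d cont]) (simp add: u_def v_def)
    moreover have "F (x(i := v)) = 0" "F (x(i := u)) = 0"
      by (intro supp xt out; simp)+
    moreover have "partial_deriv i F (x(i := t)) * indicator {u..v} t = partial_deriv i F (x(i := t))" for t
      by (cases "t \<in> {u<..<v}") (auto simp: zero[OF xt out])
    ultimately show "(\<integral>t. partial_deriv i F (x(i := t)) \<partial>lborel) = 0" by simp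
  qed simp
  finally show "(\<integral>x. partial_deriv i F x \<partial>coord_lebesgue p) = 0" by simp
qed

section \<open>Functions of class $C^1$ on manifolds\<close>

locale smooth_mfd =
  fixes M :: "'a manifold"
  assumes smooth: "smooth_manifold M"
begin

abbreviation "dm \<equiv> mfd_dim M"
abbreviation "Top \<equiv> mfd_top M"
abbreviation "crd \<equiv> coord_space (mfd_dim M)"
abbreviation "Atl \<equiv> mfd_atlas M"
abbreviation "pt \<equiv> mfd_points M"
abbreviation "nhd \<equiv> nhdsin (mfd_top M)"

section \<open>Charts, limits and C1 functions in local coordinates\<close>

lemma is_chart: "c \<in> Atl \<Longrightarrow> is_chart Top dm c"
  using smooth by (simp add: smooth_manifold_def)

lemma chart_dom_open: "c \<in> Atl \<Longrightarrow> openin Top (chart_dom c)"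
  using is_chart by (simp add: is_chart_def)

lemma chart_img_open: "c \<in> Atl \<Longrightarrow> openin crd (chart_img c)"
  using is_chart by (simp add: is_chart_def)

lemma points_cover: "mfd_points M = (\<Union>c\<in>Atl. chart_dom c)"
  using smooth by (simp add: smooth_manifold_def)

lemma chart_at: 
  assumes "\<theta> \<in> pt"
  shows "chart_at M \<theta> \<in> Atl" "\<theta> \<in> chart_dom (chart_at M \<theta>)"
proof -
  have "\<exists>c. c \<in> Atl \<and> \<theta> \<in> chart_dom c" using assms points_cover by auto
  from someI_ex[OF this] show "chart_at M \<theta> \<in> Atl" "\<theta> \<in> chart_dom (chart_at M \<theta>)"
    by (auto simp: chart_at_def)
qed

lemma chart_dom_points: "c \<in> Atl \<Longrightarrow> \<theta> \<in> chart_dom c \<Longrightarrow> \<theta> \<in> pt"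
  using points_cover by auto

lemma chart_homeo:
  assumes "c \<in> Atl"
  shows "homeomorphic_map (subtopology Top (chart_dom c)) (subtopology crd (chart_img c)) (chart_map c)"
    "topspace (subtopology Top (chart_dom c)) = chart_dom c" "topspace (subtopology crd (chart_img c)) = chart_img c"
  using is_chart[OF assms] openin_subset[OF chart_dom_open[OF assms]] openin_subset[OF chart_img_open[OF assms]]
  by (auto simp: is_chart_def)

lemma chart_inj: "c \<in> Atl \<Longrightarrow> inj_on (chart_map c) (chart_dom c)"
  using homeomorphic_imp_injective_map[OF chart_homeo(1)] chart_homeo(2) by fastforce

lemma chart_inv_map: "c \<in> Atl \<Longrightarrow> \<theta> \<in> chart_dom c \<Longrightarrow> chart_inv c (chart_map c \<theta>) = \<theta>"
  unfolding chart_inv_def by (rule inv_into_f_f[OF chart_inj])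

lemma chart_map_inv: "x \<in> chart_img c \<Longrightarrow> chart_map c (chart_inv c x) = x"
  and chart_inv_dom: "x \<in> chart_img c \<Longrightarrow> chart_inv c x \<in> chart_dom c"
  unfolding chart_inv_def by (auto simp: f_inv_into_f inv_into_into)

lemma chart_map_coord: "c \<in> Atl \<Longrightarrow> \<theta> \<in> chart_dom c \<Longrightarrow> chart_map c \<theta> \<in> pts dm"
  using openin_subset[OF chart_img_open] by blast

lemma chart_image_open:
  assumes "c \<in> Atl" "openin Top S"
  shows "openin crd (chart_map c ` (S \<inter> chart_dom c))"
proof -
  have "openin (subtopology Top (chart_dom c)) (S \<inter> chart_dom c)"
    using assms chart_dom_open openin_open_subtopology by blast
  from homeomorphic_imp_open_map[OF chart_homeo(1)[OF assms(1)], unfolded open_map_def, rule_format, OF this]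
  show ?thesis using openin_open_subtopology[OF chart_img_open[OF assms(1)]] by blast
qed

lemma chart_preimage_open:
  assumes "c \<in> Atl" "openin crd S"
  shows "openin Top {\<theta> \<in> chart_dom c. chart_map c \<theta> \<in> S}"
proof -
  have "openin (subtopology crd (chart_img c)) (S \<inter> chart_img c)"
    using assms chart_img_open openin_open_subtopology by blast
  from openin_continuous_map_preimage[OF homeomorphic_imp_continuous_map[OF chart_homeo(1)[OF assms(1)]] this]
  have "openin Top {\<theta> \<in> chart_dom c. chart_map c \<theta> \<in> S \<inter> chart_img c}"
    unfolding chart_homeo(2)[OF assms(1)] openin_open_subtopology[OF chart_dom_open[OF assms(1)]] by blast
  moreover have "{\<theta> \<in> chart_dom c. chart_map c \<theta> \<in> S \<inter> chart_img c} = {\<theta> \<in> chart_dom c. chart_map c \<theta> \<in> S}"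
    by auto
  ultimately show ?thesis by simp
qed

text \<open>A chart is a homeomorphism between open sets. This identity is the bridge by which
  limits and local equalities move between the manifold and coordinates.\<close>

lemma nhdsin_chart:
  assumes c: "c \<in> Atl" and \<theta>: "\<theta> \<in> chart_dom c"
  shows "nhdc dm (chart_map c \<theta>) = filtermap (chart_map c) (nhd \<theta>)"
  unfolding filter_eq_iff eventually_filtermap
proof
  fix P
  have t: "\<theta> \<in> topspace Top" "chart_map c \<theta> \<in> pts dm"
    using chart_dom_points[OF c \<theta>] chart_map_coord[OF c \<theta>] by auto
  show "eventually P (nhdc dm (chart_map c \<theta>)) \<longleftrightarrow> eventually (\<lambda>\<eta>. P (chart_map c \<eta>)) (nhd \<theta>)" (is "?L \<longleftrightarrow> ?R")
  proof
    assume ?L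
    then obtain S where "openin crd S" "chart_map c \<theta> \<in> S" "\<forall>x\<in>S. P x"
      using t by (auto simp: eventually_nhdsin)
    then show ?R unfolding eventually_nhdsin using chart_preimage_open[OF c, of S] \<theta> by blast
  next
    assume ?R
    then obtain S where "openin Top S" "\<theta> \<in> S" "\<forall>\<eta>\<in>S. P (chart_map c \<eta>)"
      using t by (auto simp: eventually_nhdsin)
    then show ?L unfolding eventually_nhdsin using chart_image_open[OF c, of S] \<theta> by blast
  qed
qed

lemma ccont_chart_iff:
  assumes c: "c \<in> Atl" and \<theta>: "\<theta> \<in> chart_dom c"
  shows "ccont dm (\<lambda>x. f (chart_inv c x)) (chart_map c \<theta>) \<longleftrightarrow> (f \<longlongrightarrow> f \<theta>) (nhd \<theta>)"
proof -
  have "eventually (\<lambda>\<eta>. f (chart_inv c (chart_map c \<eta>)) = f \<eta>) (nhd \<theta>)"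
    using eventually_nhdsin_openin[OF chart_dom_open[OF c] \<theta>] by eventually_elim (simp add: chart_inv_map[OF c])
  from tendsto_cong[OF this] show ?thesis
    unfolding ccont_def nhdsin_chart[OF c \<theta>] filterlim_filtermap chart_inv_map[OF c \<theta>] by blast
qed

text \<open>A version of \<open>Ck_on M 1\<close> relative to a subset. Volume densities and
  components of vector fields make sense over one chart domain only, and gluing needs statements
  about open pieces.\<close>

definition C1_on :: "'a set \<Rightarrow> ('a \<Rightarrow> real) \<Rightarrow> bool" where
  "C1_on S f \<longleftrightarrow> (\<forall>c\<in>Atl. C1_coord dm (chart_map c ` (S \<inter> chart_dom c)) (\<lambda>x. f (chart_inv c x)))"

lemma Ck_on_1_iff: "Ck_on M 1 f \<longleftrightarrow> C1_on pt f"
proof -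
  have "mfd_points M \<inter> chart_dom c = chart_dom c" if "c \<in> Atl" for c
    using openin_subset[OF chart_dom_open[OF that]] by blast
  then show ?thesis unfolding Ck_on_def C1_on_def using Ck_coord_1_iff[OF chart_img_open]
    by (intro ball_cong refl) metis
qed

lemma C1_onD: "C1_on S f \<Longrightarrow> c \<in> Atl \<Longrightarrow> C1_coord dm (chart_map c ` (S \<inter> chart_dom c)) (\<lambda>x. f (chart_inv c x))"
  by (simp add: C1_on_def)

lemma C1_on_deriv:
  assumes "C1_on S f" "\<theta> \<in> S" "c \<in> Atl" "\<theta> \<in> chart_dom c" "i < dm"
  shows "((\<lambda>t. f (chart_inv c ((chart_map c \<theta>)(i := t)))) has_real_derivative chart_deriv c i f \<theta>) (at (chart_map c \<theta> i))"
  unfolding chart_deriv_def using assms by (intro C1_coord_deriv[OF C1_onD]) auto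

lemma chart_derivI:
  "((\<lambda>t. f (chart_inv c ((chart_map c \<theta>)(i := t)))) has_real_derivative D) (at (chart_map c \<theta> i)) \<Longrightarrow> chart_deriv c i f \<theta> = D"
  unfolding chart_deriv_def by (rule partial_derivI)

lemma C1_on_tendsto:
  assumes "C1_on S f" "\<theta> \<in> S" "\<theta> \<in> pt"
  shows "(f \<longlongrightarrow> f \<theta>) (nhd \<theta>)"
proof -
  obtain c where c: "c \<in> Atl" "\<theta> \<in> chart_dom c" using chart_at[OF assms(3)] by blast
  show ?thesis using ccont_chart_iff[OF c, of f] C1_coord_ccont[OF C1_onD[OF assms(1) c(1)]] assms(2) c(2) by blast
qed

lemma chart_deriv_cong:
  assumes "c \<in> Atl" "\<theta> \<in> chart_dom c" "i < dm" "eventually (\<lambda>\<eta>. f \<eta> = h \<eta>) (nhd \<theta>)"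
  shows "chart_deriv c i f \<theta> = chart_deriv c i h \<theta>"
  unfolding chart_deriv_def
proof (rule partial_deriv_cong[OF chart_map_coord[OF assms(1,2)] assms(3)])
  show "eventually (\<lambda>y. f (chart_inv c y) = h (chart_inv c y)) (nhdc dm (chart_map c \<theta>))"
    unfolding nhdsin_chart[OF assms(1,2)] eventually_filtermap
    using assms(4) eventually_nhdsin_openin[OF chart_dom_open[OF assms(1)] assms(2)]
    by eventually_elim (simp add: chart_inv_map[OF assms(1)])
qed

lemma chart_deriv_tendsto:
  assumes "C1_on S f" "\<theta> \<in> S" "c \<in> Atl" "\<theta> \<in> chart_dom c" "i < dm" "openin Top S"
  shows "(chart_deriv c i f \<longlongrightarrow> chart_deriv c i f \<theta>) (nhd \<theta>)"
proof -
  have "ccont dm (partial_deriv i (\<lambda>x. f (chart_inv c x))) (chart_map c \<theta>)"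
    using assms by (intro C1_coord_ccont_deriv[OF C1_onD]) auto
  then show ?thesis
    unfolding ccont_def nhdsin_chart[OF assms(3,4)] filterlim_filtermap chart_deriv_def[abs_def] by simp
qed

lemma C1_on_subset: "C1_on S f \<Longrightarrow> T \<subseteq> S \<Longrightarrow> C1_on T f"
  unfolding C1_on_def by (meson C1_coord_subset Int_mono image_mono order_refl)

lemma C1_on_Un: "C1_on S f \<Longrightarrow> C1_on T f \<Longrightarrow> C1_on (S \<union> T) f"
  unfolding C1_on_def by (simp add: Int_Un_distrib2 image_Un C1_coord_Un)

lemma C1_on_cong:
  assumes "openin Top S" "\<And>\<theta>. \<theta> \<in> S \<Longrightarrow> f \<theta> = h \<theta>" "C1_on S f"
  shows "C1_on S h"
  unfolding C1_on_def
proof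
  fix c assume c: "c \<in> Atl"
  show "C1_coord dm (chart_map c ` (S \<inter> chart_dom c)) (\<lambda>x. h (chart_inv c x))"
    by (rule C1_coord_cong[OF chart_image_open[OF c assms(1)] _ C1_onD[OF assms(3) c]])
      (auto simp: chart_inv_map[OF c] assms(2))
qed

lemma C1_on_const: "C1_on S (\<lambda>_. a)"
  by (simp add: C1_on_def C1_coord_const)

lemma C1_on_add: "openin Top S \<Longrightarrow> C1_on S f \<Longrightarrow> C1_on S h \<Longrightarrow> C1_on S (\<lambda>\<theta>. f \<theta> + h \<theta>)"
  unfolding C1_on_def by (simp add: C1_coord_add[OF chart_image_open])

lemma C1_on_mult: "openin Top S \<Longrightarrow> C1_on S f \<Longrightarrow> C1_on S h \<Longrightarrow> C1_on S (\<lambda>\<theta>. f \<theta> * h \<theta>)"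
  unfolding C1_on_def by (simp add: C1_coord_mult[OF chart_image_open])

lemma C1_on_sum: "openin Top S \<Longrightarrow> (\<And>k. k \<in> I \<Longrightarrow> C1_on S (f k)) \<Longrightarrow> C1_on S (\<lambda>\<theta>. \<Sum>k\<in>I. f k \<theta>)"
  unfolding C1_on_def by (simp add: C1_coord_sum[OF chart_image_open])

lemma C1_on_compose:
  assumes S: "openin Top S" and f: "C1_on S f"
    and d: "\<And>\<theta>. \<theta> \<in> S \<Longrightarrow> (\<phi> has_real_derivative \<phi>' (f \<theta>)) (at (f \<theta>))" and c: "\<And>\<theta>. \<theta> \<in> S \<Longrightarrow> isCont \<phi>' (f \<theta>)"
  shows "C1_on S (\<lambda>\<theta>. \<phi> (f \<theta>))"
    and "\<And>c i \<theta>. c \<in> Atl \<Longrightarrow> i < dm \<Longrightarrow> \<theta> \<in> S \<Longrightarrow> \<theta> \<in> chart_dom c \<Longrightarrow>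
       chart_deriv c i (\<lambda>\<theta>. \<phi> (f \<theta>)) \<theta> = \<phi>' (f \<theta>) * chart_deriv c i f \<theta>"
proof -
  note * = C1_coord_compose[OF chart_image_open[OF _ S] C1_onD[OF f], where \<phi> = \<phi> and \<phi>' = \<phi>']
  have **: "(\<phi> has_real_derivative \<phi>' (f (chart_inv c x))) (at (f (chart_inv c x)))"
    "isCont \<phi>' (f (chart_inv c x))" if "c \<in> Atl" "x \<in> chart_map c ` (S \<inter> chart_dom c)" for c x
    using that d c by (auto simp: chart_inv_map)
  show "C1_on S (\<lambda>\<theta>. \<phi> (f \<theta>))" unfolding C1_on_def using *(1) ** by blast
  show "chart_deriv c i (\<lambda>\<theta>. \<phi> (f \<theta>)) \<theta> = \<phi>' (f \<theta>) * chart_deriv c i f \<theta>"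
    if "c \<in> Atl" "i < dm" "\<theta> \<in> S" "\<theta> \<in> chart_dom c" for c i \<theta>
    using *(2)[OF that(1,1) **[OF that(1)] that(2), of "chart_map c \<theta>"] that
    by (auto simp: chart_deriv_def chart_inv_map)
qed

lemma C1_on_divide:
  assumes S: "openin Top S" "C1_on S f" "C1_on S h" and h: "\<And>\<theta>. \<theta> \<in> S \<Longrightarrow> h \<theta> \<noteq> 0"
  shows "C1_on S (\<lambda>\<theta>. f \<theta> / h \<theta>)"
proof -
  have "C1_on S (\<lambda>\<theta>. inverse (h \<theta>))"
    using h by (intro C1_on_compose(1)[OF S(1,3), where \<phi>' = "\<lambda>s. - (inverse s ^ Suc (Suc 0))"] DERIV_inverse continuous_intros) auto
  from C1_on_mult[OF S(1,2) this] show ?thesis by (simp add: divide_inverse)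
qed

lemma chart_deriv_add:
  assumes "C1_on S f" "C1_on S h" "\<theta> \<in> S" "c \<in> Atl" "\<theta> \<in> chart_dom c" "i < dm"
  shows "chart_deriv c i (\<lambda>\<theta>. f \<theta> + h \<theta>) \<theta> = chart_deriv c i f \<theta> + chart_deriv c i h \<theta>"
  by (intro chart_derivI DERIV_add C1_on_deriv[OF _ assms(3-6)] assms(1,2))

lemma chart_deriv_sum:
  assumes "\<And>k. k \<in> I \<Longrightarrow> C1_on S (f k)" "\<theta> \<in> S" "c \<in> Atl" "\<theta> \<in> chart_dom c" "i < dm"
  shows "chart_deriv c i (\<lambda>\<theta>. \<Sum>k\<in>I. f k \<theta>) \<theta> = (\<Sum>k\<in>I. chart_deriv c i (f k) \<theta>)"
  by (intro chart_derivI DERIV_sum C1_on_deriv[OF _ assms(2-5)] assms(1))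

lemma chart_deriv_mult:
  assumes "C1_on S f" "C1_on S h" "\<theta> \<in> S" "c \<in> Atl" "\<theta> \<in> chart_dom c" "i < dm"
  shows "chart_deriv c i (\<lambda>\<theta>. f \<theta> * h \<theta>) \<theta> = chart_deriv c i f \<theta> * h \<theta> + f \<theta> * chart_deriv c i h \<theta>"
proof -
  have "chart_inv c ((chart_map c \<theta>)(i := chart_map c \<theta> i)) = \<theta>"
    using assms by (simp add: chart_inv_map)
  then show ?thesis
    using DERIV_mult[OF C1_on_deriv[OF assms(1,3-6)] C1_on_deriv[OF assms(2,3-6)]]
    by (intro chart_derivI) (simp add: algebra_simps)
qed

lemma transition_C1:
  assumes "c \<in> Atl" "c' \<in> Atl" "i < dm"
  shows "C1_coord dm (chart_map c ` (chart_dom c' \<inter> chart_dom c)) (\<lambda>x. chart_map c' (chart_inv c x) i)"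
proof -
  have "smooth_coord dm (chart_map c ` (chart_dom c \<inter> chart_dom c')) (\<lambda>x. chart_map c' (chart_inv c x) i)"
    using smooth assms unfolding smooth_manifold_def by blast
  from smooth_coord_C1[OF _ this] show ?thesis
    using chart_image_open[OF assms(1) chart_dom_open[OF assms(2)]] by (simp add: Int_commute)
qed

text \<open>Seen through \<open>c'\<close>, the function is its expression in \<open>c\<close>
  composed with the transition map, which is smooth by the compatibility of the atlas; both claims
  are then the chain rule.\<close>

lemma C1_on_chart_transfer:
  assumes c: "c \<in> Atl" and c': "c' \<in> Atl" and S: "openin Top S" "S \<subseteq> chart_dom c"
    and f: "C1_coord dm (chart_map c ` S) (\<lambda>x. f (chart_inv c x))"
  shows "C1_coord dm (chart_map c' ` (S \<inter> chart_dom c')) (\<lambda>x. f (chart_inv c' x))"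
    and "\<And>\<theta> i. \<theta> \<in> S \<Longrightarrow> \<theta> \<in> chart_dom c' \<Longrightarrow> i < dm \<Longrightarrow> chart_deriv c' i f \<theta> =
      (\<Sum>k<dm. chart_deriv c' i (\<lambda>\<eta>. chart_map c \<eta> k) \<theta> * chart_deriv c k f \<theta>)"
proof -
  let ?U = "chart_map c' ` (S \<inter> chart_dom c')" and ?T = "\<lambda>x. chart_map c (chart_inv c' x)"
  have U: "openin crd ?U" by (rule chart_image_open[OF c' S(1)])
  have W: "openin crd (chart_map c ` S)" using chart_image_open[OF c S(1)] S(2) by (simp add: Int_absorb2)
  have TW: "?T x \<in> chart_map c ` S" if "x \<in> ?U" for x using that by (auto simp: chart_inv_map[OF c'])
  have T: "C1_coord dm ?U (\<lambda>x. ?T x k)" if "k < dm" for k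
    using S(2) by (intro C1_coord_subset[OF transition_C1[OF c' c that]]) auto
  have cr1: "C1_coord dm ?U (\<lambda>x. f (chart_inv c (?T x)))"
    by (rule chain_rule_coord(1)[OF U W f]) (fact TW T)+
  have cr2: "partial_deriv i (\<lambda>x. f (chart_inv c (?T x))) x =
      (\<Sum>k<dm. partial_deriv k (\<lambda>x. f (chart_inv c x)) (?T x) * partial_deriv i (\<lambda>x. ?T x k) x)"
    if "i < dm" "x \<in> ?U" for i x
    by (rule chain_rule_coord(2)[OF U W f _ _ that]) (fact TW T)+
  have eq: "f (chart_inv c (?T x)) = f (chart_inv c' x)" if "x \<in> ?U" for x
    using that S(2) by (auto simp: chart_inv_map[OF c'] chart_inv_map[OF c])
  show "C1_coord dm ?U (\<lambda>x. f (chart_inv c' x))"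
    by (rule C1_coord_cong[OF U _ cr1]) (rule eq)
  show "chart_deriv c' i f \<theta> = (\<Sum>k<dm. chart_deriv c' i (\<lambda>\<eta>. chart_map c \<eta> k) \<theta> * chart_deriv c k f \<theta>)"
    if "\<theta> \<in> S" "\<theta> \<in> chart_dom c'" "i < dm" for \<theta> i
  proof -
    have x: "chart_map c' \<theta> \<in> ?U" "chart_map c' \<theta> \<in> pts dm"
      using that chart_map_coord[OF c'] by auto
    have "eventually (\<lambda>x. f (chart_inv c' x) = f (chart_inv c (?T x))) (nhdc dm (chart_map c' \<theta>))"
      by (rule eventually_mono[OF eventually_nhdsin_openin[OF U x(1)]]) (simp add: eq)
    from partial_deriv_cong[OF x(2) that(3) this] cr2[OF that(3) x(1)]
    show ?thesis using that by (simp add: chart_deriv_def chart_inv_map[OF c'] mult.commute)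
  qed
qed

lemma C1_onI_chart:
  assumes "c \<in> Atl" "openin Top S" "S \<subseteq> chart_dom c" "C1_coord dm (chart_map c ` S) (\<lambda>x. f (chart_inv c x))"
  shows "C1_on S f"
  unfolding C1_on_def using C1_on_chart_transfer(1)[OF assms(1) _ assms(2-4)] by blast

lemma chart_deriv_change:
  assumes "C1_on S f" "openin Top S" "\<theta> \<in> S" "c \<in> Atl" "c' \<in> Atl" "\<theta> \<in> chart_dom c" "\<theta> \<in> chart_dom c'" "i < dm"
  shows "chart_deriv c' i f \<theta> = (\<Sum>k<dm. chart_deriv c' i (\<lambda>\<eta>. chart_map c \<eta> k) \<theta> * chart_deriv c k f \<theta>)"
  using assms C1_onD[OF assms(1,4)] chart_dom_open[OF assms(4)]
  by (intro C1_on_chart_transfer(2)[of c c' "S \<inter> chart_dom c"]) auto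

text \<open>The derivative of \<open>f\<close> along \<open>V\<close>, computed in the components of
  one chart. It is the inner product of \<open>V\<close> with the gradient of \<open>f\<close>,
  written without the metric.\<close>

definition dird :: "'a vfield \<Rightarrow> 'a chart \<Rightarrow> ('a \<Rightarrow> real) \<Rightarrow> 'a \<Rightarrow> real" where
  "dird V c f \<theta> = (\<Sum>i<dm. V c \<theta> i * chart_deriv c i f \<theta>)"

text \<open>The Jacobian matrix that carries the components of \<open>V\<close> from
  \<open>c\<close> to \<open>c'\<close> also expresses the partial derivatives in \<open>c\<close>
  through those in \<open>c'\<close>; exchanging the two sums lets it pass from one factor to the
  other.\<close>

lemma dird_chart_indep:
  assumes V: "Ck_vfield M k V" and f: "C1_on S f" "openin Top S" "\<theta> \<in> S"
    and c: "c \<in> Atl" "c' \<in> Atl" "\<theta> \<in> chart_dom c" "\<theta> \<in> chart_dom c'"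
  shows "dird V c f \<theta> = dird V c' f \<theta>"
proof -
  have V': "V c' \<theta> i = (\<Sum>j<dm. chart_deriv c j (\<lambda>\<eta>. chart_map c' \<eta> i) \<theta> * V c \<theta> j)" if "i < dm" for i
    using V c that unfolding Ck_vfield_def by blast
  have "dird V c f \<theta> = (\<Sum>j<dm. V c \<theta> j * (\<Sum>i<dm. chart_deriv c j (\<lambda>\<eta>. chart_map c' \<eta> i) \<theta> * chart_deriv c' i f \<theta>))"
    unfolding dird_def using chart_deriv_change[OF f c(2,1,4,3)] by simp
  also have "\<dots> = (\<Sum>j<dm. \<Sum>i<dm. chart_deriv c j (\<lambda>\<eta>. chart_map c' \<eta> i) \<theta> * V c \<theta> j * chart_deriv c' i f \<theta>)"
    by (simp add: sum_distrib_left mult_ac)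
  also have "\<dots> = (\<Sum>i<dm. \<Sum>j<dm. chart_deriv c j (\<lambda>\<eta>. chart_map c' \<eta> i) \<theta> * V c \<theta> j * chart_deriv c' i f \<theta>)"
    by (rule sum.swap)
  also have "\<dots> = dird V c' f \<theta>"
    unfolding dird_def by (simp add: V' sum_distrib_right)
  finally show ?thesis .
qed

section \<open>Compact cubes and bump functions on the manifold\<close>

lemma Hausdorff_top: "Hausdorff_space Top"
  using smooth by (simp add: smooth_manifold_def)

lemma chart_cube_compactin:
  assumes c: "c \<in> Atl" and cube: "coord_cube dm a r \<subseteq> chart_img c"
  shows "compactin Top {\<theta> \<in> chart_dom c. chart_map c \<theta> \<in> coord_cube dm a r}" (is "compactin Top ?K")
proof -
  have "chart_map c ` ?K = coord_cube dm a r" using cube by blast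
  moreover have "compactin (subtopology crd (chart_img c)) (coord_cube dm a r)"
    using cube compactin_coord_cube by (simp add: compactin_subtopology)
  ultimately have "compactin (subtopology Top (chart_dom c)) ?K"
    using homeomorphic_map_compactness[OF chart_homeo(1)[OF c], of ?K] unfolding chart_homeo(2)[OF c] by auto
  then show ?thesis by (simp add: compactin_subtopology)
qed

text \<open>Compactness does not depend on the ambient space, so the Hausdorff property makes the
  set closed in the whole manifold and not merely in the chart domain.\<close>

lemma chart_cube_closedin:
  assumes "c \<in> Atl" "coord_cube dm a r \<subseteq> chart_img c"
  shows "closedin Top {\<theta> \<in> chart_dom c. chart_map c \<theta> \<in> coord_cube dm a r}"
  by (rule compactin_imp_closedin[OF Hausdorff_top chart_cube_compactin[OF assms]])

lemma chart_cube_exists: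
  assumes c: "c \<in> Atl" and S: "openin Top S" and \<theta>: "\<theta> \<in> S" "\<theta> \<in> chart_dom c"
  obtains r where "r > 0" "coord_cube dm (chart_map c \<theta>) r \<subseteq> chart_map c ` (S \<inter> chart_dom c)"
proof -
  obtain \<delta> where \<delta>: "\<delta> > 0" "\<And>y. y \<in> pts dm \<Longrightarrow> (\<And>i. i < dm \<Longrightarrow> \<bar>y i - chart_map c \<theta> i\<bar> < \<delta>) \<Longrightarrow> y \<in> chart_map c ` (S \<inter> chart_dom c)"
    using openin_coord_box[OF chart_image_open[OF c S], of "chart_map c \<theta>"] \<theta> by blast
  have "y \<in> chart_map c ` (S \<inter> chart_dom c)" if "y \<in> coord_cube dm (chart_map c \<theta>) (\<delta> / 2)" for y
  proof (rule \<delta>(2))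
    show "y \<in> pts dm" using that by (auto simp: topspace_coord PiE_def)
    fix i assume "i < dm"
    then have "y i \<in> {chart_map c \<theta> i - \<delta> / 2..chart_map c \<theta> i + \<delta> / 2}" using that by (auto simp: PiE_def Pi_def)
    then show "\<bar>y i - chart_map c \<theta> i\<bar> < \<delta>" using \<delta>(1) by (auto simp: abs_less_iff)
  qed
  then show ?thesis using that[of "\<delta> / 2"] \<delta>(1) by auto
qed

definition bump :: "'a chart \<Rightarrow> (nat \<Rightarrow> real) \<Rightarrow> real \<Rightarrow> 'a \<Rightarrow> real" where
  "bump c a r \<theta> = (if \<theta> \<in> chart_dom c then coord_bump dm a r (chart_map c \<theta>) else 0)"

lemma bump_nonneg: "bump c a r \<theta> \<ge> 0"
  by (simp add: bump_def coord_bump_nonneg)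

lemma bump_pos: "c \<in> Atl \<Longrightarrow> \<theta> \<in> chart_dom c \<Longrightarrow> r > 0 \<Longrightarrow> bump c (chart_map c \<theta>) r \<theta> > 0"
  by (simp add: bump_def coord_bump_pos)

lemma bump_eq_0:
  assumes "c \<in> Atl" "r > 0" "\<theta> \<in> chart_dom c \<Longrightarrow> chart_map c \<theta> \<notin> coord_cube dm a r"
  shows "bump c a r \<theta> = 0"
proof (cases "\<theta> \<in> chart_dom c")
  case True
  then obtain i where "i < dm" "chart_map c \<theta> i \<notin> {a i - r..a i + r}"
    using assms(3) chart_map_coord[OF assms(1) True] unfolding PiE_def Pi_def topspace_coord by blast
  then show ?thesis using True assms(2) by (auto simp: bump_def abs_if intro!: coord_bump_eq_0)
qed (simp add: bump_def)

text \<open>The chart domain and the complement of \<open>K\<close> are open, cover the manifold,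
  and \<open>f\<close> is C1 on each. Closedness of \<open>K\<close> in the whole manifold is
  essential: it rules out a jump at the boundary of the chart domain.\<close>

lemma C1_on_zero_extension:
  assumes c: "c \<in> Atl" and f: "C1_on (chart_dom c) f" and K: "closedin Top K" "K \<subseteq> chart_dom c"
    and 0: "\<And>\<theta>. \<theta> \<in> pt \<Longrightarrow> \<theta> \<notin> K \<Longrightarrow> f \<theta> = 0"
  shows "C1_on pt f"
proof -
  have "C1_on (mfd_points M - K) f"
    by (rule C1_on_cong[OF _ _ C1_on_const[of _ 0]]) (use K 0 in auto)
  from C1_on_Un[OF f this] show ?thesis
    by (rule C1_on_subset) (use K(2) in auto)
qed

lemma bump_C1:
  assumes c: "c \<in> Atl" and r: "r > 0" and cube: "coord_cube dm a r \<subseteq> chart_img c"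
  shows "C1_on pt (bump c a r)"
proof (rule C1_on_zero_extension[OF c _ chart_cube_closedin[OF c cube]])
  have "C1_coord dm (chart_img c) (coord_bump dm a r)"
    using openin_subset[OF chart_img_open[OF c]] by (rule C1_coord_subset[OF coord_bump_C1])
  then have "C1_coord dm (chart_img c) (\<lambda>x. bump c a r (chart_inv c x))"
    by (rule C1_coord_cong[OF chart_img_open[OF c], rotated]) (auto simp: bump_def chart_inv_map[OF c])
  then show "C1_on (chart_dom c) (bump c a r)"
    by (intro C1_onI_chart[OF c chart_dom_open[OF c]]) auto
qed (auto intro: bump_eq_0[OF c r])

end

section \<open>Riemannian volume in charts\<close>

text \<open>The segment from the identity to \<open>G\<close> consists of positive definite
  matrices. None of them has a null vector, so the determinant cannot change sign on the way from
  its value 1 at the identity.\<close>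

lemma pos_def_det_pos:
  fixes G :: "nat \<Rightarrow> nat \<Rightarrow> real"
  assumes pos: "\<And>u. \<exists>i<n. u i \<noteq> 0 \<Longrightarrow> (\<Sum>i<n. \<Sum>j<n. G i j * u i * u j) > 0"
  shows "Determinant.det (mat n n (\<lambda>(i, j). G i j)) > 0"
proof -
  define B where "B t i j = (1 - t) * (if i = j then 1 else 0) + t * G i j" for t :: real and i j
  define D where "D t = Determinant.det (mat n n (\<lambda>(i, j). B t i j))" for t
  \<comment> \<open>Leibniz's formula exhibits the determinant as a polynomial in \<open>t\<close>,
    hence as a continuous function.\<close>
  have D: "D t = (\<Sum>q | q permutes {0..<n}. signof q * (\<Prod>i = 0..<n. B t i (q i)))" for t
  proof -
    have "mat n n (\<lambda>(i, j). B t i j) $$ (i, q i) = B t i (q i)" if "q permutes {0..<n}" "i \<in> {0..<n}" for q i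
      using that permutes_in_image[OF that(1), of i] by simp
    then show ?thesis unfolding D_def by (subst det_def'[of _ n]) auto
  qed
  have cont: "isCont D t" for t
    unfolding D[abs_def] B_def by (intro continuous_intros)
  have nz: "D t \<noteq> 0" if t: "0 \<le> t" "t \<le> 1" for t
  proof
    assume "D t = 0"
    then obtain v where v: "v \<in> carrier_vec n" "v \<noteq> 0\<^sub>v n" "mat n n (\<lambda>(i, j). B t i j) *\<^sub>v v = 0\<^sub>v n"
      unfolding D_def by (subst (asm) det_0_iff_vec_prod_zero) auto
    have ex: "\<exists>i<n. v $ i \<noteq> 0"
    proof (rule ccontr)
      assume "\<not> ?thesis"
      then have "v = 0\<^sub>v n" using v(1) by (intro eq_vecI) auto
      with v(2) show False by simp
    qed
    let ?G = "\<Sum>i<n. \<Sum>j<n. G i j * v $ i * v $ j" and ?N = "\<Sum>i<n. v $ i * v $ i"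
    have "(\<Sum>j<n. B t i j * v $ j) = 0" if "i < n" for i
    proof -
      have "(mat n n (\<lambda>(i, j). B t i j) *\<^sub>v v) $ i = 0" using v(3) that by simp
      then show ?thesis using that v(1) by (simp add: scalar_prod_def lessThan_atLeast0)
    qed
    then have "0 = (\<Sum>i<n. v $ i * (\<Sum>j<n. B t i j * v $ j))" by simp
    also have "\<dots> = (\<Sum>i<n. \<Sum>j<n. (1 - t) * ((if i = j then 1 else 0) * v $ i * v $ j) + t * (G i j * v $ i * v $ j))"
      by (simp add: B_def sum_distrib_left algebra_simps)
    also have "\<dots> = (1 - t) * (\<Sum>i<n. \<Sum>j<n. (if i = j then 1 else 0) * v $ i * v $ j) + t * ?G"
      by (simp only: sum.distrib sum_distrib_left)
    also have "(\<Sum>i<n. \<Sum>j<n. (if i = j then 1 else 0) * v $ i * v $ j) = ?N"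
      by (intro sum.cong refl) (simp add: sum.delta if_distrib[of "\<lambda>x. x * _"] cong: if_cong)
    finally have eq: "0 = (1 - t) * ?N + t * ?G" .
    have p1: "?N > 0"
    proof -
      from ex obtain i where "i < n" "v $ i \<noteq> 0" by blast
      then show ?thesis by (intro sum_pos2[of "{..<n}" i]) (auto simp: zero_less_mult_iff)
    qed
    have p2: "?G > 0" by (rule pos[OF ex])
    show False
    proof (cases "t = 0")
      case True then show False using eq p1 by simp
    next
      case False
      then have "t * ?G > 0" using t p2 by simp
      moreover have "(1 - t) * ?N \<ge> 0" using t p1 by simp
      ultimately show False using eq by simp
    qed
  qed
  have "mat n n (\<lambda>(i, j). B 0 i j) = 1\<^sub>m n" by (rule eq_matI) (auto simp: B_def)
  then have D0: "D 0 = 1" by (simp add: D_def)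
  have D1: "D 1 = Determinant.det (mat n n (\<lambda>(i, j). G i j))" by (simp add: D_def B_def)
  show ?thesis
  proof (rule ccontr)
    assume "\<not> ?thesis"
    then have "\<exists>t\<ge>0. t \<le> 1 \<and> D t = 0" using D0 D1 cont by (intro IVT2) auto
    with nz show False by blast
  qed
qed

text \<open>This gives the definite description in \<open>grad\<close> a meaning. Existence follows
  from the nonzero determinant; for uniqueness the form is evaluated at the difference of two
  solutions, and extensionality settles the indices from \<open>n\<close> on.\<close>

lemma pos_def_unique_solution:
  fixes G :: "nat \<Rightarrow> nat \<Rightarrow> real"
  assumes pos: "\<And>u. \<exists>i<n. u i \<noteq> 0 \<Longrightarrow> (\<Sum>i<n. \<Sum>j<n. G i j * u i * u j) > 0"
  shows "\<exists>!u. u \<in> extensional {..<n} \<and> (\<forall>i<n. (\<Sum>j<n. G i j * u j) = d i)"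
proof (rule ex_ex1I)
  define A where "A = mat n n (\<lambda>(i, j). G i j)"
  have A: "A \<in> carrier_mat n n" by (simp add: A_def)
  have "Determinant.det A \<noteq> 0" using pos_def_det_pos[OF pos] by (auto simp: A_def)
  from det_non_zero_imp_unit[OF A this] obtain B where B: "B \<in> carrier_mat n n" "A * B = 1\<^sub>m n"
    unfolding Units_def ring_mat_def by auto
  define u where "u = restrict (\<lambda>j. (B *\<^sub>v vec n d) $ j) {..<n}"
  have "(\<Sum>j<n. G i j * u j) = d i" if "i < n" for i
  proof -
    have "A *\<^sub>v (B *\<^sub>v vec n d) = vec n d"
      using A B by (simp flip: assoc_mult_mat_vec)
    then have "(A *\<^sub>v (B *\<^sub>v vec n d)) $ i = d i" using that by simp
    then show ?thesis using that B by (simp add: A_def u_def scalar_prod_def lessThan_atLeast0)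
  qed
  then show "\<exists>u. u \<in> extensional {..<n} \<and> (\<forall>i<n. (\<Sum>j<n. G i j * u j) = d i)"
    by (intro exI[of _ u]) (auto simp: u_def)
next
  fix u v assume u: "u \<in> extensional {..<n} \<and> (\<forall>i<n. (\<Sum>j<n. G i j * u j) = d i)"
    and v: "v \<in> extensional {..<n} \<and> (\<forall>i<n. (\<Sum>j<n. G i j * v j) = d i)"
  have "(\<Sum>i<n. \<Sum>j<n. G i j * (u i - v i) * (u j - v j)) = (\<Sum>i<n. (u i - v i) * ((\<Sum>j<n. G i j * u j) - (\<Sum>j<n. G i j * v j)))"
    by (simp add: sum_distrib_left sum_subtractf[symmetric] algebra_simps)
  also have "\<dots> = 0" using u v by simp
  finally have "u i = v i" if "i < n" for i using pos[of "\<lambda>i. u i - v i"] that by force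
  then show "u = v" using u v by (intro extensionalityI[of u "{..<n}" v]) auto
qed

lemma compactin_coord_subset_cube:
  assumes "compactin (coord_space p) K"
  obtains r where "K \<subseteq> coord_cube p (\<lambda>_. 0) r"
proof -
  have "\<exists>B. \<forall>x\<in>K. \<bar>x i\<bar> \<le> B" if "i < p" for i
  proof -
    have "continuous_map (coord_space p) euclideanreal (\<lambda>x. x i)"
      unfolding coord_space_def using that by (intro continuous_map_product_projection) auto
    from image_compactin[OF assms this] have "bounded ((\<lambda>x. x i) ` K)"
      by (simp add: compact_imp_bounded)
    then show ?thesis unfolding bounded_iff by auto
  qed
  then obtain B where B: "\<And>i x. i < p \<Longrightarrow> x \<in> K \<Longrightarrow> \<bar>x i\<bar> \<le> B i" by metis
  define r where "r = (\<Sum>i<p. \<bar>B i\<bar>)"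
  have "\<bar>x i\<bar> \<le> r" if "i < p" "x \<in> K" for i x
  proof -
    have "\<bar>B i\<bar> \<le> r" unfolding r_def using that by (intro member_le_sum) auto
    then show ?thesis using B[OF that] by linarith
  qed
  then have le: "- r \<le> x i \<and> x i \<le> r" if "i < p" "x \<in> K" for i x
    using that by (simp add: abs_le_iff minus_le_iff)
  have "K \<subseteq> coord_cube p (\<lambda>_. 0) r"
  proof (rule subsetI, rule PiE_I)
    fix x i assume x: "x \<in> K"
    show "x i \<in> {0 - r..0 + r}" if "i \<in> {..<p}" using le[of i x] that x by simp
    show "x i = undefined" if "i \<notin> {..<p}"
      using compactin_subset_topspace[OF assms] x that by (auto simp: topspace_coord extensional_def)
  qed
  then show ?thesis by (rule that)
qed

lemma Hausdorff_coord: "Hausdorff_space (coord_space p)"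
  unfolding coord_space_def by (simp add: Hausdorff_space_product_topology Hausdorff_space_euclidean)

section \<open>Volume density, gradients and integrals over a chart\<close>

locale riemannian_mfd = smooth_mfd M for M :: "'a manifold" +
  fixes g :: "'a metric" and \<mu> :: "'a measure"
  assumes metric: "riemannian_metric M g" and volume: "riemannian_volume M g \<mu>"
begin

abbreviation "\<rho> \<equiv> vol_density M g"

lemma sets_vol: "sets \<mu> = sets (sigma (mfd_points M) {S. openin Top S})"
  using volume by (simp add: riemannian_volume_def)

lemma openin_sets: "openin Top S \<Longrightarrow> S \<in> sets \<mu>"
  unfolding sets_vol by (auto intro!: in_measure_of dest: openin_subset)

lemma space_vol: "space \<mu> = mfd_points M"
  using sets_eq_imp_space_eq[OF sets_vol] by (simp add: space_measure_of_conv)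

lemma emeasure_vol:
  assumes "c \<in> Atl" "B \<in> sets \<mu>" "B \<subseteq> chart_dom c"
  shows "emeasure \<mu> B = (\<integral>\<^sup>+x. ennreal (\<rho> c (chart_inv c x)) * indicator (chart_map c ` B) x \<partial>coord_lebesgue dm)"
  using volume assms unfolding riemannian_volume_def by blast

lemma metric_pos:
  assumes "c \<in> Atl" "\<theta> \<in> chart_dom c" "\<exists>i<dm. u i \<noteq> 0"
  shows "(\<Sum>i<dm. \<Sum>j<dm. g c \<theta> i j * u i * u j) > 0"
  using metric assms unfolding riemannian_metric_def by blast

lemma metric_sym:
  assumes "c \<in> Atl" "\<theta> \<in> chart_dom c" "i < dm" "j < dm"
  shows "g c \<theta> i j = g c \<theta> j i"
  using metric assms unfolding riemannian_metric_def by blast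

lemma vol_density_pos: "c \<in> Atl \<Longrightarrow> \<theta> \<in> chart_dom c \<Longrightarrow> \<rho> c \<theta> > 0"
  unfolding vol_density_def by (simp add: pos_def_det_pos metric_pos)

text \<open>Leibniz's formula makes the determinant a polynomial in smooth coefficients, and
  positive definiteness keeps it away from 0, where the square root is not differentiable.\<close>

lemma vol_density_C1:
  assumes c: "c \<in> Atl"
  shows "C1_on (chart_dom c) (\<rho> c)"
proof (rule C1_onI_chart[OF c chart_dom_open[OF c] order_refl])
  note o = chart_img_open[OF c]
  let ?D = "\<lambda>x. Determinant.det (mat dm dm (\<lambda>(i, j). g c (chart_inv c x) i j))"
  have D: "?D = (\<lambda>x. \<Sum>q | q permutes {0..<dm}. signof q * (\<Prod>i = 0..<dm. g c (chart_inv c x) i (q i)))"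
  proof
    fix x
    have "mat dm dm (\<lambda>(i, j). g c (chart_inv c x) i j) $$ (i, q i) = g c (chart_inv c x) i (q i)"
      if "q permutes {0..<dm}" "i \<in> {0..<dm}" for q i
      using that permutes_in_image[OF that(1), of i] by simp
    then show "?D x = (\<Sum>q | q permutes {0..<dm}. signof q * (\<Prod>i = 0..<dm. g c (chart_inv c x) i (q i)))"
      by (subst det_def'[of _ dm]) auto
  qed
  have "C1_coord dm (chart_img c) (\<lambda>x. g c (chart_inv c x) i (q i))" if "q permutes {0..<dm}" "i \<in> {0..<dm}" for q i
    using metric c that permutes_in_image[OF that(1), of i] unfolding riemannian_metric_def
    by (intro smooth_coord_C1[OF o]) auto
  then have D1: "C1_coord dm (chart_img c) ?D"
    unfolding D by (intro C1_coord_sum C1_coord_mult C1_coord_prod C1_coord_const o) auto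
  have pos: "?D x > 0" if "x \<in> chart_img c" for x
    using metric_pos[OF c chart_inv_dom[OF that]] by (intro pos_def_det_pos)
  show "C1_coord dm (chart_img c) (\<lambda>x. \<rho> c (chart_inv c x))"
    unfolding vol_density_def
  proof (rule C1_coord_compose(1)[OF o D1, where \<phi> = sqrt and \<phi>' = "\<lambda>s. inverse (sqrt s) / 2"])
    fix x assume "x \<in> chart_img c"
    note p = pos[OF this]
    show "(sqrt has_real_derivative inverse (sqrt (?D x)) / 2) (at (?D x))" by (rule DERIV_real_sqrt[OF p])
    show "isCont (\<lambda>s. inverse (sqrt s) / 2) (?D x)" using p by (intro continuous_intros) auto
  qed
qed

lemma grad_solves:
  assumes "c \<in> Atl" "\<theta> \<in> chart_dom c" "i < dm"
  shows "(\<Sum>j<dm. g c \<theta> i j * grad M g f c \<theta> j) = chart_deriv c i f \<theta>"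
proof -
  have "\<exists>!u. u \<in> extensional {..<dm} \<and> (\<forall>i<dm. (\<Sum>j<dm. g c \<theta> i j * u j) = chart_deriv c i f \<theta>)"
    by (rule pos_def_unique_solution) (rule metric_pos[OF assms(1,2)])
  from theI'[OF this] show ?thesis using assms(3) unfolding grad_def by blast
qed

text \<open>Contracting the metric with a gradient returns the differential, so inner products with
  gradients become directional derivatives and the metric survives only in the volume density. The
  second form uses the symmetry of the metric.\<close>

lemma metric_inner_grad:
  assumes "\<theta> \<in> pt"
  shows "metric_inner M g V (grad M g f) \<theta> = dird V (chart_at M \<theta>) f \<theta>"
    and "metric_inner M g (grad M g f) V \<theta> = dird V (chart_at M \<theta>) f \<theta>"
proof -
  define c where "c = chart_at M \<theta>"
  note c = chart_at[OF assms, folded c_def]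
  have "metric_inner M g V (grad M g f) \<theta> = (\<Sum>i<dm. V c \<theta> i * (\<Sum>j<dm. g c \<theta> i j * grad M g f c \<theta> j))"
    by (simp add: metric_inner_def Let_def c_def sum_distrib_left mult_ac)
  then show 1: "metric_inner M g V (grad M g f) \<theta> = dird V (chart_at M \<theta>) f \<theta>"
    using grad_solves[OF c] by (simp add: dird_def c_def)
  have "metric_inner M g (grad M g f) V \<theta> = (\<Sum>i<dm. \<Sum>j<dm. g c \<theta> j i * grad M g f c \<theta> i * V c \<theta> j)"
    using metric_sym[OF c] by (simp add: metric_inner_def Let_def c_def)
  also have "\<dots> = (\<Sum>j<dm. \<Sum>i<dm. g c \<theta> j i * grad M g f c \<theta> i * V c \<theta> j)" by (rule sum.swap)
  also have "\<dots> = metric_inner M g V (grad M g f) \<theta>"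
    by (simp add: metric_inner_def Let_def c_def mult_ac)
  finally show "metric_inner M g (grad M g f) V \<theta> = dird V (chart_at M \<theta>) f \<theta>" using 1 by simp
qed

lemma measurable_if_tendsto:
  fixes f :: "'a \<Rightarrow> real"
  assumes "openin Top S" "\<And>\<theta>. \<theta> \<in> S \<Longrightarrow> (f \<longlongrightarrow> f \<theta>) (nhd \<theta>)"
  shows "(\<lambda>\<theta>. if \<theta> \<in> S then f \<theta> else 0) \<in> borel_measurable \<mu>"
  using assms by (intro borel_measurable_if_tendsto[OF space_vol openin_sets])

lemma measurable_tendsto:
  fixes f :: "'a \<Rightarrow> real"
  assumes "\<And>\<theta>. \<theta> \<in> pt \<Longrightarrow> (f \<longlongrightarrow> f \<theta>) (nhd \<theta>)"
  shows "f \<in> borel_measurable \<mu>"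
  using measurable_if_tendsto[OF openin_topspace assms]
  by (rule measurable_cong[THEN iffD1, rotated]) (auto simp: space_vol)

text \<open>Passes from the volume of sets to integrals: the volume restricted to the chart domain
  is the image, under the inverse chart, of Lebesgue measure weighted by the volume density.\<close>

lemma integral_chart:
  fixes F :: "'a \<Rightarrow> real"
  assumes c: "c \<in> Atl" and F: "F \<in> borel_measurable \<mu>" and F0: "\<And>\<theta>. \<theta> \<notin> chart_dom c \<Longrightarrow> F \<theta> = 0"
  defines "h \<equiv> \<lambda>x. if x \<in> chart_img c then F (chart_inv c x) * \<rho> c (chart_inv c x) else 0"
  shows "integrable \<mu> F \<longleftrightarrow> integrable (coord_lebesgue dm) h" "(\<integral>\<theta>. F \<theta> \<partial>\<mu>) = (\<integral>x. h x \<partial>coord_lebesgue dm)"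
proof -
  let ?I = "density \<mu> (\<lambda>\<theta>. ennreal (indicator (chart_dom c) \<theta>))"
  let ?L = "coord_lebesgue dm"
  have "(integrable \<mu> F \<longleftrightarrow> integrable ?L h) \<and> (\<integral>\<theta>. F \<theta> \<partial>\<mu>) = (\<integral>x. h x \<partial>?L)"
  proof (cases "chart_dom c = {}")
    case True
    then have "F = (\<lambda>_. 0)" "h = (\<lambda>_. 0)" using F0 by (auto simp: h_def)
    then show ?thesis by simp
  next
    case False
    then obtain \<theta>0 where \<theta>0: "\<theta>0 \<in> chart_dom c" by auto
    \<comment> \<open>A total version of the inverse chart, as the image of a measure needs one. The
      base point \<theta>0 carries no mass because \<open>w\<close> vanishes off the chart image; it
      exists only if the chart domain is nonempty, hence the case split.\<close>
    define s where "s x = (if x \<in> chart_img c then chart_inv c x else \<theta>0)" for x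
    define w where "w x = (if x \<in> chart_img c then \<rho> c (chart_inv c x) else 0)" for x
    have dom_sets: "chart_dom c \<in> sets \<mu>" by (rule openin_sets[OF chart_dom_open[OF c]])
    have img_sets: "chart_img c \<in> sets ?L" by (rule openin_coord_sets[OF chart_img_open[OF c]])
    have s: "s \<in> measurable ?L \<mu>"
    proof (rule measurable_sigma_sets[of _ "mfd_points M" "{S. openin Top S}"])
      show "sets \<mu> = sigma_sets (mfd_points M) {S. openin Top S}"
        unfolding sets_vol by (intro sets_measure_of) (auto dest: openin_subset)
      show "{S. openin Top S} \<subseteq> Pow (mfd_points M)" by (auto dest: openin_subset)
      show "s \<in> space ?L \<rightarrow> mfd_points M"
        using \<theta>0 chart_dom_points[OF c] by (auto simp: s_def chart_inv_map[OF c])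
      fix S assume "S \<in> {S. openin Top S}"
      then have S: "openin crd (chart_map c ` (S \<inter> chart_dom c))" using chart_image_open[OF c] by blast
      have "s -` S \<inter> space ?L = chart_map c ` (S \<inter> chart_dom c) \<union> (if \<theta>0 \<in> S then space ?L - chart_img c else {})"
      proof (rule Set.set_eqI)
        fix x
        have "x \<in> chart_img c \<Longrightarrow> x \<in> space ?L"
          using openin_subset[OF chart_img_open[OF c]] by (auto simp: space_coord_lebesgue)
        moreover have "x \<in> chart_map c ` (S \<inter> chart_dom c) \<longleftrightarrow> x \<in> chart_img c \<and> s x \<in> S"
          using chart_map_inv[of x c] chart_inv_dom[of x c] by (auto simp: s_def chart_inv_map[OF c] image_iff)
        ultimately show "x \<in> s -` S \<inter> space ?L \<longleftrightarrow>
            x \<in> chart_map c ` (S \<inter> chart_dom c) \<union> (if \<theta>0 \<in> S then space ?L - chart_img c else {})"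
          by (cases "x \<in> chart_img c") (auto simp: s_def)
      qed
      then show "s -` S \<inter> space ?L \<in> sets ?L" using openin_coord_sets[OF S] img_sets by auto
    qed
    have w: "w \<in> borel_measurable ?L"
      unfolding w_def[abs_def]
      using C1_coord_ccont[OF C1_onD[OF vol_density_C1[OF c] c]] by (intro ccont_borel_measurable[OF chart_img_open[OF c]]) auto
    have w0: "w x \<ge> 0" for x
      using vol_density_pos[OF c chart_inv_dom] by (auto simp: w_def intro: less_imp_le)
    have eq: "?I = distr (density ?L (\<lambda>x. ennreal (w x))) \<mu> s"
    proof (rule measure_eqI)
      fix B assume "B \<in> sets ?I"
      then have B: "B \<in> sets \<mu>" by simp
      have "emeasure ?I B =
          (\<integral>\<^sup>+\<theta>. ennreal (indicator (chart_dom c) \<theta>) * indicator B \<theta> \<partial>\<mu>)"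
        using dom_sets B by (intro emeasure_density) auto
      also have "\<dots> = (\<integral>\<^sup>+\<theta>. indicator (B \<inter> chart_dom c) \<theta> \<partial>\<mu>)"
        by (intro nn_integral_cong) (auto simp: indicator_def)
      also have "\<dots> = emeasure \<mu> (B \<inter> chart_dom c)"
        using dom_sets B by (intro nn_integral_indicator) auto
      also have "\<dots> = (\<integral>\<^sup>+x. ennreal (\<rho> c (chart_inv c x)) * indicator (chart_map c ` (B \<inter> chart_dom c)) x \<partial>?L)"
        using dom_sets B by (intro emeasure_vol[OF c]) auto
      also have "\<dots> = (\<integral>\<^sup>+x. ennreal (w x) * indicator (s -` B \<inter> space ?L) x \<partial>?L)"
      proof (rule nn_integral_cong)
        fix x assume x: "x \<in> space ?L"
        have "x \<in> chart_map c ` (B \<inter> chart_dom c) \<longleftrightarrow> s x \<in> B" if "x \<in> chart_img c"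
          using that by (auto simp: s_def chart_inv_map[OF c])
        then show "ennreal (\<rho> c (chart_inv c x)) * indicator (chart_map c ` (B \<inter> chart_dom c)) x = ennreal (w x) * indicator (s -` B \<inter> space ?L) x"
          using x by (cases "x \<in> chart_img c") (auto simp: w_def indicator_def)
      qed
      also have "\<dots> = emeasure (density ?L (\<lambda>x. ennreal (w x))) (s -` B \<inter> space ?L)"
        using w measurable_sets[OF s B] by (intro emeasure_density[symmetric]) auto
      also have "\<dots> = emeasure (distr (density ?L (\<lambda>x. ennreal (w x))) \<mu> s) B"
        using s B by (subst emeasure_distr) auto
      finally show "emeasure ?I B = emeasure (distr (density ?L (\<lambda>x. ennreal (w x))) \<mu> s) B" .
    qed simp
    have Fi: "(\<lambda>\<theta>. indicator (chart_dom c) \<theta> *\<^sub>R F \<theta>) = F" using F0 by (auto simp: indicator_def fun_eq_iff)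
    have hw: "(\<lambda>x. w x *\<^sub>R F (s x)) = h" by (auto simp: w_def s_def h_def)
    have Fs: "(\<lambda>x. F (s x)) \<in> borel_measurable ?L" using s F by (rule measurable_compose)
    have s': "s \<in> measurable (density ?L (\<lambda>x. ennreal (w x))) \<mu>" using s by simp
    have "integrable \<mu> F \<longleftrightarrow> integrable ?I F"
      using integrable_density[OF F, of "indicator (chart_dom c)"] dom_sets unfolding Fi by simp
    also have "\<dots> \<longleftrightarrow> integrable ?L h"
      unfolding eq using F Fs w w0 by (simp add: integrable_distr_eq[OF s'] integrable_density hw[symmetric])
    finally have 1: "integrable \<mu> F \<longleftrightarrow> integrable ?L h" .
    have "(\<integral>\<theta>. F \<theta> \<partial>\<mu>) = (\<integral>\<theta>. F \<theta> \<partial>?I)"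
      using integral_density[OF F, of "indicator (chart_dom c)"] dom_sets unfolding Fi by simp
    also have "\<dots> = (\<integral>x. h x \<partial>?L)"
      unfolding eq using F Fs w w0 by (simp add: integral_distr[OF s'] integral_density hw[symmetric])
    finally show ?thesis using 1 by blast
  qed
  then show "integrable \<mu> F \<longleftrightarrow> integrable ?L h" "(\<integral>\<theta>. F \<theta> \<partial>\<mu>) = (\<integral>x. h x \<partial>?L)" by auto
qed

text \<open>In coordinates the set contains an open cube, which has positive Lebesgue measure, and
  the volume density is positive there. With this, an inequality between continuous functions on an
  open set is refuted by equality almost everywhere.\<close>

lemma emeasure_open_pos:
  assumes c: "c \<in> Atl" and S: "openin Top S" "S \<subseteq> chart_dom c" "S \<noteq> {}"
  shows "emeasure \<mu> S > 0"
proof -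
  obtain \<theta> where \<theta>: "\<theta> \<in> S" "\<theta> \<in> chart_dom c" using S by auto
  obtain r where r: "r > 0" "coord_cube dm (chart_map c \<theta>) r \<subseteq> chart_map c ` (S \<inter> chart_dom c)"
    using chart_cube_exists[OF c S(1) \<theta>] .
  let ?C = "Pi\<^sub>E {..<dm} (\<lambda>i. {chart_map c \<theta> i - r<..<chart_map c \<theta> i + r})"
  let ?w = "\<lambda>x. ennreal (if x \<in> chart_img c then \<rho> c (chart_inv c x) else 0) * indicator (chart_map c ` S) x"
  have CS: "?C \<subseteq> chart_map c ` S"
  proof -
    have "?C \<subseteq> coord_cube dm (chart_map c \<theta>) r" by (intro PiE_mono) auto
    also note r(2)
    also have "chart_map c ` (S \<inter> chart_dom c) \<subseteq> chart_map c ` S" by (rule image_mono) simp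
    finally show ?thesis .
  qed
  have CL: "?C \<in> sets (coord_lebesgue dm)" by (intro openin_coord_sets openin_coord_rect) auto
  have w: "?w \<in> borel_measurable (coord_lebesgue dm)"
    using ccont_borel_measurable[OF chart_img_open[OF c], of "\<lambda>x. \<rho> c (chart_inv c x)"]
      C1_coord_ccont[OF C1_onD[OF vol_density_C1[OF c] c]] openin_coord_sets[OF chart_image_open[OF c S(1)]] S(2)
    by (simp add: Int_absorb2)
  have "emeasure \<mu> S = (\<integral>\<^sup>+x. ?w x \<partial>coord_lebesgue dm)"
    unfolding emeasure_vol[OF c openin_sets[OF S(1)] S(2)]
    using S(2) by (intro nn_integral_cong) (auto simp: indicator_def)
  moreover have "(\<integral>\<^sup>+x. ?w x \<partial>coord_lebesgue dm) \<noteq> 0"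
  proof
    assume "(\<integral>\<^sup>+x. ?w x \<partial>coord_lebesgue dm) = 0"
    then have "AE x in coord_lebesgue dm. ?w x = 0" using nn_integral_0_iff_AE[OF w] by simp
    then have "AE x in coord_lebesgue dm. x \<notin> ?C"
    proof eventually_elim
      case (elim x)
      show ?case
      proof
        assume x: "x \<in> ?C"
        have "x \<in> chart_map c ` S" by (rule subsetD[OF CS x])
        moreover from this have "x \<in> chart_img c" by (rule subsetD[OF image_mono[OF S(2)]])
        ultimately show False using elim vol_density_pos[OF c chart_inv_dom[of x c]] by simp
      qed
    qed
    then have "emeasure (coord_lebesgue dm) ?C = 0"
      using CL by (subst (asm) AE_iff_measurable[of ?C]) (auto dest: sets.sets_into_space)
    then show False using emeasure_coord_cube_pos[OF r(1), of dm "chart_map c \<theta>"] by simp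
  qed
  ultimately show ?thesis by (simp add: zero_less_iff_neq_zero)
qed

end

section \<open>The divergence theorem\<close>

context smooth_mfd begin

lemma chart_compact_image:
  assumes c: "c \<in> Atl" and K: "compactin Top K" "K \<subseteq> chart_dom c"
  shows "compactin crd (chart_map c ` K)"
proof -
  have "compactin (subtopology Top (chart_dom c)) K" using K by (simp add: compactin_subtopology)
  then have "compactin (subtopology crd (chart_img c)) (chart_map c ` K)"
    using homeomorphic_map_compactness[OF chart_homeo(1)[OF c], of K] K(2) unfolding chart_homeo(2)[OF c] by simp
  then show ?thesis by (simp add: compactin_subtopology)
qed

lemma dird_tendsto:
  assumes V: "Ck_vfield M 1 V" and f: "C1_on S f" "openin Top S" "\<theta> \<in> S" and c: "c \<in> Atl" "\<theta> \<in> chart_dom c"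
  shows "(dird V c f \<longlongrightarrow> dird V c f \<theta>) (nhd \<theta>)"
proof -
  have "((\<lambda>\<theta>. V c \<theta> i) \<longlongrightarrow> V c \<theta> i) (nhd \<theta>)" if "i < dm" for i
  proof -
    have "Ck_coord dm 1 (chart_img c) (\<lambda>x. V c (chart_inv c x) i)"
      using V c(1) that unfolding Ck_vfield_def by blast
    then have "C1_coord dm (chart_img c) (\<lambda>x. V c (chart_inv c x) i)"
      using Ck_coord_1_iff[OF chart_img_open[OF c(1)]] by blast
    then have "ccont dm (\<lambda>x. V c (chart_inv c x) i) (chart_map c \<theta>)"
      using c by (intro C1_coord_ccont) auto
    then show ?thesis using ccont_chart_iff[OF c, of "\<lambda>\<theta>. V c \<theta> i"] by blast
  qed
  then show ?thesis unfolding dird_def[abs_def]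
    using f c by (intro tendsto_sum tendsto_mult chart_deriv_tendsto) auto
qed

lemma dird_cong:
  assumes "c \<in> Atl" "\<theta> \<in> chart_dom c" "eventually (\<lambda>\<eta>. f \<eta> = h \<eta>) (nhd \<theta>)"
  shows "dird V c f \<theta> = dird V c h \<theta>"
  unfolding dird_def using chart_deriv_cong[OF assms(1,2) _ assms(3)] by simp

lemma dird_eq_0:
  assumes "c \<in> Atl" "\<theta> \<in> chart_dom c" "closedin Top K" "\<theta> \<notin> K" "\<And>\<eta>. \<eta> \<in> pt \<Longrightarrow> \<eta> \<notin> K \<Longrightarrow> f \<eta> = 0"
  shows "dird V c f \<theta> = 0"
proof -
  have o: "openin Top (mfd_points M - K)" using assms(3) by blast
  have "eventually (\<lambda>\<eta>. f \<eta> = 0) (nhd \<theta>)"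
    by (rule eventually_mono[OF eventually_nhdsin_openin[OF o, of \<theta>]])
      (use assms chart_dom_points[OF assms(1,2)] in auto)
  from dird_cong[OF assms(1,2) this] have "dird V c f \<theta> = dird V c (\<lambda>_. 0) \<theta>" .
  also have "\<dots> = 0" unfolding dird_def by (intro sum.neutral ballI) (simp add: chart_derivI)
  finally show ?thesis .
qed

lemma dird_mult:
  assumes "C1_on S f" "C1_on S h" "\<theta> \<in> S" "c \<in> Atl" "\<theta> \<in> chart_dom c"
  shows "dird V c (\<lambda>\<theta>. f \<theta> * h \<theta>) \<theta> = dird V c f \<theta> * h \<theta> + f \<theta> * dird V c h \<theta>"
  unfolding dird_def using chart_deriv_mult[OF assms]
  by (simp add: sum_distrib_left sum_distrib_right sum.distrib[symmetric] algebra_simps)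

lemma dird_add:
  assumes "C1_on S f" "C1_on S h" "\<theta> \<in> S" "c \<in> Atl" "\<theta> \<in> chart_dom c"
  shows "dird V c (\<lambda>\<theta>. f \<theta> + h \<theta>) \<theta> = dird V c f \<theta> + dird V c h \<theta>"
  unfolding dird_def using chart_deriv_add[OF assms] by (simp add: algebra_simps sum.distrib)

lemma dird_compose:
  assumes "C1_on S f" "openin Top S" "\<theta> \<in> S" "c \<in> Atl" "\<theta> \<in> chart_dom c"
    and "\<And>\<theta>. \<theta> \<in> S \<Longrightarrow> (\<phi> has_real_derivative \<phi>' (f \<theta>)) (at (f \<theta>))" "\<And>\<theta>. \<theta> \<in> S \<Longrightarrow> isCont \<phi>' (f \<theta>)"
  shows "dird V c (\<lambda>\<theta>. \<phi> (f \<theta>)) \<theta> = \<phi>' (f \<theta>) * dird V c f \<theta>"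
proof -
  have "chart_deriv c i (\<lambda>\<theta>. \<phi> (f \<theta>)) \<theta> = \<phi>' (f \<theta>) * chart_deriv c i f \<theta>" if "i < dm" for i
    by (rule C1_on_compose(2)[OF assms(2,1,6,7) assms(4) that assms(3,5)])
  then show ?thesis unfolding dird_def by (simp add: sum_distrib_left mult_ac)
qed

lemma dird_sum:
  assumes "\<And>k. k \<in> I \<Longrightarrow> C1_on S (f k)" "\<theta> \<in> S" "c \<in> Atl" "\<theta> \<in> chart_dom c"
  shows "dird V c (\<lambda>\<theta>. \<Sum>k\<in>I. f k \<theta>) \<theta> = (\<Sum>k\<in>I. dird V c (f k) \<theta>)"
proof -
  have "chart_deriv c i (\<lambda>\<theta>. \<Sum>k\<in>I. f k \<theta>) \<theta> = (\<Sum>k\<in>I. chart_deriv c i (f k) \<theta>)" if "i < dm" for i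
    by (rule chart_deriv_sum[OF _ assms(2-4) that]) (rule assms(1))
  then have "dird V c (\<lambda>\<theta>. \<Sum>k\<in>I. f k \<theta>) \<theta> = (\<Sum>i<dm. \<Sum>k\<in>I. V c \<theta> i * chart_deriv c i (f k) \<theta>)"
    unfolding dird_def by (simp add: sum_distrib_left)
  also have "\<dots> = (\<Sum>k\<in>I. dird V c (f k) \<theta>)" unfolding dird_def by (rule sum.swap)
  finally show ?thesis .
qed

end

section \<open>Divergence in a fixed chart and independence of the chart\<close>

context riemannian_mfd begin

text \<open>The divergence formula with the chart held fixed. Its continuity is evident, unlike that
  of \<open>divergence\<close>, whose chart may change from point to point.\<close>

definition divc :: "'a vfield \<Rightarrow> 'a chart \<Rightarrow> 'a \<Rightarrow> real" where
  "divc V c \<theta> = (\<Sum>i<dm. chart_deriv c i (\<lambda>\<eta>. \<rho> c \<eta> * V c \<eta> i) \<theta>) / \<rho> c \<theta>"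

lemma vol_vfield_C1:
  assumes V: "Ck_vfield M 1 V" and c: "c \<in> Atl" and i: "i < dm"
  shows "C1_on (chart_dom c) (\<lambda>\<eta>. \<rho> c \<eta> * V c \<eta> i)"
proof (rule C1_on_mult[OF chart_dom_open[OF c] vol_density_C1[OF c]])
  have "Ck_coord dm 1 (chart_img c) (\<lambda>x. V c (chart_inv c x) i)"
    using V c i unfolding Ck_vfield_def by blast
  then show "C1_on (chart_dom c) (\<lambda>\<eta>. V c \<eta> i)"
    using Ck_coord_1_iff[OF chart_img_open[OF c]] by (intro C1_onI_chart[OF c chart_dom_open[OF c]]) auto
qed

lemma divc_tendsto:
  assumes V: "Ck_vfield M 1 V" and c: "c \<in> Atl" "\<theta> \<in> chart_dom c"
  shows "(divc V c \<longlongrightarrow> divc V c \<theta>) (nhd \<theta>)"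
proof -
  have "(\<rho> c \<longlongrightarrow> \<rho> c \<theta>) (nhd \<theta>)"
    by (rule C1_on_tendsto[OF vol_density_C1[OF c(1)] c(2) chart_dom_points[OF c]])
  then show ?thesis unfolding divc_def[abs_def] using vol_density_pos[OF c]
    by (intro tendsto_divide tendsto_sum chart_deriv_tendsto[OF vol_vfield_C1[OF V c(1)] c(2) c _ chart_dom_open[OF c(1)]]) auto
qed

text \<open>Multiplied by the volume density, the integrand is the coordinate divergence of the
  field with components v \<rho> V_i, so each summand is a partial derivative of a compactly
  supported function and integrates to zero.\<close>

lemma divergence_theorem_chart:
  assumes V: "Ck_vfield M 1 V" and c: "c \<in> Atl" and v: "C1_on pt v"
    and K: "compactin Top K" "K \<subseteq> chart_dom c" and v0: "\<And>\<theta>. \<theta> \<in> pt \<Longrightarrow> \<theta> \<notin> K \<Longrightarrow> v \<theta> = 0"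
  defines "T \<equiv> \<lambda>\<theta>. if \<theta> \<in> chart_dom c then dird V c v \<theta> + v \<theta> * divc V c \<theta> else 0"
  shows "integrable \<mu> T" "(\<integral>\<theta>. T \<theta> \<partial>\<mu>) = 0"
proof -
  let ?L = "coord_lebesgue dm"
  define W where "W i x = (if x \<in> chart_img c then v (chart_inv c x) * (\<rho> c (chart_inv c x) * V c (chart_inv c x) i) else 0)" for i x
  note o = chart_dom_open[OF c] chart_img_open[OF c]
  have vd: "C1_on (chart_dom c) v" using v openin_subset[OF o(1)] by (rule C1_on_subset)
  have Kc: "compactin crd (chart_map c ` K)" by (rule chart_compact_image[OF c K])
  then have Kcl: "closedin crd (chart_map c ` K)" by (rule compactin_imp_closedin[OF Hausdorff_coord])
  then have oK: "openin crd (pts dm - chart_map c ` K)" by blast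
  obtain r where r: "chart_map c ` K \<subseteq> coord_cube dm (\<lambda>_. 0) r"
    by (rule compactin_coord_subset_cube[OF Kc])
  have W0: "W i x = 0" if "x \<notin> chart_map c ` K" for i x
  proof (cases "x \<in> chart_img c")
    case True
    have "chart_inv c x \<notin> K" using that chart_map_inv[OF True] by force
    then have "v (chart_inv c x) = 0" using chart_dom_points[OF c chart_inv_dom[OF True]] by (rule v0[rotated])
    then show ?thesis by (simp add: W_def)
  qed (simp add: W_def)
  have prod: "C1_on (chart_dom c) (\<lambda>\<eta>. v \<eta> * (\<rho> c \<eta> * V c \<eta> i))" if "i < dm" for i
    by (rule C1_on_mult[OF o(1) vd vol_vfield_C1[OF V c that]])
  \<comment> \<open>Gluing over two open sets: the chart image, and the complement of the image of
    \<open>K\<close>, which is compact and therefore closed. They cover coordinate space because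
    \<open>K\<close> lies in the chart domain.\<close>
  have W1: "C1_coord dm (pts dm) (W i)" if i: "i < dm" for i
  proof -
    have "C1_coord dm (chart_img c) (W i)"
      by (rule C1_coord_cong[OF o(2) _ C1_onD[OF prod[OF i] c, unfolded Int_absorb]]) (simp add: W_def)
    moreover have "C1_coord dm (pts dm - chart_map c ` K) (W i)"
      by (rule C1_coord_cong[OF oK _ C1_coord_const[of _ _ 0]]) (simp add: W0)
    ultimately have "C1_coord dm (chart_img c \<union> (pts dm - chart_map c ` K)) (W i)" by (rule C1_coord_Un)
    then show ?thesis by (rule C1_coord_subset) (use K(2) in blast)
  qed
  have Wint: "integrable ?L (partial_deriv i (W i))" "(\<integral>x. partial_deriv i (W i) x \<partial>?L) = 0" if "i < dm" for i
    using integral_partial_deriv_compact_support[OF W1[OF that] that, of "\<lambda>_. 0" r] W0 r by blast+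
  have key: "(if x \<in> chart_img c then T (chart_inv c x) * \<rho> c (chart_inv c x) else 0) = (\<Sum>i<dm. partial_deriv i (W i) x)"
    if x: "x \<in> pts dm" for x
  proof (cases "x \<in> chart_img c")
    case True
    define \<theta> where "\<theta> = chart_inv c x"
    have \<theta>: "\<theta> \<in> chart_dom c" "chart_map c \<theta> = x"
      using True by (simp_all add: \<theta>_def chart_inv_dom chart_map_inv)
    have "partial_deriv i (W i) x = chart_deriv c i v \<theta> * (\<rho> c \<theta> * V c \<theta> i) + v \<theta> * chart_deriv c i (\<lambda>\<eta>. \<rho> c \<eta> * V c \<eta> i) \<theta>"
      if i: "i < dm" for i
    proof -
      have "eventually (\<lambda>y. W i y = v (chart_inv c y) * (\<rho> c (chart_inv c y) * V c (chart_inv c y) i)) (nhdc dm x)"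
        by (rule eventually_mono[OF eventually_nhdsin_openin[OF o(2) True]]) (simp add: W_def)
      from partial_deriv_cong[OF x i this]
      have "partial_deriv i (W i) x = chart_deriv c i (\<lambda>\<eta>. v \<eta> * (\<rho> c \<eta> * V c \<eta> i)) \<theta>"
        by (simp add: chart_deriv_def \<theta>)
      also note chart_deriv_mult[OF vd vol_vfield_C1[OF V c i] \<theta>(1) c \<theta>(1) i]
      finally show ?thesis .
    qed
    then have "(\<Sum>i<dm. partial_deriv i (W i) x) = dird V c v \<theta> * \<rho> c \<theta> + v \<theta> * (\<Sum>i<dm. chart_deriv c i (\<lambda>\<eta>. \<rho> c \<eta> * V c \<eta> i) \<theta>)"
      by (simp add: dird_def sum.distrib sum_distrib_left sum_distrib_right mult_ac)
    also have "\<dots> = T \<theta> * \<rho> c \<theta>"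
      using \<theta> vol_density_pos[OF c \<theta>(1)] by (simp add: T_def divc_def field_simps)
    finally show ?thesis using True by (simp add: \<theta>_def)
  next
    case False
    have "partial_deriv i (W i) x = 0" if i: "i < dm" for i
    proof -
      have "x \<in> pts dm - chart_map c ` K" using False x K(2) by blast
      from eventually_nhdsin_openin[OF oK this]
      have "eventually (\<lambda>y. W i y = 0) (nhdc dm x)" by (rule eventually_mono) (simp add: W0)
      from partial_deriv_cong[OF x i this] show ?thesis by (simp add: partial_deriv_def)
    qed
    then show ?thesis using False by simp
  qed
  have Tm: "T \<in> borel_measurable \<mu>"
    unfolding T_def
  proof (rule measurable_if_tendsto[OF o(1)])
    fix \<theta> assume \<theta>: "\<theta> \<in> chart_dom c"
    show "((\<lambda>\<theta>. dird V c v \<theta> + v \<theta> * divc V c \<theta>) \<longlongrightarrow> dird V c v \<theta> + v \<theta> * divc V c \<theta>) (nhd \<theta>)"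
      by (intro tendsto_add tendsto_mult dird_tendsto[OF V vd o(1) \<theta> c \<theta>] divc_tendsto[OF V c \<theta>]
          C1_on_tendsto[OF vd \<theta> chart_dom_points[OF c \<theta>]])
  qed
  let ?h = "\<lambda>x. if x \<in> chart_img c then T (chart_inv c x) * \<rho> c (chart_inv c x) else 0"
  have ic: "integrable \<mu> T \<longleftrightarrow> integrable ?L ?h" "(\<integral>\<theta>. T \<theta> \<partial>\<mu>) = (\<integral>x. ?h x \<partial>?L)"
    by (rule integral_chart[OF c Tm]; simp add: T_def)+
  have "integrable ?L (\<lambda>x. \<Sum>i<dm. partial_deriv i (W i) x)" using Wint by auto
  then show "integrable \<mu> T"
    unfolding ic(1) by (rule Bochner_Integration.integrable_cong[THEN iffD1, rotated 2]) (simp_all only: key space_coord_lebesgue)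
  have "(\<integral>\<theta>. T \<theta> \<partial>\<mu>) = (\<integral>x. (\<Sum>i<dm. partial_deriv i (W i) x) \<partial>?L)"
    unfolding ic(2) by (rule Bochner_Integration.integral_cong) (simp_all only: key space_coord_lebesgue)
  also have "\<dots> = 0" using Wint by simp
  finally show "(\<integral>\<theta>. T \<theta> \<partial>\<mu>) = 0" .
qed

text \<open>Testing the divergence theorem of both charts against a bump function supported where the two
  local divergences differ replaces Jacobi's formula for the derivative of a determinant.\<close>

lemma divc_chart_indep_le:
  assumes V: "Ck_vfield M 1 V" and c: "c \<in> Atl" "c' \<in> Atl" "\<theta> \<in> chart_dom c" "\<theta> \<in> chart_dom c'"
  shows "divc V c \<theta> \<le> divc V c' \<theta>"
proof (rule ccontr)
  assume neg: "\<not> ?thesis"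
  let ?O = "chart_dom c \<inter> chart_dom c'"
  define S where "S = {\<eta> \<in> ?O. divc V c \<eta> - divc V c' \<eta> \<in> {0<..}}"
  have O: "openin Top ?O" using c chart_dom_open by blast
  have S: "openin Top S" unfolding S_def
    by (rule openin_tendsto_preimage[OF O]) (auto intro!: tendsto_diff divc_tendsto[OF V] c)
  have \<theta>S: "\<theta> \<in> S" using neg c by (simp add: S_def)
  obtain r where r: "r > 0" "coord_cube dm (chart_map c \<theta>) r \<subseteq> chart_map c ` (S \<inter> chart_dom c)"
    by (rule chart_cube_exists[OF c(1) S \<theta>S c(3)])
  define b where "b = bump c (chart_map c \<theta>) r"
  define K where "K = {\<eta> \<in> chart_dom c. chart_map c \<eta> \<in> coord_cube dm (chart_map c \<theta>) r}"
  have rc: "coord_cube dm (chart_map c \<theta>) r \<subseteq> chart_img c"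
    using r(2) by (rule order_trans) (rule image_mono, simp)
  have b1: "C1_on pt b" unfolding b_def by (rule bump_C1[OF c(1) r(1) rc])
  have K: "compactin Top K" unfolding K_def by (rule chart_cube_compactin[OF c(1) rc])
  have Kcl: "closedin Top K" by (rule compactin_imp_closedin[OF Hausdorff_top K])
  have KS: "K \<subseteq> S"
  proof
    fix \<eta> assume \<eta>: "\<eta> \<in> K"
    then have "chart_map c \<eta> \<in> chart_map c ` (S \<inter> chart_dom c)" using r(2) unfolding K_def by blast
    then show "\<eta> \<in> S" using \<eta> chart_inv_map[OF c(1)] unfolding K_def by (metis (no_types, lifting) IntE imageE mem_Collect_eq)
  qed
  have b0: "b \<eta> = 0" if "\<eta> \<notin> K" for \<eta>
    unfolding b_def by (rule bump_eq_0[OF c(1) r(1)]) (use that in \<open>simp add: K_def\<close>)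
  define T where "T c \<eta> = (if \<eta> \<in> chart_dom c then dird V c b \<eta> + b \<eta> * divc V c \<eta> else 0)" for c \<eta>
  have Tc: "integrable \<mu> (T c)" "(\<integral>\<eta>. T c \<eta> \<partial>\<mu>) = 0"
    unfolding T_def by (rule divergence_theorem_chart[OF V c(1) b1 K]; use KS b0 in \<open>auto simp: S_def\<close>)+
  have Tc': "integrable \<mu> (T c')" "(\<integral>\<eta>. T c' \<eta> \<partial>\<mu>) = 0"
    unfolding T_def by (rule divergence_theorem_chart[OF V c(2) b1 K]; use KS b0 in \<open>auto simp: S_def\<close>)+
  \<comment> \<open>The directional derivatives cancel, since they are already known not to depend
    on the chart; the bump times the gap between the divergences remains, and that is nonnegative
    with integral 0.\<close>
  have D: "T c \<eta> - T c' \<eta> = (if \<eta> \<in> K then b \<eta> * (divc V c \<eta> - divc V c' \<eta>) else 0)" for \<eta>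
  proof (cases "\<eta> \<in> K")
    case True
    then have \<eta>: "\<eta> \<in> chart_dom c" "\<eta> \<in> chart_dom c'" using KS by (auto simp: S_def)
    have "dird V c b \<eta> = dird V c' b \<eta>"
      using chart_dom_points[OF c(1) \<eta>(1)] by (rule dird_chart_indep[OF V b1 openin_topspace _ c(1,2) \<eta>])
    then show ?thesis using True \<eta> by (simp add: T_def algebra_simps)
  next
    case False
    have "dird V c b \<eta> = 0" if "\<eta> \<in> chart_dom c" by (rule dird_eq_0[OF c(1) that Kcl False]) (rule b0)
    moreover have "dird V c' b \<eta> = 0" if "\<eta> \<in> chart_dom c'" by (rule dird_eq_0[OF c(2) that Kcl False]) (rule b0)
    ultimately show ?thesis using False b0 by (simp add: T_def)
  qed
  have nn: "T c \<eta> - T c' \<eta> \<ge> 0" for \<eta>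
    unfolding D using KS bump_nonneg[of c "chart_map c \<theta>" r \<eta>] by (auto simp: b_def S_def)
  have "(\<integral>\<eta>. T c \<eta> - T c' \<eta> \<partial>\<mu>) = 0" using Tc Tc' by simp
  then have AE: "AE \<eta> in \<mu>. T c \<eta> - T c' \<eta> = 0"
    using integral_nonneg_eq_0_iff_AE[of \<mu> "\<lambda>\<eta>. T c \<eta> - T c' \<eta>"] Tc Tc' nn by simp
  \<comment> \<open>On this nonempty open set the difference is strictly positive, although it
    vanishes almost everywhere.\<close>
  define P where "P = {\<eta> \<in> pt. b \<eta> \<in> {0<..}}"
  have Po: "openin Top P" unfolding P_def
    by (rule openin_tendsto_preimage[OF openin_topspace C1_on_tendsto[OF b1]]) auto
  have PK: "P \<subseteq> K" using b0 by (force simp: P_def)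
  have "\<theta> \<in> P" using bump_pos[OF c(1,3) r(1)] chart_dom_points[OF c(1,3)] by (simp add: P_def b_def)
  then have "emeasure \<mu> P > 0" using PK by (intro emeasure_open_pos[OF c(1) Po]) (auto simp: K_def)
  moreover have "AE \<eta> in \<mu>. \<eta> \<notin> P"
    using AE
  proof eventually_elim
    case (elim \<eta>)
    show ?case
    proof
      assume "\<eta> \<in> P"
      moreover from this have "\<eta> \<in> K" "\<eta> \<in> S" using PK KS by auto
      ultimately show False using elim unfolding D by (simp add: P_def S_def)
    qed
  qed
  then have "emeasure \<mu> P = 0"
    using openin_sets[OF Po] by (subst (asm) AE_iff_measurable[of P]) (auto dest: sets.sets_into_space)
  ultimately show False by simp
qed

lemma divergence_chart:
  assumes V: "Ck_vfield M 1 V" and c: "c \<in> Atl" "\<theta> \<in> chart_dom c"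
  shows "divergence M g V \<theta> = divc V c \<theta>"
proof -
  note c' = chart_at[OF chart_dom_points[OF c]]
  have "divergence M g V \<theta> = divc V (chart_at M \<theta>) \<theta>"
    by (simp add: divergence_def divc_def Let_def)
  \<comment> \<open>Exchanging the two charts turns the inequality into an equality.\<close>
  also have "\<dots> = divc V c \<theta>"
    using divc_chart_indep_le[OF V c'(1) c(1) c'(2) c(2)] divc_chart_indep_le[OF V c(1) c'(1) c(2) c'(2)] by simp
  finally show ?thesis .
qed

text \<open>The function that \<open>metric_inner\<close> of \<open>V\<close> with a gradient
  evaluates to, with the same choice of chart at each point.\<close>

definition ddir :: "'a vfield \<Rightarrow> ('a \<Rightarrow> real) \<Rightarrow> 'a \<Rightarrow> real" where
  "ddir V f \<theta> = dird V (chart_at M \<theta>) f \<theta>"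

lemma ddir_chart:
  assumes V: "Ck_vfield M 1 V" and f: "C1_on pt f" and c: "c \<in> Atl" "\<theta> \<in> chart_dom c"
  shows "ddir V f \<theta> = dird V c f \<theta>"
  unfolding ddir_def using chart_at[OF chart_dom_points[OF c]] c chart_dom_points[OF c]
  by (intro dird_chart_indep[OF V f openin_topspace]) auto

text \<open>The chart used by \<open>ddir\<close> may change at every point, but near \<theta> chart
  independence allows the single chart chosen at \<theta>.\<close>

lemma ddir_tendsto:
  assumes V: "Ck_vfield M 1 V" and f: "C1_on pt f" and \<theta>: "\<theta> \<in> pt"
  shows "(ddir V f \<longlongrightarrow> ddir V f \<theta>) (nhd \<theta>)"
proof -
  note c = chart_at[OF \<theta>]
  have "eventually (\<lambda>\<eta>. dird V (chart_at M \<theta>) f \<eta> = ddir V f \<eta>) (nhd \<theta>)"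
    by (rule eventually_mono[OF eventually_nhdsin_openin[OF chart_dom_open[OF c(1)] c(2)]])
      (simp add: ddir_chart[OF V f c(1)])
  from tendsto_cong[OF this] show ?thesis
    using dird_tendsto[OF V f openin_topspace \<theta> c] ddir_chart[OF V f c] by simp
qed

lemma divergence_theorem_local:
  assumes V: "Ck_vfield M 1 V" and c: "c \<in> Atl" and v: "C1_on pt v"
    and K: "compactin Top K" "K \<subseteq> chart_dom c" and v0: "\<And>\<theta>. \<theta> \<in> pt \<Longrightarrow> \<theta> \<notin> K \<Longrightarrow> v \<theta> = 0"
  shows "integrable \<mu> (\<lambda>\<theta>. ddir V v \<theta> + v \<theta> * divergence M g V \<theta>)"
    "(\<integral>\<theta>. ddir V v \<theta> + v \<theta> * divergence M g V \<theta> \<partial>\<mu>) = 0"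
proof -
  let ?T = "\<lambda>\<theta>. if \<theta> \<in> chart_dom c then dird V c v \<theta> + v \<theta> * divc V c \<theta> else 0"
  let ?D = "\<lambda>\<theta>. ddir V v \<theta> + v \<theta> * divergence M g V \<theta>"
  have *: "integrable \<mu> ?T" "(\<integral>\<theta>. ?T \<theta> \<partial>\<mu>) = 0"
    by (rule divergence_theorem_chart[OF V c v K]; simp add: v0)+
  have eq: "ddir V v \<theta> + v \<theta> * divergence M g V \<theta> = (if \<theta> \<in> chart_dom c then dird V c v \<theta> + v \<theta> * divc V c \<theta> else 0)"
    if \<theta>: "\<theta> \<in> space \<mu>" for \<theta>
  proof (cases "\<theta> \<in> chart_dom c")
    case True
    then show ?thesis using ddir_chart[OF V v c] divergence_chart[OF V c] by simp
  next
    case False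
    then have "\<theta> \<notin> K" using K(2) by blast
    have \<theta>p: "\<theta> \<in> pt" using \<theta> space_vol by simp
    have "ddir V v \<theta> = 0" unfolding ddir_def
      by (rule dird_eq_0[OF chart_at[OF \<theta>p] compactin_imp_closedin[OF Hausdorff_top K(1)] \<open>\<theta> \<notin> K\<close>]) (rule v0)
    then show ?thesis using False v0[OF \<theta>p \<open>\<theta> \<notin> K\<close>] by simp
  qed
  show "integrable \<mu> (\<lambda>\<theta>. ddir V v \<theta> + v \<theta> * divergence M g V \<theta>)"
    using *(1) Bochner_Integration.integrable_cong[of \<mu> \<mu> ?D ?T, OF refl] eq by simp
  show "(\<integral>\<theta>. ddir V v \<theta> + v \<theta> * divergence M g V \<theta> \<partial>\<mu>) = 0"
    using *(2) Bochner_Integration.integral_cong[of \<mu> \<mu> ?D ?T, OF refl] eq by simp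
qed

text \<open>By compactness finitely many bumps, each living in one chart, have a sum that is
  positive on \<open>K\<close>. Dividing by this sum splits \<open>v\<close> into pieces to which
  the one-chart version applies, and the pieces add up by linearity.\<close>

theorem divergence_theorem:
  assumes V: "Ck_vfield M 1 V" and v: "C1_on pt v"
    and K: "compactin Top K" and v0: "\<And>\<theta>. \<theta> \<in> pt \<Longrightarrow> \<theta> \<notin> K \<Longrightarrow> v \<theta> = 0"
  shows "integrable \<mu> (\<lambda>\<theta>. ddir V v \<theta> + v \<theta> * divergence M g V \<theta>)"
    "(\<integral>\<theta>. ddir V v \<theta> + v \<theta> * divergence M g V \<theta> \<partial>\<mu>) = 0"
proof -
  have Kp: "K \<subseteq> mfd_points M" by (rule compactin_subset_topspace[OF K])
  have Kcl: "closedin Top K" by (rule compactin_imp_closedin[OF Hausdorff_top K])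
  have "\<exists>r>0. coord_cube dm (chart_map (chart_at M \<theta>) \<theta>) r \<subseteq> chart_img (chart_at M \<theta>)" if \<theta>: "\<theta> \<in> pt" for \<theta>
  proof -
    note c = chart_at[OF \<theta>]
    obtain r where "r > 0" "coord_cube dm (chart_map (chart_at M \<theta>) \<theta>) r \<subseteq> chart_map (chart_at M \<theta>) ` (mfd_points M \<inter> chart_dom (chart_at M \<theta>))"
      by (rule chart_cube_exists[OF c(1) openin_topspace \<theta> c(2)])
    then show ?thesis by (meson image_mono inf_le2 order_trans)
  qed
  then have "\<forall>\<theta>\<in>mfd_points M. \<exists>r. r > 0 \<and> coord_cube dm (chart_map (chart_at M \<theta>) \<theta>) r \<subseteq> chart_img (chart_at M \<theta>)"
    by blast
  from bchoice[OF this] obtain r where r: "\<And>\<theta>. \<theta> \<in> pt \<Longrightarrow> r \<theta> > 0"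
    "\<And>\<theta>. \<theta> \<in> pt \<Longrightarrow> coord_cube dm (chart_map (chart_at M \<theta>) \<theta>) (r \<theta>) \<subseteq> chart_img (chart_at M \<theta>)"
    by blast
  define b where "b \<theta> = bump (chart_at M \<theta>) (chart_map (chart_at M \<theta>) \<theta>) (r \<theta>)" for \<theta>
  have b1: "C1_on pt (b \<theta>)" if "\<theta> \<in> pt" for \<theta>
    unfolding b_def by (rule bump_C1[OF chart_at(1)[OF that] r[OF that]])
  define U where "U \<theta> = {\<eta> \<in> pt. b \<theta> \<eta> \<in> {0<..}}" for \<theta>
  have Uo: "openin Top (U \<theta>)" if "\<theta> \<in> pt" for \<theta>
    unfolding U_def by (rule openin_tendsto_preimage[OF openin_topspace C1_on_tendsto[OF b1[OF that]]]) auto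
  have U\<theta>: "\<theta> \<in> U \<theta>" if "\<theta> \<in> pt" for \<theta>
    using bump_pos[OF chart_at[OF that] r(1)[OF that]] that by (simp add: U_def b_def)
  have "\<exists>\<F>. finite \<F> \<and> \<F> \<subseteq> U ` K \<and> K \<subseteq> \<Union>\<F>"
    using K Uo U\<theta> Kp by (intro compactinD[OF K]) auto
  then obtain I where I: "finite I" "I \<subseteq> K" "K \<subseteq> (\<Union>\<theta>\<in>I. U \<theta>)"
    by (metis finite_subset_image)
  have Ip: "\<theta> \<in> pt" if "\<theta> \<in> I" for \<theta> using that I(2) Kp by blast
  define s where "s \<eta> = (\<Sum>\<theta>\<in>I. b \<theta> \<eta>)" for \<eta>
  have s1: "C1_on pt s"
    unfolding s_def[abs_def] by (intro C1_on_sum openin_topspace b1 Ip)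
  have bn: "b \<theta> \<eta> \<ge> 0" for \<theta> \<eta> by (simp add: b_def bump_nonneg)
  have spos: "s \<eta> > 0" if \<eta>: "\<eta> \<in> K" for \<eta>
  proof -
    obtain \<theta> where "\<theta> \<in> I" "\<eta> \<in> U \<theta>" using I(3) \<eta> by blast
    then show ?thesis unfolding s_def using I(1) bn by (intro sum_pos2[of I \<theta>]) (auto simp: U_def)
  qed
  define w where "w \<theta> \<eta> = v \<eta> * b \<theta> \<eta> / s \<eta>" for \<theta> \<eta>
  \<comment> \<open>The quotient is C1 where \<open>s\<close> is positive, and zero off
    \<open>K\<close> because \<open>v\<close> is, whatever \<open>s\<close> does there. These two
    open sets cover the manifold since \<open>s\<close> is positive on \<open>K\<close>.\<close>
  have w1: "C1_on pt (w \<theta>)" if \<theta>: "\<theta> \<in> I" for \<theta>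
  proof -
    let ?O = "{\<eta> \<in> pt. s \<eta> \<in> {0<..}}"
    have O: "openin Top ?O"
      by (rule openin_tendsto_preimage[OF openin_topspace C1_on_tendsto[OF s1]]) auto
    have sub: "?O \<subseteq> mfd_points M" by blast
    have "C1_on ?O (w \<theta>)"
      unfolding w_def[abs_def]
      by (intro C1_on_divide C1_on_mult O C1_on_subset[OF v sub] C1_on_subset[OF b1[OF Ip[OF \<theta>]] sub] C1_on_subset[OF s1 sub]) auto
    moreover have "C1_on (mfd_points M - K) (w \<theta>)"
      by (rule C1_on_cong[OF _ _ C1_on_const[of _ 0]]) (use Kcl in \<open>auto simp: w_def v0\<close>)
    ultimately have "C1_on (?O \<union> (mfd_points M - K)) (w \<theta>)" by (rule C1_on_Un)
    then show ?thesis by (rule C1_on_subset) (use spos in auto)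
  qed
  have sum_w: "v \<eta> = (\<Sum>\<theta>\<in>I. w \<theta> \<eta>)" if "\<eta> \<in> pt" for \<eta>
  proof (cases "\<eta> \<in> K")
    case True
    have "(\<Sum>\<theta>\<in>I. w \<theta> \<eta>) = v \<eta> * s \<eta> / s \<eta>"
      unfolding w_def s_def by (simp add: sum_distrib_left sum_divide_distrib)
    then show ?thesis using spos[OF True] by simp
  qed (simp add: w_def v0 that)
  have loc: "integrable \<mu> (\<lambda>\<eta>. ddir V (w \<theta>) \<eta> + w \<theta> \<eta> * divergence M g V \<eta>) \<and>
      (\<integral>\<eta>. ddir V (w \<theta>) \<eta> + w \<theta> \<eta> * divergence M g V \<eta> \<partial>\<mu>) = 0" if \<theta>: "\<theta> \<in> I" for \<theta>
  proof -
    note c = chart_at(1)[OF Ip[OF \<theta>]]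
    let ?K = "{\<eta> \<in> chart_dom (chart_at M \<theta>). chart_map (chart_at M \<theta>) \<eta> \<in> coord_cube dm (chart_map (chart_at M \<theta>) \<theta>) (r \<theta>)}"
    have K': "compactin Top ?K" by (rule chart_cube_compactin[OF c r(2)[OF Ip[OF \<theta>]]])
    have "w \<theta> \<eta> = 0" if "\<eta> \<notin> ?K" for \<eta>
    proof -
      have "b \<theta> \<eta> = 0" unfolding b_def by (rule bump_eq_0[OF c r(1)[OF Ip[OF \<theta>]]]) (use that in simp)
      then show ?thesis by (simp add: w_def)
    qed
    then show ?thesis
      using divergence_theorem_local[OF V c w1[OF \<theta>] K'] by auto
  qed
  let ?D = "\<lambda>\<theta>. ddir V v \<theta> + v \<theta> * divergence M g V \<theta>"
  let ?T = "\<lambda>\<eta>. \<Sum>\<theta>\<in>I. ddir V (w \<theta>) \<eta> + w \<theta> \<eta> * divergence M g V \<eta>"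
  have eq: "ddir V v \<eta> + v \<eta> * divergence M g V \<eta> = (\<Sum>\<theta>\<in>I. ddir V (w \<theta>) \<eta> + w \<theta> \<eta> * divergence M g V \<eta>)"
    if \<eta>: "\<eta> \<in> space \<mu>" for \<eta>
  proof -
    have \<eta>p: "\<eta> \<in> pt" using \<eta> space_vol by simp
    note c = chart_at[OF \<eta>p]
    have "eventually (\<lambda>\<xi>. v \<xi> = (\<Sum>\<theta>\<in>I. w \<theta> \<xi>)) (nhd \<eta>)"
      by (rule eventually_mono[OF eventually_nhdsin_openin[OF openin_topspace \<eta>p]]) (rule sum_w)
    from dird_cong[OF c this] have "ddir V v \<eta> = dird V (chart_at M \<eta>) (\<lambda>\<xi>. \<Sum>\<theta>\<in>I. w \<theta> \<xi>) \<eta>"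
      by (simp only: ddir_def)
    also have "\<dots> = (\<Sum>\<theta>\<in>I. ddir V (w \<theta>) \<eta>)"
      unfolding ddir_def by (rule dird_sum[OF _ \<eta>p c]) (rule w1)
    finally have "ddir V v \<eta> = (\<Sum>\<theta>\<in>I. ddir V (w \<theta>) \<eta>)" .
    then show ?thesis using sum_w[OF \<eta>p] by (simp add: sum.distrib sum_distrib_right)
  qed
  have "integrable \<mu> (\<lambda>\<eta>. \<Sum>\<theta>\<in>I. ddir V (w \<theta>) \<eta> + w \<theta> \<eta> * divergence M g V \<eta>)"
    using loc by (intro Bochner_Integration.integrable_sum) auto
  then show "integrable \<mu> (\<lambda>\<theta>. ddir V v \<theta> + v \<theta> * divergence M g V \<theta>)"
    using Bochner_Integration.integrable_cong[of \<mu> \<mu> ?D ?T, OF refl] eq by simp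
  have "(\<integral>\<theta>. ddir V v \<theta> + v \<theta> * divergence M g V \<theta> \<partial>\<mu>) = (\<integral>\<eta>. (\<Sum>\<theta>\<in>I. ddir V (w \<theta>) \<eta> + w \<theta> \<eta> * divergence M g V \<eta>) \<partial>\<mu>)"
    using Bochner_Integration.integral_cong[of \<mu> \<mu> ?D ?T, OF refl] eq by simp
  also have "\<dots> = (\<Sum>\<theta>\<in>I. \<integral>\<eta>. ddir V (w \<theta>) \<eta> + w \<theta> \<eta> * divergence M g V \<eta> \<partial>\<mu>)"
    using loc by (intro Bochner_Integration.integral_sum) auto
  also have "\<dots> = 0" using loc by (intro sum.neutral) auto
  finally show "(\<integral>\<theta>. ddir V v \<theta> + v \<theta> * divergence M g V \<theta> \<partial>\<mu>) = 0" .
qed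

end

section \<open>Stein's equation\<close>

lemma normal_density_deriv:
  assumes "\<sigma> > 0"
  shows "(normal_density 0 \<sigma> has_real_derivative - x / \<sigma>\<^sup>2 * normal_density 0 \<sigma> x) (at x)"
  using assms unfolding normal_density_def[abs_def]
  by (auto intro!: derivative_eq_intros simp: field_simps power2_eq_square)

text \<open>The comparison function \<open>2 \<sigma>\<^sup>2 \<phi> x / x\<close> decreases faster than \<open>G\<close> can, and both vanish at infinity
  (Mills' ratio).\<close>

lemma gaussian_tail_bound:
  fixes G k :: "real \<Rightarrow> real"
  assumes \<sigma>: "\<sigma> > 0"
    and G: "\<And>x. (G has_real_derivative k x) (at x)" "(G \<longlongrightarrow> 0) at_top"
    and k: "\<And>x. \<bar>k x\<bar> \<le> 2 * normal_density 0 \<sigma> x"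
  shows "u > 0 \<Longrightarrow> u * \<bar>G u\<bar> \<le> 2 * \<sigma>\<^sup>2 * normal_density 0 \<sigma> u"
    and "u \<ge> 0 \<Longrightarrow> \<bar>G u\<bar> \<le> 4 * \<sigma> * normal_density 0 \<sigma> u"
proof -
  let ?\<phi> = "normal_density 0 \<sigma>"
  have \<phi>: "?\<phi> x > 0" for x using \<sigma> by (rule normal_density_pos)
  \<comment> \<open>The sign \<open>s\<close> stands for 1 or -1, so the two instances together
    bound |G u|.\<close>
  have side: "s * G u \<le> 2 * \<sigma>\<^sup>2 * ?\<phi> u / u" if u: "u > 0" and s: "\<bar>s\<bar> = 1" for s u :: real
  proof -
    define D where "D x = 2 * \<sigma>\<^sup>2 * ?\<phi> x / x - s * G x" for x
    have "D x \<le> D u" if "u \<le> x" for x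
    proof (rule DERIV_nonpos_imp_nonincreasing[OF that])
      fix y assume y: "u \<le> y" "y \<le> x"
      let ?E = "(2 * \<sigma>\<^sup>2 * (- y / \<sigma>\<^sup>2 * ?\<phi> y) * y - 2 * \<sigma>\<^sup>2 * ?\<phi> y) / (y * y) - s * k y"
      have d: "(D has_real_derivative ?E) (at y)"
        unfolding D_def[abs_def] using y u
        by (auto intro!: derivative_eq_intros normal_density_deriv \<sigma> G(1))
      \<comment> \<open>The comparison function was scaled so that its derivative contains exactly
        -2 times the density, which offsets \<open>k\<close>; the remaining term has the favourable
        sign.\<close>
      have "(2 * \<sigma>\<^sup>2 * (- y / \<sigma>\<^sup>2 * ?\<phi> y) * y - 2 * \<sigma>\<^sup>2 * ?\<phi> y) / (y * y) = - 2 * ?\<phi> y - 2 * \<sigma>\<^sup>2 * ?\<phi> y / (y * y)"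
        using y u \<sigma> by (simp add: field_simps)
      moreover have "2 * \<sigma>\<^sup>2 * ?\<phi> y / (y * y) \<ge> 0" using \<phi>[of y] by simp
      moreover have "\<bar>s * k y\<bar> \<le> 2 * ?\<phi> y" using k[of y] s by (simp add: abs_mult)
      moreover have "A - S \<le> 0" if "A = - 2 * C - B" "0 \<le> B" "\<bar>S\<bar> \<le> 2 * C" for A B C S :: real
        using that by linarith
      ultimately have "?E \<le> 0" by blast
      with d show "\<exists>d. (D has_real_derivative d) (at y) \<and> d \<le> 0" by blast
    qed
    moreover have "((\<lambda>x. 2 * \<sigma>\<^sup>2 * ?\<phi> x / x) \<longlongrightarrow> 0) at_top"
      unfolding normal_density_def using \<sigma> by real_asymp
    then have "(D \<longlongrightarrow> 0 - s * 0) at_top"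
      unfolding D_def[abs_def] by (intro tendsto_intros G(2))
    ultimately have "0 \<le> D u"
      using tendsto_upperbound[of D "0 - s * 0" at_top "D u"] by (simp add: eventually_at_top_linorder) (meson order_refl)
    then show ?thesis by (simp add: D_def)
  qed
  show 1: "u * \<bar>G u\<bar> \<le> 2 * \<sigma>\<^sup>2 * ?\<phi> u" if "u > 0" for u
    using side[OF that, of 1] side[OF that, of "-1"] that by (simp add: field_simps abs_if)
  show "\<bar>G u\<bar> \<le> 4 * \<sigma> * ?\<phi> u" if u: "u \<ge> 0"
  proof (cases "u \<ge> \<sigma>")
    case True
    have "\<sigma> * \<bar>G u\<bar> \<le> u * \<bar>G u\<bar>" using True by (intro mult_right_mono) auto
    also have "\<dots> \<le> \<sigma> * (2 * \<sigma> * ?\<phi> u)" using 1[of u] True \<sigma> by (simp add: power2_eq_square)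
    finally have "\<bar>G u\<bar> \<le> 2 * \<sigma> * ?\<phi> u" using \<sigma> by simp
    moreover have "2 * \<sigma> * ?\<phi> u \<ge> 0" using \<sigma> \<phi>[of u] by simp
    ultimately show ?thesis by linarith
  next
    case False
    have mono: "?\<phi> x \<le> ?\<phi> u" if "u \<le> x" for x
    proof (rule DERIV_nonpos_imp_nonincreasing[OF that])
      fix y assume "u \<le> y"
      then show "\<exists>d. (?\<phi> has_real_derivative d) (at y) \<and> d \<le> 0"
        using normal_density_deriv[OF \<sigma>, of y] u \<phi>[of y] by (intro exI conjI) (assumption, auto simp: divide_nonpos_pos mult_nonpos_nonneg)
    qed
    \<comment> \<open>Mills' bound degenerates as \<open>u\<close> approaches 0. Going from
      \<open>u\<close> to \<sigma> costs at most 2 \<sigma> times the density at \<open>u\<close>,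
      and the bound at \<sigma> costs as much again, which makes the 4.\<close>
    have "norm (G \<sigma> - G u) \<le> 2 * ?\<phi> u * norm (\<sigma> - u)"
      by (rule field_differentiable_bound[where S = "{u..\<sigma>}" and f' = k])
        (use False k mono in \<open>auto intro: has_field_derivative_at_within G(1) order.trans[OF k]\<close>)
    also have "\<dots> \<le> 2 * ?\<phi> u * \<sigma>" using u False \<phi>[of u] by (intro mult_left_mono) auto
    finally have a: "\<bar>G \<sigma> - G u\<bar> \<le> 2 * \<sigma> * ?\<phi> u" by (simp add: mult_ac)
    have "\<sigma> * \<bar>G \<sigma>\<bar> \<le> \<sigma> * (2 * \<sigma> * ?\<phi> \<sigma>)" using 1[OF \<sigma>] by (simp add: power2_eq_square mult_ac)
    then have "\<bar>G \<sigma>\<bar> \<le> 2 * \<sigma> * ?\<phi> \<sigma>" using \<sigma> by simp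
    also have "\<dots> \<le> 2 * \<sigma> * ?\<phi> u" using mono[of \<sigma>] False \<sigma> by simp
    finally show ?thesis using a by linarith
  qed
qed

text \<open>The Gaussian density \<phi> is an integrating factor: the equation says that \<sigma>^2
  f \<phi> has derivative (h - m) \<phi>. So \<open>f\<close> is the integral of the latter over the
  left half-line, divided by \<sigma>^2 \<phi>, and the tail estimates bound it on both sides of
  0.\<close>

lemma stein_solution:
  fixes h :: "real \<Rightarrow> real"
  assumes \<sigma>: "\<sigma> > 0" and h: "\<And>x. isCont h x" "\<And>x. \<bar>h x\<bar> \<le> 1"
  defines "m \<equiv> (\<integral>x. h x \<partial>density lborel (\<lambda>x. ennreal (normal_density 0 \<sigma> x)))"
  obtains f f' where "\<And>z. (f has_real_derivative f' z) (at z)" "\<And>z. isCont f' z"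
    "\<And>z. \<sigma>\<^sup>2 * f' z - z * f z = h z - m" "\<And>z. \<bar>f z\<bar> \<le> 4 / \<sigma>" "\<And>z. \<bar>f' z\<bar> \<le> 4 / \<sigma>\<^sup>2" "\<bar>m\<bar> \<le> 1"
proof -
  let ?\<phi> = "normal_density 0 \<sigma>"
  let ?N = "density lborel (\<lambda>x. ennreal (?\<phi> x))"
  define k where "k x = (h x - m) * ?\<phi> x" for x
  have \<phi>: "?\<phi> x > 0" for x using \<sigma> by (rule normal_density_pos)
  interpret N: prob_space "?N" using \<sigma> by (rule prob_space_normal_density)
  have [measurable]: "h \<in> borel_measurable borel"
    using h(1) by (intro borel_measurable_continuous_onI) (simp add: continuous_on_eq_continuous_at)
  have inth: "integrable (?N) h"
    by (rule N.integrable_const_bound[of _ 1]) (use h(2) in auto)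
  have "\<bar>m\<bar> \<le> (\<integral>x. \<bar>h x\<bar> \<partial>?N)" unfolding m_def by (rule integral_abs_bound)
  also have "\<dots> \<le> (\<integral>x. 1 \<partial>?N)"
    using inth h(2) by (intro integral_mono) auto
  finally have m: "\<bar>m\<bar> \<le> 1" using N.prob_space by simp
  have H: "\<bar>h x - m\<bar> \<le> 2" for x using h(2)[of x] m by linarith
  have kb: "\<bar>k x\<bar> \<le> 2 * ?\<phi> x" for x
    using H[of x] \<phi>[of x] by (simp add: k_def abs_mult)
  have "isCont ?\<phi> x" for x by (rule DERIV_isCont[OF normal_density_deriv[OF \<sigma>]])
  then have kc: "isCont k x" for x unfolding k_def[abs_def] by (intro continuous_intros h(1))
  have "(\<integral>x. h x - m \<partial>?N) = 0" "integrable (?N) (\<lambda>x. h x - m)"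
    using inth N.prob_space by (auto simp: m_def)
  then have int0: "(\<integral>x. k x \<partial>lborel) = 0" and intk: "integrable lborel k"
    by (simp_all add: integral_density integrable_density k_def[abs_def] mult.commute)
  define G where "G u = (\<integral>x. indicator {..u} x *\<^sub>R k x \<partial>lborel)" for u
  \<comment> \<open>Here the centring by \<open>m\<close> matters: the integral over the whole line
    is 0, so \<open>G\<close> vanishes at both ends.\<close>
  have G_top: "(G \<longlongrightarrow> 0) at_top"
    using tendsto_integral_at_top[OF _ intk] int0 unfolding G_def[abs_def] by simp
  \<comment> \<open>\<open>G\<close> differs by a constant from any antiderivative of
    \<open>k\<close>, which yields its differentiability without differentiating under the improper
    integral.\<close>
  have Gd: "G v - G u = K v - K u" if "u \<le> v" and K: "\<And>x. (K has_real_derivative k x) (at x)" for u v K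
  proof -
    have i: "integrable lborel (\<lambda>x. indicator {..u} x *\<^sub>R k x)" for u
      using intk by (intro integrable_mult_indicator) auto
    have "G v - G u = (\<integral>x. indicator {..v} x *\<^sub>R k x - indicator {..u} x *\<^sub>R k x \<partial>lborel)"
      unfolding G_def by (rule Bochner_Integration.integral_diff[symmetric, OF i i])
    also have "\<dots> = (\<integral>x. k x * indicator {u..v} x \<partial>lborel)"
    proof (rule integral_cong_AE)
      show "AE x in lborel. indicator {..v} x *\<^sub>R k x - indicator {..u} x *\<^sub>R k x = k x * indicator {u..v} x"
        using AE_lborel_singleton[of u] by eventually_elim (use that in \<open>auto simp: indicator_def\<close>)
    qed (use intk in auto)
    also have "\<dots> = K v - K u" by (rule integral_FTC_Icc_real[OF that(1) K kc])
    finally show ?thesis .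
  qed
  obtain K where K: "\<And>x. (K has_real_derivative k x) (at x)"
    using einterval_antiderivative[of "-\<infinity>" "\<infinity>" k] kc by (auto simp: has_real_derivative_iff_has_vector_derivative)
  have GK: "G u = K u + (G 0 - K 0)" for u
    using Gd[OF _ K, of 0 u] Gd[OF _ K, of u 0] by (cases "u \<ge> 0") auto
  have G': "(G has_real_derivative k x) (at x)" for x
  proof -
    have "((\<lambda>u. K u + (G 0 - K 0)) has_real_derivative k x) (at x)"
      by (auto intro!: derivative_eq_intros K)
    moreover have "(\<lambda>u. K u + (G 0 - K 0)) = G" by (rule ext, rule GK[symmetric])
    ultimately show ?thesis by simp
  qed
  \<comment> \<open>Reflection brings the left tail into the form that the one-sided tail bound
    treats.\<close>
  have G_bot: "((\<lambda>x. G (- x)) \<longlongrightarrow> 0) at_top"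
  proof -
    have "((\<lambda>x. \<integral>y. indicator {..- x} y *\<^sub>R k y \<partial>lborel) \<longlongrightarrow> (\<integral>y. 0 \<partial>(lborel :: real measure))) at_top"
    proof (rule integral_dominated_convergence_at_top[where w = "\<lambda>y. \<bar>k y\<bar>"])
      show "AE y in lborel. ((\<lambda>x. indicator {..- x} y *\<^sub>R k y) \<longlongrightarrow> 0) at_top"
      proof (rule AE_I2)
        fix y
        have "eventually (\<lambda>x. indicator {..- x} y *\<^sub>R k y = 0) at_top"
          using eventually_gt_at_top[of "- y"] by eventually_elim (auto simp: indicator_def)
        then show "((\<lambda>x. indicator {..- x} y *\<^sub>R k y) \<longlongrightarrow> 0) at_top" by (rule tendsto_eventually)
      qed
      show "\<forall>\<^sub>F x in at_top. AE y in lborel. norm (indicator {..- x} y *\<^sub>R k y) \<le> \<bar>k y\<bar>"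
        by (auto simp: indicator_def)
    qed (use intk in auto)
    then show ?thesis unfolding G_def by simp
  qed
  have G'': "((\<lambda>x. G (- x)) has_real_derivative - k (- x)) (at x)" for x
    using DERIV_chain2[where f = G and g = uminus and x = x and Da = "k (- x)" and Db = "-1" and s = UNIV, OF G' DERIV_minus[OF DERIV_ident]]
    by simp
  have kb': "\<bar>- k (- x)\<bar> \<le> 2 * ?\<phi> x" for x
    using kb[of "-x"] by (simp add: normal_density_def)
  note t1 = gaussian_tail_bound[OF \<sigma> G' G_top kb] and t2 = gaussian_tail_bound[OF \<sigma> G'' G_bot kb']
  have sym: "?\<phi> (- x) = ?\<phi> x" for x by (simp add: normal_density_def)
  have b1: "\<bar>x\<bar> * \<bar>G x\<bar> \<le> 2 * \<sigma>\<^sup>2 * ?\<phi> x" for x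
    using t1(1)[of x] t2(1)[of "- x"] \<phi>[of x] by (cases x "0::real" rule: linorder_cases) (auto simp: sym)
  have b2: "\<bar>G x\<bar> \<le> 4 * \<sigma> * ?\<phi> x" for x
    using t1(2)[of x] t2(2)[of "- x"] by (cases "x \<ge> 0") (auto simp: sym)
  define f where "f z = G z / (\<sigma>\<^sup>2 * ?\<phi> z)" for z
  \<comment> \<open>Stein's equation solved for the derivative: the equation then holds by
    definition, and what has to be proved is that \<open>f'\<close> is the derivative of
    \<open>f\<close>.\<close>
  define f' where "f' z = (h z - m + z * f z) / \<sigma>\<^sup>2" for z
  have fz: "\<bar>z * f z\<bar> \<le> 2" for z
    using b1[of z] \<phi>[of z] \<sigma> by (simp add: f_def abs_mult divide_le_eq)
  show ?thesis
  proof (rule that[of f f'])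
    show fd: "(f has_real_derivative f' z) (at z)" for z
    proof -
      have "(f has_real_derivative (k z * (\<sigma>\<^sup>2 * ?\<phi> z) - G z * (\<sigma>\<^sup>2 * (- z / \<sigma>\<^sup>2 * ?\<phi> z))) / ((\<sigma>\<^sup>2 * ?\<phi> z) * (\<sigma>\<^sup>2 * ?\<phi> z))) (at z)"
        unfolding f_def[abs_def] using \<phi>[of z] \<sigma>
        by (intro DERIV_divide G' DERIV_cmult normal_density_deriv) auto
      moreover have "(k z * (\<sigma>\<^sup>2 * ?\<phi> z) - G z * (\<sigma>\<^sup>2 * (- z / \<sigma>\<^sup>2 * ?\<phi> z))) / ((\<sigma>\<^sup>2 * ?\<phi> z) * (\<sigma>\<^sup>2 * ?\<phi> z)) = f' z"
        using \<phi>[of z] \<sigma> by (simp add: f'_def f_def k_def field_simps power2_eq_square)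
      ultimately show ?thesis by simp
    qed
    \<comment> \<open>Inherited from \<open>h\<close>; it makes the composite of \<open>f\<close>
      with a C1 function C1 again, as the divergence theorem requires.\<close>
    show "isCont f' z" for z
      unfolding f'_def[abs_def] using \<sigma> by (intro continuous_intros h(1) DERIV_isCont[OF fd]) auto
    show "\<sigma>\<^sup>2 * f' z - z * f z = h z - m" for z using \<sigma> by (simp add: f'_def)
    show "\<bar>f z\<bar> \<le> 4 / \<sigma>" for z
      using b2[of z] \<phi>[of z] \<sigma> by (simp add: f_def abs_mult divide_le_eq power2_eq_square mult_ac)
    show "\<bar>f' z\<bar> \<le> 4 / \<sigma>\<^sup>2" for z
    proof -
      have "\<bar>h z - m + z * f z\<bar> \<le> 4" using H[of z] fz[of z] by linarith
      then show ?thesis using \<sigma> by (simp add: f'_def divide_right_mono)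
    qed
    show "\<bar>m\<bar> \<le> 1" by (rule m)
  qed
qed

section \<open>Stochastic order of the bound\<close>

lemma ennreal_divide_antimono:
  fixes a x y :: ennreal
  assumes "y \<le> x" shows "a / x \<le> a / y"
proof -
  have "inverse x \<le> inverse y"
    using assms including ennreal.lifting by transfer (rule ereal_inverse_antimono)
  then show ?thesis unfolding divide_ennreal_def by (rule mult_left_mono) simp
qed

text \<open>From e \<le> 1/2 the denominator 1 - a0 is at least 1/2, so the a1 term contributes
  2e/\<sigma>; with e/\<sigma> from the a2 term this explains the 3/\<sigma>.\<close>

lemma stein_bound_small:
  assumes "\<sigma> > 0" "n \<ge> 1" "0 < e" "e \<le> 1 / 2"
    and a: "a0 \<le> ennreal (e * 1)" "a1 \<le> ennreal (e * sqrt (real n))" "a2 \<le> ennreal (e * (1 / sqrt (real n)))" "a3 \<le> ennreal (e * 1)"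
  shows "stein_bound \<sigma> n a0 a1 a2 a3 \<le> ennreal (4 * e * (1 + 3 / \<sigma> + 1 / \<sigma>\<^sup>2))"
proof -
  let ?s = "sqrt (real n)"
  have n: "?s > 0" using assms(2) by simp
  have "a0 < 1" using a(1) assms(4) by (metis ennreal_1 ennreal_less_iff le_less_trans less_le_trans mult.right_neutral order.trans field_sum_of_halves less_add_same_cancel1 half_gt_zero zero_less_one assms(3) less_imp_le)
  have "ennreal (1 / 2) \<le> ennreal (1 - e)" using assms by (intro ennreal_leI) auto
  also have "\<dots> = 1 - ennreal e" using assms(3) by (simp add: ennreal_minus flip: ennreal_1)
  also have "\<dots> \<le> 1 - a0" using a(1) by (intro ennreal_minus_mono) auto
  finally have h: "ennreal (1 / 2) \<le> 1 - a0" .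
  have "a1 / (ennreal (?s) * (1 - a0)) \<le> a1 / (ennreal (?s) * ennreal (1 / 2))"
    using h by (intro ennreal_divide_antimono mult_left_mono) auto
  also have "\<dots> \<le> ennreal (e * ?s) / (ennreal (?s) * ennreal (1 / 2))"
    by (intro divide_right_mono_ennreal a)
  also have "\<dots> = ennreal (2 * e)"
  proof -
    have "ennreal (?s) * ennreal (1 / 2) = ennreal (?s * (1 / 2))"
      by (rule ennreal_mult[symmetric]) auto
    then show ?thesis using n assms(3) by (simp only: divide_ennreal) (subst divide_ennreal; simp)
  qed
  finally have 1: "a1 / (ennreal (?s) * (1 - a0)) \<le> ennreal (2 * e)" .
  have "ennreal (1 / \<sigma>) * ennreal (?s) * a2 \<le> ennreal (1 / \<sigma>) * ennreal (?s) * ennreal (e * (1 / ?s))"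
    by (intro mult_left_mono a) auto
  also have "\<dots> = ennreal (e / \<sigma>)" using n assms by (simp flip: ennreal_mult)
  finally have 2: "ennreal (1 / \<sigma>) * ennreal (?s) * a2 \<le> ennreal (e / \<sigma>)" .
  have "stein_bound \<sigma> n a0 a1 a2 a3 \<le> 4 * (ennreal e + ennreal (1 / \<sigma>) * ennreal (2 * e) + ennreal (e / \<sigma>) + ennreal (1 / \<sigma>\<^sup>2) * ennreal e)"
    using \<open>a0 < 1\<close> a(1,4) 1 2 unfolding stein_bound_def by (auto intro!: mult_left_mono add_mono)
  also have "\<dots> = ennreal 4 * ennreal (e + 1 / \<sigma> * (2 * e) + e / \<sigma> + 1 / \<sigma>\<^sup>2 * e)"
  proof -
    have p: "0 \<le> e" "0 \<le> 1 / \<sigma>" "0 \<le> 2 * e" "0 \<le> e / \<sigma>" "0 \<le> 1 / \<sigma>\<^sup>2" "0 \<le> 1 / \<sigma> * (2 * e)"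
      "0 \<le> 1 / \<sigma>\<^sup>2 * e" "0 \<le> e + 1 / \<sigma> * (2 * e)" "0 \<le> e + 1 / \<sigma> * (2 * e) + e / \<sigma>"
      using assms by (auto intro!: add_nonneg_nonneg)
    show ?thesis
      unfolding ennreal_plus[OF p(9,7)] ennreal_plus[OF p(8,4)] ennreal_plus[OF p(1,6)] ennreal_mult[OF p(2,3)] ennreal_mult[OF p(5,1)]
      by simp
  qed
  also have "\<dots> = ennreal (4 * e * (1 + 3 / \<sigma> + 1 / \<sigma>\<^sup>2))"
  proof -
    have "ennreal 4 * ennreal (e + 1 / \<sigma> * (2 * e) + e / \<sigma> + 1 / \<sigma>\<^sup>2 * e) = ennreal (4 * (e + 1 / \<sigma> * (2 * e) + e / \<sigma> + 1 / \<sigma>\<^sup>2 * e))"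
      using assms by (intro ennreal_mult[symmetric] add_nonneg_nonneg) auto
    also have "4 * (e + 1 / \<sigma> * (2 * e) + e / \<sigma> + 1 / \<sigma>\<^sup>2 * e) = 4 * e * (1 + 3 / \<sigma> + 1 / \<sigma>\<^sup>2)"
      by (simp add: algebra_simps)
    finally show ?thesis .
  qed
  finally show ?thesis .
qed

text \<open>Outside the union of the four covering events every ingredient is at most
  \<open>e\<close> times its rate, and the deterministic estimate applies; the measures of the four
  events add.\<close>

lemma little_op_stein_bound:
  assumes "\<sigma> > 0"
    and A: "little_op Q A0 (\<lambda>_. 1)" "little_op Q A1 (\<lambda>n. sqrt (real n))"
      "little_op Q A2 (\<lambda>n. 1 / sqrt (real n))" "little_op Q A3 (\<lambda>_. 1)"
  shows "little_op Q (\<lambda>n X. stein_bound \<sigma> n (A0 n X) (A1 n X) (A2 n X) (A3 n X)) (\<lambda>_. 1)"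
  unfolding little_op_def
proof (intro allI impI)
  let ?S = "\<lambda>n X. stein_bound \<sigma> n (A0 n X) (A1 n X) (A2 n X) (A3 n X)"
  fix \<epsilon> :: real assume \<epsilon>: "\<epsilon> > 0"
  define C where "C = 1 + 3 / \<sigma> + 1 / \<sigma>\<^sup>2"
  have C: "C > 0" using assms(1) by (auto simp: C_def intro!: add_pos_pos)
  \<comment> \<open>The first entry meets the restriction of the deterministic estimate, the second
    brings the final bound below \<epsilon>.\<close>
  define e where "e = min (1 / 2) (\<epsilon> / (4 * C))"
  have e: "0 < e" "e \<le> 1 / 2" using \<epsilon> C by (auto simp: e_def)
  have "4 * e * C \<le> 4 * (\<epsilon> / (4 * C)) * C" using C by (intro mult_right_mono mult_left_mono) (auto simp: e_def)
  then have eC: "4 * e * C \<le> \<epsilon>" using C by simp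
  note A' = A[unfolded little_op_def, rule_format, OF e(1)]
  obtain B0 where B0: "\<And>n. B0 n \<in> sets (Q n) \<and> {X \<in> space (Q n). A0 n X > ennreal (e * 1)} \<subseteq> B0 n" "(\<lambda>n. measure (Q n) (B0 n)) \<longlonglongrightarrow> 0"
    using A'(1) by blast
  obtain B1 where B1: "\<And>n. B1 n \<in> sets (Q n) \<and> {X \<in> space (Q n). A1 n X > ennreal (e * sqrt (real n))} \<subseteq> B1 n" "(\<lambda>n. measure (Q n) (B1 n)) \<longlonglongrightarrow> 0"
    using A'(2) by blast
  obtain B2 where B2: "\<And>n. B2 n \<in> sets (Q n) \<and> {X \<in> space (Q n). A2 n X > ennreal (e * (1 / sqrt (real n)))} \<subseteq> B2 n" "(\<lambda>n. measure (Q n) (B2 n)) \<longlonglongrightarrow> 0"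
    using A'(3) by blast
  obtain B3 where B3: "\<And>n. B3 n \<in> sets (Q n) \<and> {X \<in> space (Q n). A3 n X > ennreal (e * 1)} \<subseteq> B3 n" "(\<lambda>n. measure (Q n) (B3 n)) \<longlonglongrightarrow> 0"
    using A'(4) by blast
  \<comment> \<open>At index 0 the rates degenerate, so the whole space is taken as the covering
    event; a single index does not affect the limit.\<close>
  define B where "B n = (if n = 0 then space (Q n) else B0 n \<union> B1 n \<union> B2 n \<union> B3 n)" for n
  have "{X \<in> space (Q n). ?S n X > ennreal (\<epsilon> * 1)} \<subseteq> B n" for n
  proof (cases "n = 0")
    case False
    show ?thesis
    proof (rule subsetI, rule ccontr)
      fix X assume X: "X \<in> {X \<in> space (Q n). ?S n X > ennreal (\<epsilon> * 1)}"
        and nB: "X \<notin> B n"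
      have "A0 n X \<le> ennreal (e * 1)" "A1 n X \<le> ennreal (e * sqrt (real n))" "A2 n X \<le> ennreal (e * (1 / sqrt (real n)))" "A3 n X \<le> ennreal (e * 1)"
        using X nB False B0(1)[of n] B1(1)[of n] B2(1)[of n] B3(1)[of n] unfolding B_def by (auto simp: not_less[symmetric])
      from stein_bound_small[OF assms(1) _ e this] False
      have "?S n X \<le> ennreal (4 * e * C)" by (simp add: C_def)
      also have "\<dots> \<le> ennreal \<epsilon>" using eC by (rule ennreal_leI)
      finally show False using X by (simp add: not_less[symmetric])
    qed
  qed (auto simp: B_def)
  moreover have "B n \<in> sets (Q n)" for n using B0(1)[of n] B1(1)[of n] B2(1)[of n] B3(1)[of n] by (auto simp: B_def)
  moreover have "(\<lambda>n. measure (Q n) (B n)) \<longlonglongrightarrow> 0"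
  proof (rule tendsto_sandwich[where f = "\<lambda>_. 0"])
    show "(\<lambda>n. measure (Q n) (B0 n) + measure (Q n) (B1 n) + measure (Q n) (B2 n) + measure (Q n) (B3 n)) \<longlonglongrightarrow> 0"
      using tendsto_add[OF tendsto_add[OF tendsto_add[OF B0(2) B1(2)] B2(2)] B3(2)] by simp
    show "\<forall>\<^sub>F n in sequentially. measure (Q n) (B n) \<le> measure (Q n) (B0 n) + measure (Q n) (B1 n) + measure (Q n) (B2 n) + measure (Q n) (B3 n)"
      using eventually_gt_at_top[of 0]
    proof eventually_elim
      case (elim n)
      have s: "B0 n \<in> sets (Q n)" "B1 n \<in> sets (Q n)" "B2 n \<in> sets (Q n)" "B3 n \<in> sets (Q n)"
        using B0(1) B1(1) B2(1) B3(1) by auto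
      show ?case using elim measure_Un_le[OF s(1,2)] measure_Un_le[of "B0 n \<union> B1 n" "Q n" "B2 n"]
          measure_Un_le[of "B0 n \<union> B1 n \<union> B2 n" "Q n" "B3 n"] s by (simp add: B_def)
    qed
  qed auto
  ultimately show "\<exists>B. (\<forall>n. B n \<in> sets (Q n) \<and>
      {X \<in> space (Q n). ?S n X > ennreal (\<epsilon> * 1)} \<subseteq> B n) \<and>
      (\<lambda>n. measure (Q n) (B n)) \<longlonglongrightarrow> 0"
    by (intro exI[of _ B]) auto
qed

section \<open>Stein's method for the posterior\<close>

context riemannian_mfd begin

lemma weighted_div_ddir:
  assumes "\<theta> \<in> pt"
  shows "weighted_div M g w V \<theta> = divergence M g V \<theta> + ddir V (\<lambda>\<eta>. ln (w \<eta>)) \<theta>"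
  unfolding weighted_div_def metric_inner_grad(1)[OF assms] ddir_def ..

lemma C1_on_exp: "openin Top S \<Longrightarrow> C1_on S f \<Longrightarrow> C1_on S (\<lambda>\<theta>. exp (f \<theta>))"
  by (rule C1_on_compose(1)[where \<phi> = exp and \<phi>' = exp]) auto

lemma C1_on_ln: "openin Top S \<Longrightarrow> C1_on S f \<Longrightarrow> (\<And>\<theta>. \<theta> \<in> S \<Longrightarrow> f \<theta> > 0) \<Longrightarrow> C1_on S (\<lambda>\<theta>. ln (f \<theta>))"
  by (rule C1_on_compose(1)[where \<phi> = ln and \<phi>' = "\<lambda>x. 1 / x"])
    (assumption | rule DERIV_ln_divide continuous_intros | simp add: less_imp_neq[symmetric])+

lemma C1_on_measurable: "C1_on pt f \<Longrightarrow> f \<in> borel_measurable \<mu>"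
  by (intro measurable_tendsto C1_on_tendsto)

lemma C1_on_cmult: "openin Top S \<Longrightarrow> C1_on S f \<Longrightarrow> C1_on S (\<lambda>\<theta>. a * f \<theta>)"
  by (intro C1_on_mult C1_on_const)

text \<open>The divergence theorem, divided by the density: the logarithmic derivative of
  \<open>w\<close> along \<open>V\<close> supplies both the prior term, which completes the
  divergence to the weighted one, and the likelihood term.\<close>

lemma posterior_stein_identity:
  assumes V: "Ck_vfield M 1 V" and \<pi>: "C1_on pt \<pi>" "\<And>\<theta>. \<theta> \<in> pt \<Longrightarrow> \<pi> \<theta> > 0"
    and l: "C1_on pt l" and u: "C1_on pt u"
    and K: "compactin Top K" "\<And>\<theta>. \<theta> \<in> pt \<Longrightarrow> \<theta> \<notin> K \<Longrightarrow> u \<theta> = 0" and Z: "Z > 0"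
  defines "T \<equiv> \<lambda>\<theta>. ddir V u \<theta> + u \<theta> * (weighted_div M g \<pi> V \<theta> + ddir V l \<theta>)"
    and "P \<equiv> density \<mu> (\<lambda>\<theta>. ennreal (\<pi> \<theta> * exp (l \<theta>) / Z))"
  shows "integrable P T" "(\<integral>\<theta>. T \<theta> \<partial>P) = 0"
proof -
  note o = openin_topspace[of Top]
  \<comment> \<open>Writing the density as an exponential makes its derivative \<open>w\<close>
    times the derivative of \<open>L\<close>.\<close>
  define L where "L \<theta> = ln (\<pi> \<theta>) + l \<theta>" for \<theta>
  define w where "w \<theta> = inverse Z * exp (L \<theta>)" for \<theta>
  have ln\<pi>: "C1_on pt (\<lambda>\<theta>. ln (\<pi> \<theta>))" by (rule C1_on_ln[OF o \<pi>])
  have L: "C1_on pt L" unfolding L_def[abs_def] by (rule C1_on_add[OF o ln\<pi> l])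
  have eL: "C1_on pt (\<lambda>\<theta>. exp (L \<theta>))" by (rule C1_on_exp[OF o L])
  have w: "C1_on pt w" unfolding w_def[abs_def] by (rule C1_on_cmult[OF o eL])
  have w_eq: "w \<theta> = \<pi> \<theta> * exp (l \<theta>) / Z" if "\<theta> \<in> pt" for \<theta>
    using \<pi>(2)[OF that] by (simp add: w_def L_def exp_add field_simps)
  have w_pos: "w \<theta> > 0" for \<theta> using Z by (simp add: w_def)
  have v: "C1_on pt (\<lambda>\<theta>. u \<theta> * w \<theta>)" by (rule C1_on_mult[OF o u w])
  let ?D = "\<lambda>\<theta>. ddir V (\<lambda>\<theta>. u \<theta> * w \<theta>) \<theta> + u \<theta> * w \<theta> * divergence M g V \<theta>"
  have D: "integrable \<mu> ?D" "(\<integral>\<theta>. ?D \<theta> \<partial>\<mu>) = 0"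
    by (rule divergence_theorem[OF V v K(1)]; simp add: K(2))+
  have DT: "?D \<theta> = w \<theta> * T \<theta>" if \<theta>: "\<theta> \<in> space \<mu>" for \<theta>
  proof -
    have \<theta>p: "\<theta> \<in> pt" using \<theta> space_vol by simp
    note c = chart_at[OF \<theta>p]
    have "ddir V w \<theta> = inverse Z * ddir V (\<lambda>\<theta>. exp (L \<theta>)) \<theta>"
      unfolding w_def[abs_def] ddir_def
      by (subst dird_mult[OF C1_on_const eL \<theta>p c]) (simp add: dird_def chart_derivI[OF DERIV_const])
    also have "ddir V (\<lambda>\<theta>. exp (L \<theta>)) \<theta> = exp (L \<theta>) * ddir V L \<theta>"
      unfolding ddir_def by (rule dird_compose[OF L o \<theta>p c]) auto
    also have "ddir V L \<theta> = ddir V (\<lambda>\<theta>. ln (\<pi> \<theta>)) \<theta> + ddir V l \<theta>"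
      unfolding ddir_def L_def[abs_def] by (rule dird_add[OF ln\<pi> l \<theta>p c])
    finally have "ddir V w \<theta> = w \<theta> * (ddir V (\<lambda>\<theta>. ln (\<pi> \<theta>)) \<theta> + ddir V l \<theta>)"
      by (simp add: w_def[abs_def])
    moreover have "ddir V (\<lambda>\<theta>. u \<theta> * w \<theta>) \<theta> = ddir V u \<theta> * w \<theta> + u \<theta> * ddir V w \<theta>"
      unfolding ddir_def by (rule dird_mult[OF u w \<theta>p c])
    ultimately show ?thesis unfolding T_def weighted_div_ddir[OF \<theta>p] by (simp add: algebra_simps)
  qed
  have wm: "w \<in> borel_measurable \<mu>" by (rule C1_on_measurable[OF w])
  \<comment> \<open>Measurability of \<open>T\<close> is inherited from the integrable left-hand
    side, by division through the positive density.\<close>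
  have "(\<lambda>\<theta>. ?D \<theta> / w \<theta>) \<in> borel_measurable \<mu>"
    using borel_measurable_integrable[OF D(1)] wm by (rule borel_measurable_divide)
  moreover have "?D \<theta> / w \<theta> = T \<theta>" if "\<theta> \<in> space \<mu>" for \<theta>
    using DT[OF that] w_pos[of \<theta>] by simp
  ultimately have Tm: "T \<in> borel_measurable \<mu>" using measurable_cong[of \<mu> "\<lambda>\<theta>. ?D \<theta> / w \<theta>" T] by simp
  have P: "P = density \<mu> (\<lambda>\<theta>. ennreal (w \<theta>))"
  proof -
    have [measurable]: "\<pi> \<in> borel_measurable \<mu>" "l \<in> borel_measurable \<mu>" by (intro C1_on_measurable \<pi> l)+
    show ?thesis unfolding P_def using wm by (intro density_cong AE_I2) (auto simp: w_eq space_vol)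
  qed
  have nn: "AE \<theta> in \<mu>. 0 \<le> w \<theta>" using w_pos by (auto intro: less_imp_le)
  have "integrable \<mu> (\<lambda>\<theta>. w \<theta> *\<^sub>R T \<theta>) \<longleftrightarrow> integrable \<mu> ?D"
    by (rule Bochner_Integration.integrable_cong[OF refl]) (simp add: DT)
  then show "integrable P T" unfolding P integrable_density[OF Tm wm nn] using D(1) by blast
  have "(\<integral>\<theta>. w \<theta> *\<^sub>R T \<theta> \<partial>\<mu>) = (\<integral>\<theta>. ?D \<theta> \<partial>\<mu>)"
    by (rule Bochner_Integration.integral_cong[OF refl]) (simp add: DT)
  then show "(\<integral>\<theta>. T \<theta> \<partial>P) = 0" unfolding P integral_density[OF Tm wm nn] using D(2) by simp
qed

end

section \<open>From single test functions to the bounded Lipschitz distance and the stated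
  bound\<close>

lemma dBL_le:
  fixes Z :: "'a \<Rightarrow> real"
  assumes "prob_space P" and Z: "Z \<in> borel_measurable P"
    and le: "\<And>h. (\<And>x. \<bar>h x\<bar> \<le> 1) \<Longrightarrow> (\<And>x y. \<bar>h x - h y\<bar> \<le> \<bar>x - y\<bar>) \<Longrightarrow>
      ennreal \<bar>\<integral>\<theta>. (h (Z \<theta>) - (\<integral>x. h x \<partial>\<nu>)) \<partial>P\<bar> \<le> B"
  shows "ennreal (dBL (distr P borel Z) \<nu>) \<le> B"
proof (cases B)
  case (real b)
  interpret prob_space P by fact
  have "dBL (distr P borel Z) \<nu> \<le> b"
    unfolding dBL_def
  proof (rule cSUP_least)
    show "{h :: real \<Rightarrow> real. (\<forall>x. \<bar>h x\<bar> \<le> 1) \<and> (\<forall>x y. \<bar>h x - h y\<bar> \<le> \<bar>x - y\<bar>)} \<noteq> {}"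
      by (auto intro!: exI[of _ "\<lambda>_. 0"])
    fix h :: "real \<Rightarrow> real" assume "h \<in> {h. (\<forall>x. \<bar>h x\<bar> \<le> 1) \<and> (\<forall>x y. \<bar>h x - h y\<bar> \<le> \<bar>x - y\<bar>)}"
    then have h: "\<bar>h x\<bar> \<le> 1" "\<bar>h x - h y\<bar> \<le> \<bar>x - y\<bar>" for x y by auto
    have "1-lipschitz_on UNIV h" using h(2) by (auto simp: lipschitz_on_def dist_real_def)
    then have "continuous_on UNIV h" by (rule lipschitz_on_continuous_on)
    then have hm: "h \<in> borel_measurable borel" by (rule borel_measurable_continuous_onI)
    have i: "integrable P (\<lambda>\<theta>. h (Z \<theta>))"
      using h(1) Z hm by (intro integrable_const_bound[of _ 1]) auto
    have "(\<integral>x. h x \<partial>distr P borel Z) - (\<integral>x. h x \<partial>\<nu>) = (\<integral>\<theta>. (h (Z \<theta>) - (\<integral>x. h x \<partial>\<nu>)) \<partial>P)"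
      using i prob_space by (simp add: integral_distr[OF Z hm])
    then show "\<bar>(\<integral>x. h x \<partial>distr P borel Z) - (\<integral>x. h x \<partial>\<nu>)\<bar> \<le> b"
      using le[OF h] real by (simp add: ennreal_le_iff)
  qed
  then show ?thesis using real by (simp add: ennreal_leI)
qed simp

text \<open>Stein's method delivers the stronger estimate in the premise, with 2 A0 in place of 4 A0
  and no factor 1 - A0 below A1. Since that factor is at most 1, inserting it only enlarges the
  bound.\<close>

lemma le_stein_bound:
  assumes "\<sigma> > 0" "n \<ge> 1" "0 \<le> x" "x \<le> 1"
    and d: "x < 1 \<Longrightarrow> d \<le> ennreal (2 * x) + ennreal (4 / (\<sigma> * sqrt (real n))) * a1 + ennreal (4 / \<sigma> * sqrt (real n)) * a2 + ennreal (4 / \<sigma>\<^sup>2) * a3"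
  shows "d \<le> stein_bound \<sigma> n (ennreal x) a1 a2 a3"
proof (cases "x < 1")
  case False
  then have "x = 1" using assms by simp
  then show ?thesis by (simp add: stein_bound_def)
next
  case True
  let ?s = "sqrt (real n)"
  have n: "?s > 0" using assms(2) by simp
  have "ennreal (4 / (\<sigma> * ?s)) * a1 = 4 * (ennreal (1 / \<sigma>) * (a1 / ennreal (?s)))"
  proof -
    have "4 / (\<sigma> * ?s) = 4 * (1 / \<sigma> * inverse (?s))" by (simp add: field_simps)
    moreover have "ennreal (4 * (1 / \<sigma> * inverse (?s))) = ennreal 4 * ennreal (1 / \<sigma> * inverse (?s))"
      using assms(1) by (intro ennreal_mult) auto
    moreover have "ennreal (1 / \<sigma> * inverse (?s)) = ennreal (1 / \<sigma>) * ennreal (inverse (?s))"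
      using assms(1) by (intro ennreal_mult) auto
    ultimately have "ennreal (4 / (\<sigma> * ?s)) = 4 * (ennreal (1 / \<sigma>) * ennreal (inverse (?s)))"
      by simp
    also have "ennreal (inverse (?s)) = inverse (ennreal (?s))"
      by (rule inverse_ennreal[OF n, symmetric])
    finally show ?thesis by (simp add: divide_ennreal_def mult_ac)
  qed
  also have "\<dots> \<le> 4 * (ennreal (1 / \<sigma>) * (a1 / (ennreal (?s) * (1 - ennreal x))))"
  proof (intro mult_left_mono ennreal_divide_antimono)
    have "ennreal (?s) * (1 - ennreal x) \<le> ennreal (?s) * 1"
      by (intro mult_left_mono) (auto simp: diff_le_self_ennreal)
    then show "ennreal (?s) * (1 - ennreal x) \<le> ennreal (?s)" by simp
  qed auto
  finally have 1: "ennreal (4 / (\<sigma> * ?s)) * a1 \<le> 4 * (ennreal (1 / \<sigma>) * (a1 / (ennreal (?s) * (1 - ennreal x))))" .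
  have 2: "ennreal (4 / \<sigma> * ?s) * a2 = 4 * (ennreal (1 / \<sigma>) * ennreal (?s) * a2)"
  proof -
    have "4 / \<sigma> * ?s = 4 * (1 / \<sigma> * ?s)" by simp
    moreover have "ennreal (4 * (1 / \<sigma> * ?s)) = ennreal 4 * ennreal (1 / \<sigma> * ?s)"
      using assms(1) by (intro ennreal_mult) auto
    moreover have "ennreal (1 / \<sigma> * ?s) = ennreal (1 / \<sigma>) * ennreal (?s)"
      using assms(1) by (intro ennreal_mult) auto
    ultimately have "ennreal (4 / \<sigma> * ?s) = 4 * (ennreal (1 / \<sigma>) * ennreal (?s))"
      by simp
    then show ?thesis by (simp add: mult_ac)
  qed
  have 3: "ennreal (4 / \<sigma>\<^sup>2) * a3 = 4 * (ennreal (1 / \<sigma>\<^sup>2) * a3)"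
  proof -
    have "4 / \<sigma>\<^sup>2 = 4 * (1 / \<sigma>\<^sup>2)" by simp
    moreover have "ennreal (4 * (1 / \<sigma>\<^sup>2)) = ennreal 4 * ennreal (1 / \<sigma>\<^sup>2)"
      by (intro ennreal_mult) auto
    ultimately have "ennreal (4 / \<sigma>\<^sup>2) = 4 * ennreal (1 / \<sigma>\<^sup>2)" by simp
    then show ?thesis by (simp add: mult_ac)
  qed
  have 4: "ennreal (2 * x) \<le> 4 * ennreal x"
  proof -
    have "ennreal (2 * x) \<le> ennreal (4 * x)" using assms(3) by (intro ennreal_leI) simp
    then show ?thesis using assms(3) by (simp add: ennreal_mult)
  qed
  have "d \<le> 4 * ennreal x + 4 * (ennreal (1 / \<sigma>) * (a1 / (ennreal (?s) * (1 - ennreal x))))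
      + 4 * (ennreal (1 / \<sigma>) * ennreal (?s) * a2) + 4 * (ennreal (1 / \<sigma>\<^sup>2) * a3)"
    by (rule order.trans[OF d[OF True]]) (intro add_mono 1 4 eq_refl[OF 2] eq_refl[OF 3])
  moreover have "ennreal x \<noteq> 1" using True assms(3) by (simp flip: ennreal_1)
  ultimately show ?thesis by (simp add: stein_bound_def distrib_left)
qed

context riemannian_mfd begin

text \<open>Formulated for a general functional \<Psi> so that it covers both items.
  \<open>E2\<close> measures how far the corrected functional is from the estimator,
  \<open>E3\<close> how far the derivative of \<Psi> along \<open>V\<close> is from \<sigma>^2; both
  are prescribed only at points of the manifold.\<close>

theorem posterior_stein_bound:
  fixes n :: nat
  assumes \<sigma>: "\<sigma> > 0" and n: "n \<ge> 1" and V: "Ck_vfield M 1 V"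
    and \<pi>: "C1_on pt \<pi>" "\<And>\<theta>. \<theta> \<in> pt \<Longrightarrow> \<pi> \<theta> > 0"
    and l: "C1_on pt l" and \<Psi>: "C1_on pt \<Psi>"
    and \<kappa>: "C1_on pt \<kappa>" "\<And>\<theta>. \<theta> \<in> pt \<Longrightarrow> 0 \<le> \<kappa> \<theta> \<and> \<kappa> \<theta> \<le> 1" "compactin Top (msupport M \<kappa>)"
    and int: "integrable (density \<mu> (\<lambda>\<theta>. ennreal (\<pi> \<theta>))) (\<lambda>\<theta>. exp (l \<theta>))"
    and E2: "\<And>\<theta>. \<theta> \<in> pt \<Longrightarrow> E2 \<theta> = \<Psi> \<theta> - \<psi> + (ddir V l \<theta> + weighted_div M g \<pi> V \<theta>) / real n"
    and E3: "\<And>\<theta>. \<theta> \<in> pt \<Longrightarrow> E3 \<theta> = \<sigma>\<^sup>2 - ddir V \<Psi> \<theta>"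
  defines "Post \<equiv> posterior (density \<mu> (\<lambda>\<theta>. ennreal (\<pi> \<theta>))) l"
  shows "ennreal (dBL (distr Post borel (\<lambda>\<theta>. sqrt (real n) * (\<Psi> \<theta> - \<psi>))) (density lborel (\<lambda>x. ennreal (normal_density 0 \<sigma> x))))
    \<le> stein_bound \<sigma> n (ennreal (1 - (\<integral>\<theta>. \<kappa> \<theta> \<partial>Post))) (\<integral>\<^sup>+\<theta>. ennreal \<bar>metric_inner M g (grad M g \<kappa>) V \<theta>\<bar> \<partial>Post)
      (SUP \<theta>\<in>msupport M \<kappa>. ennreal \<bar>E2 \<theta>\<bar>) (SUP \<theta>\<in>msupport M \<kappa>. ennreal \<bar>E3 \<theta>\<bar>)"
    (is "_ \<le> stein_bound \<sigma> n _ ?A1 ?A2 ?A3")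
proof -
  let ?s = "sqrt (real n)" and ?N = "density lborel (\<lambda>x. ennreal (normal_density 0 \<sigma> x))"
  let ?R = "ennreal (4 / (\<sigma> * ?s)) * ?A1 + (ennreal (4 / \<sigma> * ?s) * ?A2 + ennreal (4 / \<sigma>\<^sup>2) * ?A3)"
  note o = openin_topspace[of Top]
  define Prior where "Prior = density \<mu> (\<lambda>\<theta>. ennreal (\<pi> \<theta>))"
  define Z0 where "Z0 = (\<integral>\<theta>. exp (l \<theta>) \<partial>Prior)"
  have m[measurable]: "\<pi> \<in> borel_measurable \<mu>" "l \<in> borel_measurable \<mu>" "\<kappa> \<in> borel_measurable \<mu>" "\<Psi> \<in> borel_measurable \<mu>"
    by (intro C1_on_measurable \<pi> l \<kappa> \<Psi>)+
  have Post: "Post = density Prior (\<lambda>\<theta>. ennreal (exp (l \<theta>) / Z0))"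
    unfolding Post_def posterior_def Z0_def Prior_def ..
  have setsP[measurable_cong]: "sets Post = sets \<mu>" unfolding Post Prior_def by simp
  have spaceP: "space Post = mfd_points M" unfolding Post Prior_def by (simp add: space_vol)
  have "Z0 \<ge> 0" unfolding Z0_def by (rule Bochner_Integration.integral_nonneg) simp
  show ?thesis
  proof (cases "Z0 = 0")
    \<comment> \<open>Division by zero makes \<open>Post\<close> the null measure, as happens for an
      empty manifold. Then the expectation of \<kappa> is 0, so A0 is 1 and the bound is
      infinite.\<close>
    case True
    have "(\<integral>\<theta>. \<kappa> \<theta> \<partial>Post) = (\<integral>\<theta>. 0 *\<^sub>R \<kappa> \<theta> \<partial>Prior)"
      unfolding Post True using m unfolding Prior_def by (subst integral_density) auto
    then show ?thesis by (simp add: stein_bound_def)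
  next
    case False
    then have Z0: "Z0 > 0" using \<open>Z0 \<ge> 0\<close> by simp
    have Post\<mu>: "Post = density \<mu> (\<lambda>\<theta>. ennreal (\<pi> \<theta> * exp (l \<theta>) / Z0))"
    proof -
      have "Post = density \<mu> (\<lambda>\<theta>. ennreal (\<pi> \<theta>) * ennreal (exp (l \<theta>) / Z0))"
        unfolding Post Prior_def by (rule density_density_eq) auto
      also have "\<dots> = density \<mu> (\<lambda>\<theta>. ennreal (\<pi> \<theta> * exp (l \<theta>) / Z0))"
        using \<pi>(2) Z0 by (intro density_cong AE_I2) (auto simp: space_vol less_imp_le simp flip: ennreal_mult)
      finally show ?thesis .
    qed
    interpret prob_space Post
    proof
      have "emeasure Post (space Post) = (\<integral>\<^sup>+\<theta>. ennreal (exp (l \<theta>) / Z0) \<partial>Prior)"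
        unfolding Post by (subst emeasure_density) (auto simp: Prior_def intro!: nn_integral_cong)
      also have "\<dots> = ennreal (\<integral>\<theta>. exp (l \<theta>) / Z0 \<partial>Prior)"
        using int Z0 unfolding Prior_def by (intro nn_integral_eq_integral) auto
      also have "\<dots> = 1" using Z0 by (simp add: Z0_def)
      finally show "emeasure Post (space Post) = 1" .
    qed
    let ?Z = "\<lambda>\<theta>. ?s * (\<Psi> \<theta> - \<psi>)"
    have sn: "?s > 0" "real n = ?s * ?s" using n by auto
    have Z1: "C1_on pt ?Z"
      using C1_on_cmult[OF o C1_on_add[OF o \<Psi> C1_on_const[of _ "- \<psi>"]], of "?s"] by simp
    have \<kappa>b: "\<bar>\<kappa> \<theta>\<bar> \<le> 1" if "\<theta> \<in> space Post" for \<theta> using \<kappa>(2) that spaceP by auto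
    have i\<kappa>: "integrable Post \<kappa>"
      by (rule integrable_const_bound[of _ 1]) (use \<kappa>b in auto)
    define x where "x = 1 - (\<integral>\<theta>. \<kappa> \<theta> \<partial>Post)"
    have "(\<integral>\<theta>. \<kappa> \<theta> \<partial>Post) \<ge> 0"
      by (rule integral_nonneg_AE) (use \<kappa>(2) spaceP in auto)
    moreover have "(\<integral>\<theta>. \<kappa> \<theta> \<partial>Post) \<le> (\<integral>\<theta>. 1 \<partial>Post)"
      by (rule integral_mono[OF i\<kappa>]) (use \<kappa>(2) spaceP in auto)
    ultimately have x: "0 \<le> x" "x \<le> 1" using prob_space by (auto simp: x_def)
    have supp: "\<kappa> \<theta> = 0" if "\<theta> \<in> pt" "\<theta> \<notin> msupport M \<kappa>" for \<theta>
      using that closure_of_subset[of "{\<theta> \<in> pt. \<kappa> \<theta> \<noteq> 0}" Top] unfolding msupport_def by blast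
    have dm: "(\<lambda>\<theta>. ddir V \<kappa> \<theta>) \<in> borel_measurable \<mu>"
      by (intro measurable_tendsto ddir_tendsto[OF V \<kappa>(1)])
    have A1: "?A1 = (\<integral>\<^sup>+\<theta>. ennreal \<bar>ddir V \<kappa> \<theta>\<bar> \<partial>Post)"
      by (rule nn_integral_cong) (simp add: metric_inner_grad ddir_def spaceP)
    have bound: "ennreal \<bar>\<integral>\<theta>. (h (?Z \<theta>) - (\<integral>x. h x \<partial>?N)) \<partial>Post\<bar>
       \<le> ennreal (2 * x) + ennreal (4 / (\<sigma> * ?s)) * ?A1 + ennreal (4 / \<sigma> * ?s) * ?A2 + ennreal (4 / \<sigma>\<^sup>2) * ?A3"
      if h: "\<And>x. \<bar>h x\<bar> \<le> 1" "\<And>x y. \<bar>h x - h y\<bar> \<le> \<bar>x - y\<bar>" for h :: "real \<Rightarrow> real"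
    proof -
      define m where "m = (\<integral>x. h x \<partial>?N)"
      have "1-lipschitz_on UNIV h" using h(2) by (auto simp: lipschitz_on_def dist_real_def)
      then have hc0: "continuous_on UNIV h" by (rule lipschitz_on_continuous_on)
      then have hc: "isCont h x" for x by (simp add: continuous_on_eq_continuous_at)
      have hm[measurable]: "h \<in> borel_measurable borel" using hc0 by (rule borel_measurable_continuous_onI)
      obtain f f' where f: "\<And>z. (f has_real_derivative f' z) (at z)" "\<And>z. isCont f' z"
        "\<And>z. \<sigma>\<^sup>2 * f' z - z * f z = h z - m" "\<And>z. \<bar>f z\<bar> \<le> 4 / \<sigma>" "\<And>z. \<bar>f' z\<bar> \<le> 4 / \<sigma>\<^sup>2" "\<bar>m\<bar> \<le> 1"
        by (rule stein_solution[OF \<sigma> hc h(1), folded m_def]) (rule that)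
      have fZ: "C1_on pt (\<lambda>\<theta>. f (?Z \<theta>))"
        by (rule C1_on_compose(1)[OF o Z1 f(1,2)])
      define u where "u \<theta> = \<kappa> \<theta> * f (?Z \<theta>)" for \<theta>
      have u1: "C1_on pt u" unfolding u_def[abs_def] by (rule C1_on_mult[OF o \<kappa>(1) fZ])
      define T where "T \<theta> = ddir V u \<theta> + u \<theta> * (weighted_div M g \<pi> V \<theta> + ddir V l \<theta>)" for \<theta>
      have T: "integrable Post T" "(\<integral>\<theta>. T \<theta> \<partial>Post) = 0"
        unfolding Post\<mu> T_def[abs_def]
        by (rule posterior_stein_identity[OF V \<pi> l u1 \<kappa>(3) _ Z0]; simp add: u_def supp)+
      \<comment> \<open>The three errors: \<sigma>^2 against the derivative of \<Psi>, the corrected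
        functional against the estimator, and the gradient of the cut-off. Only the last is divided
        by sqrt n, since the other terms of \<open>T\<close> carry at least one such factor
        themselves.\<close>
      define R where "R \<theta> = \<kappa> \<theta> * f' (?Z \<theta>) * E3 \<theta> - \<kappa> \<theta> * f (?Z \<theta>) * ?s * E2 \<theta> - f (?Z \<theta>) * ddir V \<kappa> \<theta> / ?s" for \<theta>
      have key: "\<kappa> \<theta> * (h (?Z \<theta>) - m) = T \<theta> / ?s + R \<theta>" if \<theta>: "\<theta> \<in> space Post" for \<theta>
      proof -
        have \<theta>p: "\<theta> \<in> pt" using \<theta> spaceP by simp
        note c = chart_at[OF \<theta>p]
        have "ddir V ?Z \<theta> = ?s * ddir V \<Psi> \<theta>"
        proof -
          have e: "?Z = (\<lambda>\<theta>. ?s * (\<Psi> \<theta> + - \<psi>))" by simp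
          have "C1_on pt (\<lambda>\<theta>. \<Psi> \<theta> + - \<psi>)" by (rule C1_on_add[OF o \<Psi> C1_on_const])
          then show ?thesis unfolding ddir_def e
            by (subst dird_mult[OF C1_on_const _ \<theta>p c]; (subst dird_add[OF \<Psi> C1_on_const \<theta>p c])?)
              (simp_all add: dird_def chart_derivI[OF DERIV_const])
        qed
        moreover have "ddir V (\<lambda>\<theta>. f (?Z \<theta>)) \<theta> = f' (?Z \<theta>) * ddir V ?Z \<theta>"
          unfolding ddir_def by (rule dird_compose[OF Z1 o \<theta>p c f(1,2)])
        moreover have "ddir V u \<theta> = ddir V \<kappa> \<theta> * f (?Z \<theta>) + \<kappa> \<theta> * ddir V (\<lambda>\<theta>. f (?Z \<theta>)) \<theta>"
          unfolding ddir_def u_def[abs_def] by (rule dird_mult[OF \<kappa>(1) fZ \<theta>p c])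
        ultimately have du: "ddir V u \<theta> = ddir V \<kappa> \<theta> * f (?Z \<theta>) + \<kappa> \<theta> * (f' (?Z \<theta>) * (?s * (\<sigma>\<^sup>2 - E3 \<theta>)))"
          by (simp add: E3[OF \<theta>p])
        \<comment> \<open>Of the two factors in n = \<open>?s * ?s\<close>, one is cancelled on
          dividing \<open>T\<close> by \<open>?s\<close>, and the other standardises \<Psi> -
          \<psi>.\<close>
        have dv: "weighted_div M g \<pi> V \<theta> + ddir V l \<theta> = ?s * (?s * E2 \<theta> - ?Z \<theta>)"
        proof -
          have "weighted_div M g \<pi> V \<theta> + ddir V l \<theta> = real n * (E2 \<theta> - (\<Psi> \<theta> - \<psi>))"
            using n by (simp add: E2[OF \<theta>p])
          then show ?thesis by (simp add: sn(2)[symmetric] right_diff_distrib mult.assoc[symmetric])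
        qed
        have "T \<theta> = ?s * (f (?Z \<theta>) * ddir V \<kappa> \<theta> / ?s + \<kappa> \<theta> * (f' (?Z \<theta>) * (\<sigma>\<^sup>2 - E3 \<theta>)) +
            \<kappa> \<theta> * f (?Z \<theta>) * (?s * E2 \<theta> - ?Z \<theta>))"
          unfolding T_def u_def du[unfolded u_def] dv using sn(1) by (simp add: distrib_left mult_ac)
        then have "T \<theta> / ?s = f (?Z \<theta>) * ddir V \<kappa> \<theta> / ?s + \<kappa> \<theta> * (f' (?Z \<theta>) * (\<sigma>\<^sup>2 - E3 \<theta>)) +
            \<kappa> \<theta> * f (?Z \<theta>) * (?s * E2 \<theta> - ?Z \<theta>)"
          using sn(1) by simp
        then have "T \<theta> / ?s + R \<theta> = \<kappa> \<theta> * (\<sigma>\<^sup>2 * f' (?Z \<theta>) - ?Z \<theta> * f (?Z \<theta>))"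
          unfolding R_def by (simp add: algebra_simps)
        then show ?thesis unfolding f(3) by simp
      qed
      have Hb: "\<bar>h z - m\<bar> \<le> 2" for z using h(1)[of z] f(6) by linarith
      have Zm[measurable]: "?Z \<in> borel_measurable Post" by measurable
      have iH: "integrable Post (\<lambda>\<theta>. \<kappa> \<theta> * (h (?Z \<theta>) - m))"
      proof (rule integrable_const_bound[of _ 2])
        show "AE \<theta> in Post. norm (\<kappa> \<theta> * (h (?Z \<theta>) - m)) \<le> 2"
          using mult_mono[OF \<kappa>b Hb] by (intro AE_I2) (simp add: abs_mult)
      qed measurable
      have iH2: "integrable Post (\<lambda>\<theta>. (1 - \<kappa> \<theta>) * (h (?Z \<theta>) - m))"
      proof (rule integrable_const_bound[of _ 2])
        have "\<bar>1 - \<kappa> \<theta>\<bar> \<le> 1" if "\<theta> \<in> space Post" for \<theta> using \<kappa>(2) that spaceP by auto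
        from mult_mono[OF this Hb] show "AE \<theta> in Post. norm ((1 - \<kappa> \<theta>) * (h (?Z \<theta>) - m)) \<le> 2"
          by (intro AE_I2) (simp add: abs_mult)
      qed measurable
      \<comment> \<open>\<open>R\<close> is integrable through this identity, from a bounded
        function and the integrable \<open>T\<close>; nothing of the kind is assumed of
        \<open>E2\<close> and \<open>E3\<close>.\<close>
      have R_eq: "R \<theta> = \<kappa> \<theta> * (h (?Z \<theta>) - m) - T \<theta> / ?s" if "\<theta> \<in> space Post" for \<theta>
        using key[OF that] by simp
      have iR: "integrable Post R"
        using Bochner_Integration.integrable_cong[of Post Post R "\<lambda>\<theta>. \<kappa> \<theta> * (h (?Z \<theta>) - m) - T \<theta> / ?s", OF refl R_eq]
          iH T(1) by simp
      have intR: "(\<integral>\<theta>. R \<theta> \<partial>Post) = (\<integral>\<theta>. \<kappa> \<theta> * (h (?Z \<theta>) - m) \<partial>Post)"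
        using Bochner_Integration.integral_cong[of Post Post R "\<lambda>\<theta>. \<kappa> \<theta> * (h (?Z \<theta>) - m) - T \<theta> / ?s", OF refl R_eq]
          iH T by simp
      have "(\<integral>\<theta>. (h (?Z \<theta>) - m) \<partial>Post) = (\<integral>\<theta>. (1 - \<kappa> \<theta>) * (h (?Z \<theta>) - m) + \<kappa> \<theta> * (h (?Z \<theta>) - m) \<partial>Post)"
        by (rule Bochner_Integration.integral_cong) (simp_all add: algebra_simps)
      also have "\<dots> = (\<integral>\<theta>. (1 - \<kappa> \<theta>) * (h (?Z \<theta>) - m) \<partial>Post) + (\<integral>\<theta>. R \<theta> \<partial>Post)"
        unfolding intR by (rule Bochner_Integration.integral_add[OF iH2 iH])
      finally have split: "(\<integral>\<theta>. (h (?Z \<theta>) - m) \<partial>Post) = (\<integral>\<theta>. (1 - \<kappa> \<theta>) * (h (?Z \<theta>) - m) \<partial>Post) + (\<integral>\<theta>. R \<theta> \<partial>Post)" .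
      have b1: "\<bar>\<integral>\<theta>. (1 - \<kappa> \<theta>) * (h (?Z \<theta>) - m) \<partial>Post\<bar> \<le> 2 * x"
      proof -
        have "\<bar>\<integral>\<theta>. (1 - \<kappa> \<theta>) * (h (?Z \<theta>) - m) \<partial>Post\<bar> \<le> (\<integral>\<theta>. \<bar>(1 - \<kappa> \<theta>) * (h (?Z \<theta>) - m)\<bar> \<partial>Post)"
          by (rule integral_abs_bound)
        also have "\<dots> \<le> (\<integral>\<theta>. (1 - \<kappa> \<theta>) * 2 \<partial>Post)"
        proof (rule integral_mono)
          fix \<theta> assume "\<theta> \<in> space Post"
          then have "0 \<le> 1 - \<kappa> \<theta>" using \<kappa>(2) spaceP by simp
          then show "\<bar>(1 - \<kappa> \<theta>) * (h (?Z \<theta>) - m)\<bar> \<le> (1 - \<kappa> \<theta>) * 2"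
            using Hb[of "?Z \<theta>"] by (simp only: abs_mult abs_of_nonneg mult_left_mono)
        qed (use iH2 i\<kappa> in auto)
        also have "\<dots> = 2 * x" using i\<kappa> prob_space by (simp add: x_def)
        finally show ?thesis .
      qed
      have R_le: "ennreal \<bar>R \<theta>\<bar> \<le> ennreal (4 / (\<sigma> * ?s)) * ennreal \<bar>ddir V \<kappa> \<theta>\<bar> + (ennreal (4 / \<sigma> * ?s) * ?A2 + ennreal (4 / \<sigma>\<^sup>2) * ?A3)"
        if \<theta>: "\<theta> \<in> space Post" for \<theta>
      proof -
        have \<kappa>\<theta>: "0 \<le> \<kappa> \<theta>" "\<kappa> \<theta> \<le> 1" using \<kappa>(2) \<theta> spaceP by auto
        \<comment> \<open>Off the support the factor \<kappa> annihilates the error, so suprema over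
          the support suffice. They may be infinite, which is why the estimate is carried out in
          \<open>ennreal\<close>.\<close>
        have s: "ennreal (\<kappa> \<theta> * \<bar>e \<theta>\<bar>) \<le> (SUP \<theta>\<in>msupport M \<kappa>. ennreal \<bar>e \<theta>\<bar>)" for e :: "'a \<Rightarrow> real"
        proof (cases "\<theta> \<in> msupport M \<kappa>")
          case True
          have "ennreal (\<kappa> \<theta> * \<bar>e \<theta>\<bar>) \<le> ennreal \<bar>e \<theta>\<bar>" using \<kappa>\<theta> by (intro ennreal_leI mult_left_le_one_le) auto
          also have "\<dots> \<le> (SUP \<theta>\<in>msupport M \<kappa>. ennreal \<bar>e \<theta>\<bar>)" by (rule SUP_upper[OF True])
          finally show ?thesis .
        next
          case False
          then show ?thesis using supp \<theta> spaceP by simp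
        qed
        have t1: "\<bar>\<kappa> \<theta> * f' (?Z \<theta>) * E3 \<theta>\<bar> \<le> 4 / \<sigma>\<^sup>2 * (\<kappa> \<theta> * \<bar>E3 \<theta>\<bar>)"
          using mult_right_mono[OF f(5)[of "?Z \<theta>"], of "\<kappa> \<theta> * \<bar>E3 \<theta>\<bar>"] \<kappa>\<theta>(1) by (simp add: abs_mult mult_ac)
        have t2: "\<bar>\<kappa> \<theta> * f (?Z \<theta>) * ?s * E2 \<theta>\<bar> \<le> 4 / \<sigma> * ?s * (\<kappa> \<theta> * \<bar>E2 \<theta>\<bar>)"
          using mult_right_mono[OF f(4)[of "?Z \<theta>"], of "?s * (\<kappa> \<theta> * \<bar>E2 \<theta>\<bar>)"] \<kappa>\<theta>(1) by (simp add: abs_mult mult_ac)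
        have t3: "\<bar>f (?Z \<theta>) * ddir V \<kappa> \<theta> / ?s\<bar> \<le> 4 / (\<sigma> * ?s) * \<bar>ddir V \<kappa> \<theta>\<bar>"
          using mult_right_mono[OF f(4)[of "?Z \<theta>"], of "\<bar>ddir V \<kappa> \<theta>\<bar> / ?s"] by (simp add: abs_mult mult_ac)
        have "\<bar>R \<theta>\<bar> \<le> 4 / (\<sigma> * ?s) * \<bar>ddir V \<kappa> \<theta>\<bar> + (4 / \<sigma> * ?s * (\<kappa> \<theta> * \<bar>E2 \<theta>\<bar>) + 4 / \<sigma>\<^sup>2 * (\<kappa> \<theta> * \<bar>E3 \<theta>\<bar>))"
          unfolding R_def using t1 t2 t3 by linarith
        then have "ennreal \<bar>R \<theta>\<bar> \<le> ennreal (4 / (\<sigma> * ?s) * \<bar>ddir V \<kappa> \<theta>\<bar> + (4 / \<sigma> * ?s * (\<kappa> \<theta> * \<bar>E2 \<theta>\<bar>) + 4 / \<sigma>\<^sup>2 * (\<kappa> \<theta> * \<bar>E3 \<theta>\<bar>)))"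
          by (rule ennreal_leI)
        also have "\<dots> = ennreal (4 / (\<sigma> * ?s)) * ennreal \<bar>ddir V \<kappa> \<theta>\<bar> +
            (ennreal (4 / \<sigma> * ?s) * ennreal (\<kappa> \<theta> * \<bar>E2 \<theta>\<bar>) + ennreal (4 / \<sigma>\<^sup>2) * ennreal (\<kappa> \<theta> * \<bar>E3 \<theta>\<bar>))"
          using \<sigma> \<kappa>\<theta>(1) by (subst ennreal_plus ennreal_mult[symmetric] | auto intro!: add_nonneg_nonneg)+
        also have "\<dots> \<le> ennreal (4 / (\<sigma> * ?s)) * ennreal \<bar>ddir V \<kappa> \<theta>\<bar> + (ennreal (4 / \<sigma> * ?s) * ?A2 + ennreal (4 / \<sigma>\<^sup>2) * ?A3)"
          by (intro add_left_mono add_mono mult_left_mono s) auto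
        finally show ?thesis .
      qed
      have "ennreal \<bar>\<integral>\<theta>. R \<theta> \<partial>Post\<bar> \<le> ennreal (\<integral>\<theta>. \<bar>R \<theta>\<bar> \<partial>Post)"
        by (intro ennreal_leI integral_abs_bound)
      also have "\<dots> = (\<integral>\<^sup>+\<theta>. ennreal \<bar>R \<theta>\<bar> \<partial>Post)"
        using iR by (intro nn_integral_eq_integral[symmetric]) auto
      also have "\<dots> \<le> (\<integral>\<^sup>+\<theta>. ennreal (4 / (\<sigma> * ?s)) * ennreal \<bar>ddir V \<kappa> \<theta>\<bar> + (ennreal (4 / \<sigma> * ?s) * ?A2 + ennreal (4 / \<sigma>\<^sup>2) * ?A3) \<partial>Post)"
        by (rule nn_integral_mono[OF R_le])
      also have "\<dots> = ?R"
      proof -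
        have dP: "(\<lambda>\<theta>. ennreal \<bar>ddir V \<kappa> \<theta>\<bar>) \<in> borel_measurable Post" using dm by measurable
        then show ?thesis unfolding A1 by (simp add: nn_integral_add nn_integral_cmult emeasure_space_1)
      qed
      finally have b2: "ennreal \<bar>\<integral>\<theta>. R \<theta> \<partial>Post\<bar> \<le> ?R" .
      have "ennreal \<bar>\<integral>\<theta>. (h (?Z \<theta>) - m) \<partial>Post\<bar> \<le> ennreal (2 * x + \<bar>\<integral>\<theta>. R \<theta> \<partial>Post\<bar>)"
        unfolding split using b1 by (intro ennreal_leI) linarith
      also have "\<dots> = ennreal (2 * x) + ennreal \<bar>\<integral>\<theta>. R \<theta> \<partial>Post\<bar>" using x by (intro ennreal_plus) auto
      also have "\<dots> \<le> ennreal (2 * x) + (?R)"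
        by (rule add_left_mono[OF b2])
      finally show ?thesis unfolding m_def by (simp only: add.assoc)
    qed
    show ?thesis unfolding x_def[symmetric]
    proof (rule le_stein_bound[OF \<sigma> n x])
      show "ennreal (dBL (distr Post borel ?Z) (?N))
        \<le> ennreal (2 * x) + ennreal (4 / (\<sigma> * ?s)) * ?A1 + ennreal (4 / \<sigma> * ?s) * ?A2 + ennreal (4 / \<sigma>\<^sup>2) * ?A3"
      proof (rule dBL_le[OF prob_space_axioms _ bound])
        show "?Z \<in> borel_measurable Post" by measurable
      qed
    qed
  qed
qed

end

lemma (in riemannian_mfd) ddir_diff_scaled:
  assumes "C1_on pt f" "C1_on pt h" "\<theta> \<in> pt"
  shows "ddir V (\<lambda>\<theta>. f \<theta> + a * h \<theta>) \<theta> = ddir V f \<theta> + a * ddir V h \<theta>"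
proof -
  note c = chart_at[OF assms(3)]
  have "ddir V (\<lambda>\<theta>. f \<theta> + a * h \<theta>) \<theta> = ddir V f \<theta> + ddir V (\<lambda>\<theta>. a * h \<theta>) \<theta>"
    unfolding ddir_def by (rule dird_add[OF assms(1) C1_on_cmult[OF openin_topspace assms(2)] assms(3) c])
  also have "ddir V (\<lambda>\<theta>. a * h \<theta>) \<theta> = ddir V (\<lambda>_. a) \<theta> * h \<theta> + a * ddir V h \<theta>"
    unfolding ddir_def by (rule dird_mult[OF C1_on_const assms(2,3) c])
  also have "ddir V (\<lambda>_. a) \<theta> = 0"
    unfolding ddir_def dird_def by (simp add: chart_derivI[OF DERIV_const])
  finally show ?thesis by simp
qed

theorem theorem1:
  fixes \<sigma> :: real
    and P0 :: "'x measure"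
    and M :: "nat \<Rightarrow> 'a manifold"
    and lam :: "nat \<Rightarrow> 'x measure"
    and P :: "nat \<Rightarrow> 'a \<Rightarrow> 'x measure"
    and ell :: "nat \<Rightarrow> 'a \<Rightarrow> 'x \<Rightarrow> real"
    and vol :: "nat \<Rightarrow> 'a measure"
    and prior_dens :: "nat \<Rightarrow> 'a \<Rightarrow> real"
    and \<Phi> :: "nat \<Rightarrow> 'a \<Rightarrow> real"
    and \<Psi>0 :: "nat \<Rightarrow> (nat \<Rightarrow> 'x) \<Rightarrow> real"
    and V :: "nat \<Rightarrow> 'a vfield"
    and chi :: "nat \<Rightarrow> 'a \<Rightarrow> real"
    and Q :: "nat \<Rightarrow> (nat \<Rightarrow> 'x) measure"
    and g :: "nat \<Rightarrow> 'a metric"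
    and Prior :: "nat \<Rightarrow> 'a measure"
    and Post :: "nat \<Rightarrow> (nat \<Rightarrow> 'x) \<Rightarrow> 'a measure"
    and divV :: "nat \<Rightarrow> 'a \<Rightarrow> real"
    and \<Phi>hat :: "nat \<Rightarrow> (nat \<Rightarrow> 'x) \<Rightarrow> 'a \<Rightarrow> real"
    and A0 A1 A2 A3 B2 B3 :: "nat \<Rightarrow> (nat \<Rightarrow> 'x) \<Rightarrow> ennreal"
  defines "Q \<equiv> \<lambda>n. Pi\<^sub>M {..<n} (\<lambda>_. P0)"
    and "g \<equiv> \<lambda>n. fisher_metric (P n) (ell n)"
    and "Prior \<equiv> \<lambda>n. density (vol n) (\<lambda>\<theta>. ennreal (prior_dens n \<theta>))"
    and "Post \<equiv> \<lambda>n X. posterior (Prior n) (log_lik (ell n) n X)"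
    and "divV \<equiv> \<lambda>n. weighted_div (M n) (g n) (prior_dens n) (V n)"
    and "\<Phi>hat \<equiv> \<lambda>n X \<theta>. \<Phi> n \<theta> +
           metric_inner (M n) (g n) (V n) (grad (M n) (g n) (log_lik (ell n) n X)) \<theta> / real n"
    and "A0 \<equiv> \<lambda>n X. ennreal (1 - (\<integral>\<theta>. chi n \<theta> \<partial>Post n X))"
    and "A1 \<equiv> \<lambda>n X. \<integral>\<^sup>+\<theta>. ennreal
           \<bar>metric_inner (M n) (g n) (grad (M n) (g n) (chi n)) (V n) \<theta>\<bar> \<partial>Post n X"
    and "A2 \<equiv> \<lambda>n X. SUP \<theta>\<in>msupport (M n) (chi n). ennreal
           \<bar>\<Phi>hat n X \<theta> - \<Psi>0 n X + divV n \<theta> / real n\<bar>"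
    and "A3 \<equiv> \<lambda>n X. SUP \<theta>\<in>msupport (M n) (chi n). ennreal
           \<bar>\<sigma>\<^sup>2 - metric_inner (M n) (g n) (grad (M n) (g n) (\<Phi> n)) (V n) \<theta>\<bar>"
    and "B2 \<equiv> \<lambda>n X. SUP \<theta>\<in>msupport (M n) (chi n). ennreal
           \<bar>\<Phi>hat n X \<theta> - \<Psi>0 n X\<bar>"
    and "B3 \<equiv> \<lambda>n X. SUP \<theta>\<in>msupport (M n) (chi n). ennreal
           \<bar>\<sigma>\<^sup>2 - metric_inner (M n) (g n) (grad (M n) (g n) (\<Phi> n)) (V n) \<theta> +
            metric_inner (M n) (g n) (grad (M n) (g n) (divV n)) (V n) \<theta> / real n\<bar>"
  assumes sigma: "\<sigma> > 0"
    and P0: "prob_space P0" "\<And>n. n \<ge> 1 \<Longrightarrow> sets (lam n) = sets P0"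
    and model: "\<And>n. n \<ge> 1 \<Longrightarrow> statistical_model (M n) (lam n) (P n) (ell n)"
    and fisher: "\<And>n. n \<ge> 1 \<Longrightarrow> fisher_integrable (M n) (P n) (ell n)"
      "\<And>n. n \<ge> 1 \<Longrightarrow> riemannian_metric (M n) (g n)"
    and vol: "\<And>n. n \<ge> 1 \<Longrightarrow> riemannian_volume (M n) (g n) (vol n)"
    and prior: "\<And>n. n \<ge> 1 \<Longrightarrow> Ck_on (M n) 1 (prior_dens n)"
      "\<And>n \<theta>. n \<ge> 1 \<Longrightarrow> \<theta> \<in> mfd_points (M n) \<Longrightarrow> prior_dens n \<theta> > 0"
    and lik_integrable:
      "\<And>n. n \<ge> 1 \<Longrightarrow> AE X in Q n. integrable (Prior n) (\<lambda>\<theta>. exp (log_lik (ell n) n X \<theta>))"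
    and Phi: "\<And>n. n \<ge> 1 \<Longrightarrow> Ck_on (M n) 1 (\<Phi> n)"
    and Psi0: "\<And>n. n \<ge> 1 \<Longrightarrow> \<Psi>0 n \<in> borel_measurable (Q n)"
    and V: "\<And>n. n \<ge> 1 \<Longrightarrow> Ck_vfield (M n) 1 (V n)"
    and chi: "\<And>n. n \<ge> 1 \<Longrightarrow> Ck_on (M n) 1 (chi n)"
      "\<And>n \<theta>. n \<ge> 1 \<Longrightarrow> \<theta> \<in> mfd_points (M n) \<Longrightarrow> 0 \<le> chi n \<theta> \<and> chi n \<theta> \<le> 1"
      "\<And>n. n \<ge> 1 \<Longrightarrow> compactin (mfd_top (M n)) (msupport (M n) (chi n))"
    and A0: "little_op Q A0 (\<lambda>_. 1)"
    and A1: "little_op Q A1 (\<lambda>n. sqrt (real n))"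
  shows
    "(little_op Q A2 (\<lambda>n. 1 / sqrt (real n)) \<and> little_op Q A3 (\<lambda>_. 1) \<longrightarrow>
        (\<forall>n\<ge>1. \<forall>X\<in>space (Q n). integrable (Prior n) (\<lambda>\<theta>. exp (log_lik (ell n) n X \<theta>)) \<longrightarrow>
           ennreal (dBL (distr (Post n X) borel (\<lambda>\<theta>. sqrt (real n) * (\<Phi> n \<theta> - \<Psi>0 n X)))
                        (density lborel (\<lambda>x. ennreal (normal_density 0 \<sigma> x))))
           \<le> stein_bound \<sigma> n (A0 n X) (A1 n X) (A2 n X) (A3 n X)) \<and>
        little_op Q (\<lambda>n X. stein_bound \<sigma> n (A0 n X) (A1 n X) (A2 n X) (A3 n X)) (\<lambda>_. 1)) \<and>
     ((\<forall>n\<ge>1. Ck_on (M n) 1 (divV n)) \<and>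
        little_op Q B2 (\<lambda>n. 1 / sqrt (real n)) \<and> little_op Q B3 (\<lambda>_. 1) \<longrightarrow>
        (\<forall>n\<ge>1. \<forall>X\<in>space (Q n). integrable (Prior n) (\<lambda>\<theta>. exp (log_lik (ell n) n X \<theta>)) \<longrightarrow>
           ennreal (dBL (distr (Post n X) borel
                           (\<lambda>\<theta>. sqrt (real n) * (\<Phi> n \<theta> - divV n \<theta> / real n - \<Psi>0 n X)))
                        (density lborel (\<lambda>x. ennreal (normal_density 0 \<sigma> x))))
           \<le> stein_bound \<sigma> n (A0 n X) (A1 n X) (B2 n X) (B3 n X)) \<and>
        little_op Q (\<lambda>n X. stein_bound \<sigma> n (A0 n X) (A1 n X) (B2 n X) (B3 n X)) (\<lambda>_. 1))"
proof -
  have bound: "ennreal (dBL (distr (Post n X) borel (\<lambda>\<theta>. sqrt (real n) * (\<Psi> \<theta> - \<Psi>0 n X)))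
        (density lborel (\<lambda>x. ennreal (normal_density 0 \<sigma> x))))
      \<le> stein_bound \<sigma> n (A0 n X) (A1 n X) (SUP \<theta>\<in>msupport (M n) (chi n). ennreal \<bar>E2 \<theta>\<bar>) (SUP \<theta>\<in>msupport (M n) (chi n). ennreal \<bar>E3 \<theta>\<bar>)"
    if n: "n \<ge> 1" and X: "X \<in> space (Q n)" and int: "integrable (Prior n) (\<lambda>\<theta>. exp (log_lik (ell n) n X \<theta>))"
      and \<Psi>: "Ck_on (M n) 1 \<Psi>"
      and E2: "\<And>\<theta>. \<theta> \<in> mfd_points (M n) \<Longrightarrow> E2 \<theta> = \<Psi> \<theta> - \<Psi>0 n X +
        (metric_inner (M n) (g n) (V n) (grad (M n) (g n) (log_lik (ell n) n X)) \<theta> + divV n \<theta>) / real n"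
      and E3: "\<And>\<theta>. \<theta> \<in> mfd_points (M n) \<Longrightarrow> E3 \<theta> = \<sigma>\<^sup>2 - metric_inner (M n) (g n) (grad (M n) (g n) \<Psi>) (V n) \<theta>"
    for n X \<Psi> E2 E3
  proof -
    interpret riemannian_mfd "M n" "g n" "vol n"
      using model[OF n] fisher(2)[OF n] vol[OF n] by unfold_locales (auto simp: statistical_model_def)
    \<comment> \<open>The data live in the space of \<open>P0\<close>, while regularity of
      \<open>ell\<close> is assumed on that of \<open>lam n\<close>; equal sigma-algebras have equal
      spaces.\<close>
    have Xi: "X i \<in> space (lam n)" if "i < n" for i
      using X that sets_eq_imp_space_eq[OF P0(2)[OF n]] by (auto simp: Q_def space_PiM PiE_def Pi_def)
    have "C1_on (mfd_points (M n)) (\<lambda>\<theta>. ell n \<theta> (X i))" if "i < n" for i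
      using model[OF n] Xi[OF that] unfolding statistical_model_def Ck_on_1_iff[symmetric] by blast
    then have l: "C1_on (mfd_points (M n)) (log_lik (ell n) n X)"
      unfolding log_lik_def[abs_def] by (intro C1_on_sum openin_topspace) auto
    show ?thesis
      unfolding Post_def Prior_def A0_def A1_def
    proof (rule posterior_stein_bound[OF sigma n V[OF n] prior(1)[OF n, unfolded Ck_on_1_iff] _ l \<Psi>[unfolded Ck_on_1_iff]
          chi(1)[OF n, unfolded Ck_on_1_iff] _ chi(3)[OF n] int[unfolded Prior_def]])
      fix \<theta> assume \<theta>: "\<theta> \<in> mfd_points (M n)"
      show "prior_dens n \<theta> > 0" by (rule prior(2)[OF n \<theta>])
      show "0 \<le> chi n \<theta> \<and> chi n \<theta> \<le> 1" by (rule chi(2)[OF n \<theta>])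
      show "E2 \<theta> = \<Psi> \<theta> - \<Psi>0 n X + (ddir (V n) (log_lik (ell n) n X) \<theta> + weighted_div (M n) (g n) (prior_dens n) (V n) \<theta>) / real n"
        unfolding E2[OF \<theta>] metric_inner_grad(1)[OF \<theta>] ddir_def divV_def ..
      show "E3 \<theta> = \<sigma>\<^sup>2 - ddir (V n) \<Psi> \<theta>"
        unfolding E3[OF \<theta>] metric_inner_grad(2)[OF \<theta>] ddir_def ..
    qed
  qed
  have 1: "ennreal (dBL (distr (Post n X) borel (\<lambda>\<theta>. sqrt (real n) * (\<Phi> n \<theta> - \<Psi>0 n X)))
        (density lborel (\<lambda>x. ennreal (normal_density 0 \<sigma> x))))
      \<le> stein_bound \<sigma> n (A0 n X) (A1 n X) (A2 n X) (A3 n X)"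
    if "n \<ge> 1" "X \<in> space (Q n)" "integrable (Prior n) (\<lambda>\<theta>. exp (log_lik (ell n) n X \<theta>))" for n X
    unfolding A2_def A3_def
    by (rule bound[OF that Phi[OF that(1)]]) (simp_all add: \<Phi>hat_def add_divide_distrib)
  have 2: "ennreal (dBL (distr (Post n X) borel (\<lambda>\<theta>. sqrt (real n) * (\<Phi> n \<theta> - divV n \<theta> / real n - \<Psi>0 n X)))
        (density lborel (\<lambda>x. ennreal (normal_density 0 \<sigma> x))))
      \<le> stein_bound \<sigma> n (A0 n X) (A1 n X) (B2 n X) (B3 n X)"
    if n: "n \<ge> 1" and X: "X \<in> space (Q n)" "integrable (Prior n) (\<lambda>\<theta>. exp (log_lik (ell n) n X \<theta>))"
      and div: "Ck_on (M n) 1 (divV n)" for n X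
  proof -
    interpret riemannian_mfd "M n" "g n" "vol n"
      using model[OF n] fisher(2)[OF n] vol[OF n] by unfold_locales (auto simp: statistical_model_def)
    \<comment> \<open>Subtracting the divergence here cancels it in the corrected functional, which
      is why \<open>B2\<close> has no divergence term; in exchange its derivative along
      \<open>V\<close> appears in \<open>B3\<close>.\<close>
    let ?\<Psi> = "\<lambda>\<theta>. \<Phi> n \<theta> - divV n \<theta> / real n"
    have e: "?\<Psi> = (\<lambda>\<theta>. \<Phi> n \<theta> + (- 1 / real n) * divV n \<theta>)" by (simp add: fun_eq_iff)
    note C = Phi[OF n, unfolded Ck_on_1_iff] div[unfolded Ck_on_1_iff]
    have "C1_on (mfd_points (M n)) ?\<Psi>"
      unfolding e by (rule C1_on_add[OF openin_topspace C(1) C1_on_cmult[OF openin_topspace C(2)]])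
    then have \<Psi>: "Ck_on (M n) 1 ?\<Psi>" unfolding Ck_on_1_iff .
    show ?thesis unfolding B2_def B3_def
    proof (rule bound[OF n X \<Psi>])
      fix \<theta> assume \<theta>: "\<theta> \<in> mfd_points (M n)"
      show "\<Phi>hat n X \<theta> - \<Psi>0 n X = ?\<Psi> \<theta> - \<Psi>0 n X +
          (metric_inner (M n) (g n) (V n) (grad (M n) (g n) (log_lik (ell n) n X)) \<theta> + divV n \<theta>) / real n"
        by (simp add: \<Phi>hat_def add_divide_distrib)
      have "ddir (V n) ?\<Psi> \<theta> = ddir (V n) (\<Phi> n) \<theta> + (- 1 / real n) * ddir (V n) (divV n) \<theta>"
        unfolding e by (rule ddir_diff_scaled[OF C \<theta>])
      then show "\<sigma>\<^sup>2 - metric_inner (M n) (g n) (grad (M n) (g n) (\<Phi> n)) (V n) \<theta> +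
          metric_inner (M n) (g n) (grad (M n) (g n) (divV n)) (V n) \<theta> / real n =
          \<sigma>\<^sup>2 - metric_inner (M n) (g n) (grad (M n) (g n) ?\<Psi>) (V n) \<theta>"
        unfolding metric_inner_grad(2)[OF \<theta>] ddir_def[symmetric] by simp
    qed
  qed
  show ?thesis
    using 1 2 little_op_stein_bound[OF sigma A0 A1] by blast
qed

end
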